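(* Let $M$ be a compact contact manifold with contact form $\theta$, and suppose a compact Lie group $G$ with Lie algebra $\mathfrak{g}$ acts on $M$ preserving $\theta$. For $X\in\mathfrak{g}$ let $X_M$ be the vector field on $M$ generated by the infinitesimal action of $X$, and let $\Phi^X_\theta=\theta(X_M)\in C^\infty(M)$. With respect to the Jacobi structure determined by $\theta$: (1) the map $\mathfrak{g}\to C^\infty(M)$, $X\mapsto\Phi^X_\theta$, is a Lie algebra homomorphism, where $C^\infty(M)$ carries the Jacobi bracket; (2) for every $X\in\mathfrak{g}$, the Hamiltonian vector field associated to the function $\Phi^X_\theta$ is equal to $X_M$.
   Context: $M$ is a compact manifold of dimension $2n+1$ with a cooriented contact distribution $E=\ker\theta\subset TM$, where $\theta$ is a global contact form, i.e. $\theta\wedge(d\theta)^n$ is nowhere zero. The Reeb field $\xi$ is the unique vector field with $\theta(\xi)=1$ and $\iota(\xi)d\theta=0$. The bundle map $\Lambda^\#:T^*M\to TM$ is determined by: for every $\eta\in T^*M$, $\theta(\Lambda^\#\eta)=0$ and $\iota(\Lambda^\#\eta)d\theta=\eta(\xi)\theta-\eta$. For $f\in C^\infty(M)$, the Hamiltonian vector field is $X_f=\Lambda^\#(df)+f\xi$. The Jacobi bracket is $\{f,g\}=X_f\cdot g-g\,(\xi\cdot f)$; it is a Lie bracket on $C^\infty(M)$. The functions $\Phi_\theta^X=\langle\Phi_\theta,X\rangle$ are the components of the contact momentum map $\Phi_\theta:M\to\mathfrak{g}^*$. Sign convention: $X_M(x)=\frac{d}{dt}\big|_{t=0}\exp(-tX)\cdot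 x$, so that $X\mapsto X_M$ is a Lie algebra homomorphism, $[X,Y]_M=[X_M,Y_M]$. *)

theory Defs
  imports "HOL-Analysis.Analysis" "HOL-Algebra.Group_Action"
begin

text \<open>Only meaningful for open \<open>S\<close> and finite-dimensional \<open>'a\<close>, where continuity of all
  iterated directional derivatives amounts to \<open>C\<^sup>k\<close> in the Frechet sense.\<close>

primrec Ck_on :: "nat \<Rightarrow> 'a::real_normed_vector set \<Rightarrow> ('a \<Rightarrow> 'b::real_normed_vector) \<Rightarrow> bool" where
  "Ck_on 0 S f \<longleftrightarrow> continuous_on S f"
| "Ck_on (Suc k) S f \<longleftrightarrow> (\<forall>x\<in>S. f differentiable (at x)) \<and>
     (\<forall>v. Ck_on k S (\<lambda>x. frechet_derivative f (at x) v))"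

definition smooth_on :: "'a::real_normed_vector set \<Rightarrow> ('a \<Rightarrow> 'b::real_normed_vector) \<Rightarrow> bool" where
  "smooth_on S f \<longleftrightarrow> (\<forall>k. Ck_on k S f)"

text \<open>A manifold is a whole type with an atlas of charts \<open>(U, \<phi>)\<close>; only the values of \<open>\<phi>\<close> on
  \<open>U\<close> matter. The model space \<open>'e\<close> is any finite-dimensional normed space rather than a
  \<open>euclidean_space\<close>, since the latter has positive dimension and would exclude finite Lie groups.\<close>

type_synonym ('m, 'e) chart = "'m set \<times> ('m \<Rightarrow> 'e)"
type_synonym ('m, 'e) atlas = "('m, 'e) chart set"

definition chart_inv :: "('m, 'e) chart \<Rightarrow> 'e \<Rightarrow> 'm" where
  "chart_inv c = inv_into (fst c) (snd c)"

definition smooth_atlas :: "('m::topological_space, 'e::real_normed_vector) atlas \<Rightarrow> bool" where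
  "smooth_atlas A \<longleftrightarrow>
     (\<exists>S::'e set. finite S \<and> span S = UNIV) \<and>
     (\<Union>c\<in>A. fst c) = UNIV \<and>
     (\<forall>c\<in>A. open (fst c) \<and> open (snd c ` fst c) \<and>
        homeomorphism (fst c) (snd c ` fst c) (snd c) (chart_inv c)) \<and>
     (\<forall>c\<in>A. \<forall>d\<in>A. smooth_on (snd c ` (fst c \<inter> fst d)) (snd d \<circ> chart_inv c))"

definition std_atlas :: "('e, 'e) atlas" where
  "std_atlas = {(UNIV, id)}"

definition prod_atlas :: "('m, 'e) atlas \<Rightarrow> ('k, 'f) atlas \<Rightarrow> ('m \<times> 'k, 'e \<times> 'f) atlas" where
  "prod_atlas A B = {(fst c \<times> fst d, map_prod (snd c) (snd d)) |c d. c \<in> A \<and> d \<in> B}"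

definition smooth_map :: "('m::topological_space, 'e::real_normed_vector) atlas \<Rightarrow>
    ('k::topological_space, 'f::real_normed_vector) atlas \<Rightarrow> ('m \<Rightarrow> 'k) \<Rightarrow> bool" where
  "smooth_map A B f \<longleftrightarrow> continuous_on UNIV f \<and>
     (\<forall>c\<in>A. \<forall>d\<in>B. smooth_on (snd c ` (fst c \<inter> f -` fst d)) (snd d \<circ> f \<circ> chart_inv c))"

definition smooth_functions :: "('m::topological_space, 'e::real_normed_vector) atlas \<Rightarrow> ('m \<Rightarrow> real) set" where
  "smooth_functions A = {f. smooth_map A std_atlas f}"

text \<open>Tangent spaces: a preferred chart is chosen around every point \<open>p\<close>, and the tangent space at
  \<open>p\<close> is the model space, a tangent vector being given by its components in the preferred chart
  at \<open>p\<close>. Preferred charts vary from point to point, so comparing tangent vectors at different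
  points, or with components in another chart, always goes through \<open>tangent_map\<close>. A vector field is
  a function \<open>'m \<Rightarrow> 'e\<close> and a 1-form a function \<open>'m \<Rightarrow> 'e \<Rightarrow> real\<close> in this sense.\<close>

definition chart_at :: "('m, 'e) atlas \<Rightarrow> 'm \<Rightarrow> ('m, 'e) chart" where
  "chart_at A p = (SOME c. c \<in> A \<and> p \<in> fst c)"

definition tangent_map :: "('m, 'e::real_normed_vector) atlas \<Rightarrow> ('k, 'f::real_normed_vector) atlas \<Rightarrow>
    ('m \<Rightarrow> 'k) \<Rightarrow> 'm \<Rightarrow> 'e \<Rightarrow> 'f" where
  "tangent_map A B f p =
     frechet_derivative (snd (chart_at B (f p)) \<circ> f \<circ> chart_inv (chart_at A p))
       (at (snd (chart_at A p) p))"

definition velocity :: "('m, 'e::real_normed_vector) atlas \<Rightarrow> (real \<Rightarrow> 'm) \<Rightarrow> real \<Rightarrow> 'e" where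
  "velocity A \<gamma> t = tangent_map std_atlas A \<gamma> t 1"

definition differential :: "('m, 'e::real_normed_vector) atlas \<Rightarrow> ('m \<Rightarrow> real) \<Rightarrow> 'm \<Rightarrow> 'e \<Rightarrow> real" where
  "differential A f p = tangent_map A std_atlas f p"

definition vf_apply :: "('m, 'e::real_normed_vector) atlas \<Rightarrow> ('m \<Rightarrow> 'e) \<Rightarrow> ('m \<Rightarrow> real) \<Rightarrow> 'm \<Rightarrow> real" where
  "vf_apply A X f = (\<lambda>p. differential A f p (X p))"

definition local_field :: "('m, 'e::real_normed_vector) atlas \<Rightarrow> ('m, 'e) chart \<Rightarrow> ('m \<Rightarrow> 'e) \<Rightarrow> 'e \<Rightarrow> 'e" where
  "local_field A c X x = tangent_map A std_atlas (snd c) (chart_inv c x) (X (chart_inv c x))"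

text \<open>The bracket with \<open>[X, Y] \<cdot> f = X \<cdot> (Y \<cdot> f) - Y \<cdot> (X \<cdot> f)\<close>, in coordinates.\<close>

definition vf_bracket :: "('m, 'e::real_normed_vector) atlas \<Rightarrow> ('m \<Rightarrow> 'e) \<Rightarrow> ('m \<Rightarrow> 'e) \<Rightarrow> 'm \<Rightarrow> 'e" where
  "vf_bracket A X Y p =
     (let c = chart_at A p; x = snd c p; X' = local_field A c X; Y' = local_field A c Y
      in frechet_derivative Y' (at x) (X' x) - frechet_derivative X' (at x) (Y' x))"

definition local_form :: "('m, 'e::real_normed_vector) atlas \<Rightarrow> ('m, 'e) chart \<Rightarrow> ('m \<Rightarrow> 'e \<Rightarrow> real) \<Rightarrow>
    'e \<Rightarrow> 'e \<Rightarrow> real" where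
  "local_form A c \<theta> x w = \<theta> (chart_inv c x) (tangent_map std_atlas A (chart_inv c) x w)"

definition smooth_one_form :: "('m, 'e::real_normed_vector) atlas \<Rightarrow> ('m \<Rightarrow> 'e \<Rightarrow> real) \<Rightarrow> bool" where
  "smooth_one_form A \<theta> \<longleftrightarrow> (\<forall>p. linear (\<theta> p)) \<and>
     (\<forall>c\<in>A. \<forall>w. smooth_on (snd c ` fst c) (\<lambda>x. local_form A c \<theta> x w))"

text \<open>Exterior derivative of a 1-form in coordinates, in the normalisation
  \<open>d\<theta>(X, Y) = X \<cdot> \<theta>(Y) - Y \<cdot> \<theta>(X) - \<theta>([X, Y])\<close>.\<close>

definition ext_deriv :: "('m, 'e::real_normed_vector) atlas \<Rightarrow> ('m \<Rightarrow> 'e \<Rightarrow> real) \<Rightarrow> 'm \<Rightarrow> 'e \<Rightarrow> 'e \<Rightarrow> real" where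
  "ext_deriv A \<theta> p u v =
     (let c = chart_at A p; x = snd c p
      in frechet_derivative (\<lambda>y. local_form A c \<theta> y v) (at x) u
       - frechet_derivative (\<lambda>y. local_form A c \<theta> y u) (at x) v)"

text \<open>An alternating \<open>k\<close>-form on a vector space is a function of a sequence of vectors that only
  looks at the entries \<open>0, \<dots>, k - 1\<close>.\<close>

definition wedge :: "nat \<Rightarrow> nat \<Rightarrow> ((nat \<Rightarrow> 'e) \<Rightarrow> real) \<Rightarrow> ((nat \<Rightarrow> 'e) \<Rightarrow> real) \<Rightarrow> (nat \<Rightarrow> 'e) \<Rightarrow> real" where
  "wedge k l \<alpha> \<beta> v =
     (\<Sum>\<sigma> | \<sigma> permutes {..<k + l}.
        of_int (sign \<sigma>) * \<alpha> (\<lambda>i. v (\<sigma> i)) * \<beta> (\<lambda>i. v (\<sigma> (k + i)))) / (fact k * fact l)"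

primrec wedge_power :: "((nat \<Rightarrow> 'e) \<Rightarrow> real) \<Rightarrow> nat \<Rightarrow> (nat \<Rightarrow> 'e) \<Rightarrow> real" where
  "wedge_power \<omega> 0 = (\<lambda>v. 1)"
| "wedge_power \<omega> (Suc n) = wedge 2 (2 * n) \<omega> (wedge_power \<omega> n)"

definition contact_form :: "('m::topological_space, 'e::euclidean_space) atlas \<Rightarrow> nat \<Rightarrow>
    ('m \<Rightarrow> 'e \<Rightarrow> real) \<Rightarrow> bool" where
  "contact_form A n \<theta> \<longleftrightarrow> DIM('e) = 2 * n + 1 \<and> smooth_one_form A \<theta> \<and>
     (\<forall>p. \<exists>v. wedge 1 (2 * n) (\<lambda>w. \<theta> p (w 0))
               (wedge_power (\<lambda>w. ext_deriv A \<theta> p (w 0) (w 1)) n) v \<noteq> 0)"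

text \<open>The conditions on the Reeb field and on \<open>\<Lambda>\<^sup>#\<close> are pointwise and have a unique solution at each
  point when \<open>\<theta>\<close> is a contact form; smoothness of the Reeb field is a consequence.\<close>

definition reeb :: "('m, 'e::real_normed_vector) atlas \<Rightarrow> ('m \<Rightarrow> 'e \<Rightarrow> real) \<Rightarrow> 'm \<Rightarrow> 'e" where
  "reeb A \<theta> p = (THE v. \<theta> p v = 1 \<and> (\<forall>w. ext_deriv A \<theta> p v w = 0))"

text \<open>The bundle map \<open>\<Lambda>\<^sup>#\<close>, for a covector \<open>\<eta>\<close> at \<open>p\<close>.\<close>

definition sharp :: "('m, 'e::real_normed_vector) atlas \<Rightarrow> ('m \<Rightarrow> 'e \<Rightarrow> real) \<Rightarrow> 'm \<Rightarrow> ('e \<Rightarrow> real) \<Rightarrow> 'e" where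
  "sharp A \<theta> p \<eta> = (THE v. \<theta> p v = 0 \<and>
     (\<forall>w. ext_deriv A \<theta> p v w = \<eta> (reeb A \<theta> p) * \<theta> p w - \<eta> w))"

definition hamiltonian_field :: "('m, 'e::real_normed_vector) atlas \<Rightarrow> ('m \<Rightarrow> 'e \<Rightarrow> real) \<Rightarrow>
    ('m \<Rightarrow> real) \<Rightarrow> 'm \<Rightarrow> 'e" where
  "hamiltonian_field A \<theta> f p = sharp A \<theta> p (differential A f p) + f p *\<^sub>R reeb A \<theta> p"

definition jacobi_bracket :: "('m, 'e::real_normed_vector) atlas \<Rightarrow> ('m \<Rightarrow> 'e \<Rightarrow> real) \<Rightarrow>
    ('m \<Rightarrow> real) \<Rightarrow> ('m \<Rightarrow> real) \<Rightarrow> 'm \<Rightarrow> real" where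
  "jacobi_bracket A \<theta> f g =
     (\<lambda>p. vf_apply A (hamiltonian_field A \<theta> f) g p - g p * vf_apply A (reeb A \<theta>) f p)"

definition lie_group :: "'g::topological_space monoid \<Rightarrow> ('g, 'h::real_normed_vector) atlas \<Rightarrow> bool" where
  "lie_group G B \<longleftrightarrow> group G \<and> carrier G = UNIV \<and> smooth_atlas B \<and>
     smooth_map (prod_atlas B B) B (\<lambda>(g, h). g \<otimes>\<^bsub>G\<^esub> h) \<and>
     smooth_map B B (\<lambda>g. inv\<^bsub>G\<^esub> g)"

text \<open>The Lie algebra of \<open>G\<close> is the tangent space at the identity, i.e. the type \<open>'h\<close>, with the
  bracket coming from left-invariant vector fields.\<close>

definition left_inv_field :: "'g monoid \<Rightarrow> ('g, 'h::real_normed_vector) atlas \<Rightarrow> 'h \<Rightarrow> 'g \<Rightarrow> 'h" where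
  "left_inv_field G B X g = tangent_map B B (\<lambda>h. g \<otimes>\<^bsub>G\<^esub> h) \<one>\<^bsub>G\<^esub> X"

definition lie_bracket :: "'g monoid \<Rightarrow> ('g, 'h::real_normed_vector) atlas \<Rightarrow> 'h \<Rightarrow> 'h \<Rightarrow> 'h" where
  "lie_bracket G B X Y = vf_bracket B (left_inv_field G B X) (left_inv_field G B Y) \<one>\<^bsub>G\<^esub>"

definition one_param_subgroup :: "'g::topological_space monoid \<Rightarrow> ('g, 'h::real_normed_vector) atlas \<Rightarrow>
    (real \<Rightarrow> 'g) \<Rightarrow> bool" where
  "one_param_subgroup G B \<gamma> \<longleftrightarrow> smooth_map std_atlas B \<gamma> \<and> (\<forall>s t. \<gamma> (s + t) = \<gamma> s \<otimes>\<^bsub>G\<^esub> \<gamma> t)"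

definition lie_exp :: "'g::topological_space monoid \<Rightarrow> ('g, 'h::real_normed_vector) atlas \<Rightarrow> 'h \<Rightarrow> 'g" where
  "lie_exp G B X = (THE \<gamma>. one_param_subgroup G B \<gamma> \<and> velocity B \<gamma> 0 = X) 1"

definition smooth_action :: "'g::topological_space monoid \<Rightarrow> ('g, 'h::real_normed_vector) atlas \<Rightarrow>
    ('m::topological_space, 'e::real_normed_vector) atlas \<Rightarrow> ('g \<Rightarrow> 'm \<Rightarrow> 'm) \<Rightarrow> bool" where
  "smooth_action G B A act \<longleftrightarrow> group_action G UNIV act \<and>
     smooth_map (prod_atlas B A) A (\<lambda>(g, p). act g p)"

definition preserves_form :: "('m, 'e::real_normed_vector) atlas \<Rightarrow> ('g \<Rightarrow> 'm \<Rightarrow> 'm) \<Rightarrow>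
    ('m \<Rightarrow> 'e \<Rightarrow> real) \<Rightarrow> bool" where
  "preserves_form A act \<theta> \<longleftrightarrow>
     (\<forall>g p v. \<theta> (act g p) (tangent_map A A (act g) p v) = \<theta> p v)"

text \<open>Sign convention: \<open>exp (-tX)\<close>, which makes \<open>X \<mapsto> X_M\<close> a homomorphism rather than an
  antihomomorphism.\<close>

definition fundamental_field :: "'g::topological_space monoid \<Rightarrow> ('g, 'h::real_normed_vector) atlas \<Rightarrow>
    ('m, 'e::real_normed_vector) atlas \<Rightarrow> ('g \<Rightarrow> 'm \<Rightarrow> 'm) \<Rightarrow> 'h \<Rightarrow> 'm \<Rightarrow> 'e" where
  "fundamental_field G B A act X p = velocity A (\<lambda>t. act (lie_exp G B (- (t *\<^sub>R X))) p) 0"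

definition momentum :: "'g::topological_space monoid \<Rightarrow> ('g, 'h::real_normed_vector) atlas \<Rightarrow>
    ('m, 'e::real_normed_vector) atlas \<Rightarrow> ('g \<Rightarrow> 'm \<Rightarrow> 'm) \<Rightarrow> ('m \<Rightarrow> 'e \<Rightarrow> real) \<Rightarrow> 'h \<Rightarrow> 'm \<Rightarrow> real" where
  "momentum G B A act \<theta> X = (\<lambda>p. \<theta> p (fundamental_field G B A act X p))"

end

theory Submission
  imports Defs
begin

text \<open>Write \<open>F\<^sub>X\<close> for the fundamental field of \<open>X\<close>, \<open>\<Phi>\<^sub>X = \<theta>(F\<^sub>X)\<close>, and \<open>\<xi>\<close> for the Reeb field. Everything
follows from three facts.

\<^item> Since \<open>t \<mapsto> exp(-tX)\<close> is a curve through the identity with velocity \<open>-X\<close>, the value \<open>F\<^sub>X(p)\<close> is the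
  image of \<open>-X\<close> under the tangent map of \<open>g \<mapsto> g p\<close> at the identity (\<open>fund_eq\<close>). So \<open>F\<^sub>X\<close> is
  linear in \<open>X\<close>, and it is smooth because the action is.
\<^item> The map \<open>g \<mapsto> g\<^sup>-\<^sup>1 p\<close> carries the left-invariant field of \<open>X\<close> to \<open>F\<^sub>X\<close>. Brackets of related
  fields are related, hence \<open>F\<^bsub>[X,Y]\<^esub> = [F\<^sub>X, F\<^sub>Y]\<close> (\<open>fund_lie_bracket\<close>).
\<^item> Differentiating \<open>g\<^sup>*\<theta> = \<theta>\<close> at the identity shows that the Lie derivative of \<open>\<theta>\<close>
  along \<open>F\<^sub>X\<close> vanishes (\<open>lie_derivative_zero\<close>).

The last fact has two consequences: \<open>\<iota>(F\<^sub>X) d\<theta> = - d\<Phi>\<^sub>X\<close> (\<open>contraction_ext_deriv\<close>) and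
\<open>F\<^sub>X \<cdot> \<Phi>\<^sub>Y = \<theta>([F\<^sub>X, F\<^sub>Y]) = \<Phi>\<^bsub>[X,Y]\<^esub>\<close> (\<open>momentum_derivative_along_fund\<close>). The first one shows
\<open>\<xi> \<cdot> \<Phi>\<^sub>X = - d\<theta>(F\<^sub>X, \<xi>) = 0\<close>, so \<open>F\<^sub>X - \<Phi>\<^sub>X \<xi>\<close> satisfies the two equations that determine the vector
\<open>\<Lambda>\<^sup># d\<Phi>\<^sub>X\<close>; that is, the Hamiltonian field of \<open>\<Phi>\<^sub>X\<close> is \<open>F\<^sub>X\<close>. The Jacobi bracket of \<open>\<Phi>\<^sub>X\<close> and \<open>\<Phi>\<^sub>Y\<close> is
then \<open>F\<^sub>X \<cdot> \<Phi>\<^sub>Y - \<Phi>\<^sub>Y (\<xi> \<cdot> \<Phi>\<^sub>X) = \<Phi>\<^bsub>[X,Y]\<^esub>\<close>.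

Two points need foundations. The Reeb vector and \<open>\<Lambda>\<^sup>#\<close> are definite descriptions, so existence and
uniqueness have to be derived from \<open>\<theta> \<and> (d\<theta>)\<^sup>n \<noteq> 0\<close>: uniqueness is \<open>contact_form_nondegenerate\<close>,
and existence holds because a skew form in odd dimension is degenerate (\<open>reeb_vector_exists\<close>).
The exponential map is a definite description too: a one-parameter subgroup with prescribed
velocity is obtained from a local integral curve of the left-invariant field, which is a contraction
fixed point, by extending a local homomorphism from an interval to the line
(\<open>one_param_subgroup_exists\<close>). Its uniqueness, and the homomorphism property of the local
curve, both come from the fact that the quotient of two integral curves has velocity zero
(\<open>quotient_of_integral_curves\<close>).\<close>

section \<open>Smooth maps between vector spaces\<close>

abbreviation D :: "('a::real_normed_vector \<Rightarrow> 'b::real_normed_vector) \<Rightarrow> 'a \<Rightarrow> 'a \<Rightarrow> 'b" where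
  "D f x \<equiv> frechet_derivative f (at x)"

lemma has_derivative_D: "f differentiable at x \<Longrightarrow> (f has_derivative D f x) (at x)"
  by (simp add: frechet_derivative_works)

lemma D_eqI: "(f has_derivative f') (at x) \<Longrightarrow> D f x = f'"
  by (rule frechet_derivative_at[symmetric])

lemma linear_D: "f differentiable at x \<Longrightarrow> linear (D f x)"
  by (rule linear_frechet_derivative)

lemma filterlim_nhds_if_continuous_on:
  "continuous_on S f \<Longrightarrow> open S \<Longrightarrow> x \<in> S \<Longrightarrow> filterlim f (nhds (f x)) (nhds x)"
  by (metis at_within_open continuous_on_def tendsto_at_iff_tendsto_nhds)

lemma Ck_on_cong:
  assumes "open S" and "\<And>x. x \<in> S \<Longrightarrow> f x = g x" and "Ck_on k S f"
  shows "Ck_on k S g"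
  using assms(2,3)
proof (induction k arbitrary: f g)
  case 0
  then show ?case by (auto cong: continuous_on_cong)
next
  case (Suc k)
  have der: "(g has_derivative D f x) (at x)" if "x \<in> S" for x
    using has_derivative_transform_within_open[OF has_derivative_D \<open>open S\<close> that, of f g] Suc.prems that
    by auto
  have "D f x v = D g x v" if "x \<in> S" for x v
    using D_eqI[OF der[OF that]] by simp
  then have "Ck_on k S (\<lambda>x. D g x v)" for v
    using Suc.IH[of "\<lambda>x. D f x v" "\<lambda>x. D g x v"] Suc.prems by auto
  then show ?case
    using der by (auto simp: differentiable_def)
qed

lemma Ck_on_subset: "Ck_on k S f \<Longrightarrow> T \<subseteq> S \<Longrightarrow> Ck_on k T f"
  by (induction k arbitrary: f) (auto intro: continuous_on_subset)

text \<open>Smoothness in the sense of \<open>Ck_on\<close> is a local property because all derivatives are taken with respect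
to full neighbourhoods.\<close>

lemma Ck_on_local:
  assumes "\<And>x. x \<in> S \<Longrightarrow> \<exists>U. open U \<and> x \<in> U \<and> Ck_on k U f"
  shows "Ck_on k S f"
  using assms
proof (induction k arbitrary: f)
  case 0
  have "isCont f x" if "x \<in> S" for x
    using 0[OF that] by (auto simp: continuous_on_eq_continuous_at)
  then show ?case by (simp add: continuous_at_imp_continuous_on)
next
  case (Suc k)
  show ?case
  proof (simp only: Ck_on.simps, intro conjI ballI allI)
    fix x assume "x \<in> S"
    then show "f differentiable at x" using Suc.prems by force
  next
    fix v show "Ck_on k S (\<lambda>x. D f x v)"
      by (rule Suc.IH) (use Suc.prems in fastforce)
  qed
qed

lemma Ck_on_Suc_imp: "Ck_on (Suc k) S f \<Longrightarrow> Ck_on k S f"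
proof (induction k arbitrary: f)
  case 0
  then show ?case
    by (auto intro!: continuous_at_imp_continuous_on differentiable_imp_continuous_within)
next
  case (Suc k)
  then show ?case by (metis Ck_on.simps(2))
qed

lemma Ck_on_const: "Ck_on k S (\<lambda>x. c)"
  by (induction k arbitrary: c) auto

lemma Ck_on_ident: "Ck_on k S (\<lambda>x. x)"
  by (cases k) (auto simp: Ck_on_const)

lemma Ck_on_bounded_linear_comp:
  assumes "bounded_linear L" and "open S" and "Ck_on k S f"
  shows "Ck_on k S (\<lambda>x. L (f x))"
  using assms(3)
proof (induction k arbitrary: f)
  case 0
  then show ?case using bounded_linear.continuous_on[OF assms(1)] by auto
next
  case (Suc k)
  have der: "((\<lambda>x. L (f x)) has_derivative (\<lambda>v. L (D f x v))) (at x)" if "x \<in> S" for x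
    using bounded_linear.has_derivative[OF assms(1) has_derivative_D] Suc.prems that by auto
  have "Ck_on k S (\<lambda>x. L (D f x v))" for v
    using Suc by auto
  then have "Ck_on k S (\<lambda>x. D (\<lambda>x. L (f x)) x v)" for v
    by (rule Ck_on_cong[OF \<open>open S\<close>, rotated]) (simp add: D_eqI[OF der])
  then show ?case using der by (auto simp: differentiable_def)
qed

lemma Ck_on_add:
  assumes "open S" and "Ck_on k S f" and "Ck_on k S g"
  shows "Ck_on k S (\<lambda>x. f x + g x)"
  using assms(2,3)
proof (induction k arbitrary: f g)
  case 0
  then show ?case by (auto intro: continuous_intros)
next
  case (Suc k)
  have der: "((\<lambda>x. f x + g x) has_derivative (\<lambda>v. D f x v + D g x v)) (at x)" if "x \<in> S" for x
    using Suc.prems that by (auto intro!: has_derivative_add has_derivative_D)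
  have "Ck_on k S (\<lambda>x. D f x v + D g x v)" for v
    using Suc by auto
  then have "Ck_on k S (\<lambda>x. D (\<lambda>x. f x + g x) x v)" for v
    by (rule Ck_on_cong[OF \<open>open S\<close>, rotated]) (simp add: D_eqI[OF der])
  then show ?case using der by (auto simp: differentiable_def)
qed

lemma Ck_on_sum:
  assumes "open S" and "\<And>i. i \<in> I \<Longrightarrow> Ck_on k S (f i)"
  shows "Ck_on k S (\<lambda>x. \<Sum>i\<in>I. f i x)"
  using assms(2)
  by (induction I rule: infinite_finite_induct) (auto simp: Ck_on_const intro: Ck_on_add[OF \<open>open S\<close>])

lemma Ck_on_bilinear:
  assumes "bounded_bilinear p" and "open S" and "Ck_on k S f" and "Ck_on k S g"
  shows "Ck_on k S (\<lambda>x. p (f x) (g x))"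
  using assms(3,4)
proof (induction k arbitrary: f g)
  case 0
  then show ?case by (auto intro: bounded_bilinear.continuous_on[OF assms(1)])
next
  case (Suc k)
  have der: "((\<lambda>x. p (f x) (g x)) has_derivative (\<lambda>v. p (f x) (D g x v) + p (D f x v) (g x))) (at x)"
    if "x \<in> S" for x
    using Suc.prems that by (auto intro!: bounded_bilinear.FDERIV[OF assms(1)] has_derivative_D)
  have "Ck_on k S (\<lambda>x. p (f x) (D g x v) + p (D f x v) (g x))" for v
    using Suc.prems Ck_on_Suc_imp[OF Suc.prems(1)] Ck_on_Suc_imp[OF Suc.prems(2)]
    by (auto intro!: Ck_on_add[OF \<open>open S\<close>] Suc.IH)
  then have "Ck_on k S (\<lambda>x. D (\<lambda>x. p (f x) (g x)) x v)" for v
    by (rule Ck_on_cong[OF \<open>open S\<close>, rotated]) (simp add: D_eqI[OF der])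
  then show ?case using der by (auto simp: differentiable_def)
qed

text \<open>A finite Parseval frame. The reconstruction identity passes from two spaces to their product, and it
makes sense in dimension zero, which occurs for finite groups.\<close>

definition frame :: "'a::real_inner set \<Rightarrow> bool" where
  "frame C \<longleftrightarrow> finite C \<and> (\<forall>x. (\<Sum>b\<in>C. (x \<bullet> b) *\<^sub>R b) = x)"

lemma frame_expand: "frame C \<Longrightarrow> (\<Sum>b\<in>C. (x \<bullet> b) *\<^sub>R b) = x"
  by (auto simp: frame_def)

lemma frame_linear:
  assumes "frame C" and "linear L"
  shows "(\<Sum>b\<in>C. (x \<bullet> b) *\<^sub>R L b) = L x"
proof -
  have "L x = L (\<Sum>b\<in>C. (x \<bullet> b) *\<^sub>R b)" using frame_expand[OF assms(1)] by simp
  also have "\<dots> = (\<Sum>b\<in>C. (x \<bullet> b) *\<^sub>R L b)"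
    using assms(2) by (simp add: linear_sum linear_scale)
  finally show ?thesis by simp
qed

lemma frame_Basis: "frame (Basis :: 'a::euclidean_space set)"
  by (simp add: frame_def euclidean_representation)

lemma frame_prod:
  assumes "frame C" and "frame C'"
  shows "frame ((\<lambda>b. (b, 0)) ` C \<union> (\<lambda>b. (0, b)) ` C' :: ('a::real_inner \<times> 'b::real_inner) set)"
  unfolding frame_def
proof (intro conjI allI)
  let ?L = "(\<lambda>b. (b, 0)) ` C :: ('a \<times> 'b) set" and ?R = "(\<lambda>b. (0, b)) ` C' :: ('a \<times> 'b) set"
  have fin: "finite ?L" "finite ?R" using assms by (auto simp: frame_def)
  then show "finite (?L \<union> ?R)" by simp
  fix z :: "'a \<times> 'b"
  have "(\<Sum>b\<in>?L \<union> ?R. (z \<bullet> b) *\<^sub>R b) = (\<Sum>b\<in>?L. (z \<bullet> b) *\<^sub>R b) + (\<Sum>b\<in>?R. (z \<bullet> b) *\<^sub>R b)"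
    using fin by (intro sum.union_inter_neutral) (auto simp: zero_prod_def)
  also have "(\<Sum>b\<in>?L. (z \<bullet> b) *\<^sub>R b) = (\<Sum>b\<in>C. ((fst z \<bullet> b) *\<^sub>R b, 0))"
    by (subst sum.reindex) (auto simp: inj_on_def inner_prod_def)
  also have "\<dots> = (fst z, 0)"
    using frame_expand[OF assms(1)] by (simp add: sum_prod)
  also have "(\<Sum>b\<in>?R. (z \<bullet> b) *\<^sub>R b) = (\<Sum>b\<in>C'. (0, (snd z \<bullet> b) *\<^sub>R b))"
    by (subst sum.reindex) (auto simp: inj_on_def inner_prod_def)
  also have "\<dots> = (0, snd z)"
    using frame_expand[OF assms(2)] by (simp add: sum_prod)
  finally show "(\<Sum>b\<in>?L \<union> ?R. (z \<bullet> b) *\<^sub>R b) = z" by simp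
qed

text \<open>Gram-Schmidt; zero vectors are dropped from the orthogonal system before normalising.\<close>

lemma frame_exists:
  fixes S :: "'a::real_inner set"
  assumes "finite S" and "span S = UNIV"
  shows "\<exists>C::'a set. frame C"
proof -
  obtain C where C: "finite C" "span C = span S" "pairwise orthogonal C"
    using basis_orthogonal[OF assms(1)] by blast
  let ?N = "(\<lambda>b. (1 / norm b) *\<^sub>R b)"
  define E where "E = ?N ` (C - {0})"
  have fE: "finite E" using C by (simp add: E_def)
  have n1: "norm e = 1" if "e \<in> E" for e using that by (auto simp: E_def split: if_splits)
  have orth: "e \<bullet> e' = 0" if "e \<in> E" "e' \<in> E" "e \<noteq> e'" for e e'
  proof -
    from \<open>e \<in> E\<close> obtain b where b: "b \<in> C" "e = ?N b" unfolding E_def by blast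
    from \<open>e' \<in> E\<close> obtain b' where b': "b' \<in> C" "e' = ?N b'" unfolding E_def by blast
    have "b \<noteq> b'" using \<open>e \<noteq> e'\<close> b(2) b'(2) by blast
    then have "b \<bullet> b' = 0" using C(3) b(1) b'(1) by (simp add: pairwise_def orthogonal_def)
    then show ?thesis by (simp add: b b')
  qed
  have "C \<subseteq> span E"
  proof
    fix b assume b: "b \<in> C"
    show "b \<in> span E"
    proof (cases "b = 0")
      case False
      then have "?N b \<in> span E" using b by (auto simp: E_def intro!: span_base)
      then have "norm b *\<^sub>R ?N b \<in> span E" by (rule span_scale)
      then show ?thesis using False by simp
    qed (simp add: span_zero)
  qed
  then have sp: "span E = UNIV" using C(2) assms(2) span_minimal[of C "span E"] by (auto simp: subspace_span)
  have "(\<Sum>b\<in>E. (x \<bullet> b) *\<^sub>R b) = x" for x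
  proof -
    have "x \<in> span E" using sp by simp
    then show ?thesis
    proof (induction rule: span_induct)
      case base
      have "linear (\<lambda>x. (\<Sum>b\<in>E. (x \<bullet> b) *\<^sub>R b) - x)"
        by (intro linear_compose_sub linear_compose_sum ballI linear_ident bounded_linear.linear
            bounded_linear_scaleR_left[THEN bounded_linear_compose] bounded_linear_inner_left)
      from linear_subspace_kernel[OF this] show ?case by simp
    next
      case (step x)
      have "(\<Sum>b\<in>E. (x \<bullet> b) *\<^sub>R b) = (\<Sum>b\<in>E. if b = x then x else 0)"
        using step n1[OF step] orth[OF step]
        by (intro sum.cong) (auto simp: norm_eq_1)
      then show ?case using fE step by simp
    qed
  qed
  then show ?thesis using fE by (auto simp: frame_def)
qed

text \<open>The derivative of \<open>g \<circ> f\<close> in direction \<open>v\<close> evaluates \<open>D g (f x)\<close> in the moving direction \<open>D f x v\<close>.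
The frame expands it into derivatives of \<open>g\<close> in fixed directions, for which the induction hypothesis
is available.\<close>

lemma Ck_on_compose:
  fixes f :: "'a::real_normed_vector \<Rightarrow> 'b::real_inner" and g :: "'b \<Rightarrow> 'c::real_normed_vector"
  assumes C: "frame (C :: 'b set)" and "open S" "open T" "f ` S \<subseteq> T"
    and "Ck_on k T g" "Ck_on k S f"
  shows "Ck_on k S (\<lambda>x. g (f x))"
  using assms(5,6)
proof (induction k arbitrary: g)
  case 0
  then show ?case using assms(4) by (auto intro: continuous_on_compose2)
next
  case (Suc k)
  have dg: "g differentiable at (f x)" if "x \<in> S" for x using Suc.prems assms(4) that by auto
  have der: "((\<lambda>x. g (f x)) has_derivative (\<lambda>v. D g (f x) (D f x v))) (at x)" if "x \<in> S" for x
    using Suc.prems dg[OF that] that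
    by (auto intro!: has_derivative_compose[of f _ x UNIV g, simplified] has_derivative_D)
  have "Ck_on k S (\<lambda>x. \<Sum>b\<in>C. (D f x v \<bullet> b) *\<^sub>R D g (f x) b)" for v
    using Suc.prems Ck_on_Suc_imp[OF Suc.prems(2)]
    by (intro Ck_on_sum[OF \<open>open S\<close>] Ck_on_bilinear[OF bounded_bilinear_scaleR \<open>open S\<close>] Suc.IH
        Ck_on_bounded_linear_comp[OF bounded_linear_inner_left \<open>open S\<close>]) auto
  then have "Ck_on k S (\<lambda>x. D (\<lambda>x. g (f x)) x v)" for v
    by (rule Ck_on_cong[OF \<open>open S\<close>, rotated])
       (simp add: D_eqI[OF der] frame_linear[OF C linear_D[OF dg]])
  then show ?case using der by (auto simp: differentiable_def)
qed

lemma smooth_on_cong: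
  "open S \<Longrightarrow> (\<And>x. x \<in> S \<Longrightarrow> f x = g x) \<Longrightarrow> smooth_on S f \<Longrightarrow> smooth_on S g"
  unfolding smooth_on_def by (metis Ck_on_cong)

lemma smooth_on_subset: "smooth_on S f \<Longrightarrow> T \<subseteq> S \<Longrightarrow> smooth_on T f"
  unfolding smooth_on_def using Ck_on_subset by blast

lemma smooth_on_local:
  "(\<And>x. x \<in> S \<Longrightarrow> \<exists>U. open U \<and> x \<in> U \<and> smooth_on U f) \<Longrightarrow> smooth_on S f"
  unfolding smooth_on_def by (meson Ck_on_local)

lemma smooth_on_const: "smooth_on S (\<lambda>x. c)"
  by (simp add: smooth_on_def Ck_on_const)

lemma smooth_on_ident: "smooth_on S (\<lambda>x. x)"
  by (simp add: smooth_on_def Ck_on_ident)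

lemma smooth_on_bounded_linear_comp:
  "bounded_linear L \<Longrightarrow> open S \<Longrightarrow> smooth_on S f \<Longrightarrow> smooth_on S (\<lambda>x. L (f x))"
  by (simp add: smooth_on_def Ck_on_bounded_linear_comp)

lemma smooth_on_add:
  "open S \<Longrightarrow> smooth_on S f \<Longrightarrow> smooth_on S g \<Longrightarrow> smooth_on S (\<lambda>x. f x + g x)"
  by (simp add: smooth_on_def Ck_on_add)

lemma smooth_on_sum:
  "open S \<Longrightarrow> (\<And>i. i \<in> I \<Longrightarrow> smooth_on S (f i)) \<Longrightarrow> smooth_on S (\<lambda>x. \<Sum>i\<in>I. f i x)"
  by (simp add: smooth_on_def Ck_on_sum)

lemma smooth_on_bilinear:
  "bounded_bilinear p \<Longrightarrow> open S \<Longrightarrow> smooth_on S f \<Longrightarrow> smooth_on S g \<Longrightarrow> smooth_on S (\<lambda>x. p (f x) (g x))"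
  by (simp add: smooth_on_def Ck_on_bilinear)

lemma smooth_on_Pair:
  assumes "open S" "smooth_on S f" "smooth_on S g"
  shows "smooth_on S (\<lambda>x. (f x, g x))"
proof -
  have "smooth_on S (\<lambda>x. (f x, 0) + (0, g x))"
    using assms by (intro smooth_on_add smooth_on_bounded_linear_comp[of "\<lambda>y. (y, 0)"]
        smooth_on_bounded_linear_comp[of "\<lambda>y. (0, y)"] bounded_linear_Pair bounded_linear_ident bounded_linear_zero)
  then show ?thesis by simp
qed

lemma smooth_on_compose:
  fixes f :: "'a::real_normed_vector \<Rightarrow> 'b::real_inner"
  assumes "frame (C :: 'b set)" "open S" "open T" "f ` S \<subseteq> T" "smooth_on T g" "smooth_on S f"
  shows "smooth_on S (\<lambda>x. g (f x))"
  unfolding smooth_on_def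
proof
  show "Ck_on k S (\<lambda>x. g (f x))" for k
    by (rule Ck_on_compose[OF assms(1-4)]) (use assms(5,6) in \<open>simp_all add: smooth_on_def\<close>)
qed

lemma smooth_on_imp_continuous: "smooth_on S f \<Longrightarrow> continuous_on S f"
  by (metis Ck_on.simps(1) smooth_on_def)

lemma smooth_on_imp_differentiable: "smooth_on S f \<Longrightarrow> x \<in> S \<Longrightarrow> f differentiable at x"
  by (metis Ck_on.simps(2) smooth_on_def)

lemma smooth_on_has_derivative: "smooth_on S f \<Longrightarrow> x \<in> S \<Longrightarrow> (f has_derivative D f x) (at x)"
  by (simp add: has_derivative_D smooth_on_imp_differentiable)

lemma smooth_on_D_const: "smooth_on S f \<Longrightarrow> smooth_on S (\<lambda>x. D f x v)"
  by (metis Ck_on.simps(2) smooth_on_def)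

lemma open_section:
  fixes \<Omega> :: "('a::topological_space \<times> 'b::topological_space) set"
  assumes "open \<Omega>"
  shows "open {x. (x, b) \<in> \<Omega>}" and "open {y. (a, y) \<in> \<Omega>}"
proof -
  have "continuous_on UNIV (\<lambda>x. (x, b))" "continuous_on UNIV (\<lambda>y. (a, y))"
    by (intro continuous_intros)+
  from this[THEN open_vimage[OF assms]] show "open {x. (x, b) \<in> \<Omega>}" "open {y. (a, y) \<in> \<Omega>}"
    by (simp_all add: vimage_def)
qed

lemma smooth_on_section:
  fixes F :: "'a::real_inner \<times> 'b::real_inner \<Rightarrow> 'c::real_normed_vector"
  assumes C: "frame (C :: 'a set)" and C': "frame (C' :: 'b set)" and \<Omega>: "open \<Omega>" and F: "smooth_on \<Omega> F"
  shows "smooth_on {x. (x, b) \<in> \<Omega>} (\<lambda>x. F (x, b))" and "smooth_on {y. (a, y) \<in> \<Omega>} (\<lambda>y. F (a, y))"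
  by (rule smooth_on_compose[OF frame_prod[OF C C'] _ \<Omega> _ F];
      auto simp: open_section[OF \<Omega>] intro!: smooth_on_Pair smooth_on_ident smooth_on_const)+

lemma D_section:
  assumes "F differentiable at (x, y)"
  shows "((\<lambda>x. F (x, y)) has_derivative (\<lambda>v. D F (x, y) (v, 0))) (at x)"
    and "((\<lambda>y. F (x, y)) has_derivative (\<lambda>w. D F (x, y) (0, w))) (at y)"
proof -
  show "((\<lambda>x. F (x, y)) has_derivative (\<lambda>v. D F (x, y) (v, 0))) (at x)"
    by (rule has_derivative_compose[of "\<lambda>x. (x, y)" "\<lambda>r. (r, 0)" x UNIV F "D F (x, y)", OF _ has_derivative_D[OF assms]])
       (auto intro!: derivative_eq_intros)
  show "((\<lambda>y. F (x, y)) has_derivative (\<lambda>w. D F (x, y) (0, w))) (at y)"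
    by (rule has_derivative_compose[of "\<lambda>y. (x, y)" "\<lambda>s. (0, s)" y UNIV F "D F (x, y)", OF _ has_derivative_D[OF assms]])
       (auto intro!: derivative_eq_intros)
qed

section \<open>Symmetry of second derivatives\<close>

lemma has_real_derivative_along_line:
  fixes g :: "'a::real_normed_vector \<Rightarrow> real"
  assumes "g differentiable at (x + s *\<^sub>R u)"
  shows "((\<lambda>s. g (x + s *\<^sub>R u)) has_real_derivative D g (x + s *\<^sub>R u) u) (at s)"
proof -
  have "((\<lambda>s. x + s *\<^sub>R u) has_derivative (\<lambda>h. h *\<^sub>R u)) (at s)"
    by (auto intro!: derivative_eq_intros)
  from has_derivative_compose[OF this has_derivative_D[OF assms]]
  show ?thesis
    by (simp add: has_field_derivative_def linear_scale[OF linear_D[OF assms]] mult.commute[of _ "D g _ u"])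
qed

text \<open>The mean value theorem, applied first in direction \<open>u\<close> and then in direction \<open>v\<close>, turns the second
difference over a small parallelogram into a second derivative. The left-hand side is symmetric
in \<open>u\<close> and \<open>v\<close>, which is why second derivatives commute.\<close>

lemma second_difference_mean_value:
  fixes g :: "'a::real_normed_vector \<Rightarrow> real"
  assumes g: "Ck_on 2 S g" and "t > 0"
    and S: "\<And>a b. 0 \<le> a \<Longrightarrow> a \<le> t \<Longrightarrow> 0 \<le> b \<Longrightarrow> b \<le> t \<Longrightarrow> x + a *\<^sub>R u + b *\<^sub>R v \<in> S"
  obtains a b where "0 < a" "a < t" "0 < b" "b < t"
    "g (x + t *\<^sub>R u + t *\<^sub>R v) - g (x + t *\<^sub>R u) - g (x + t *\<^sub>R v) + g x
      = t * (t * D (\<lambda>y. D g y u) (x + a *\<^sub>R u + b *\<^sub>R v) v)"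
proof -
  have d1: "g differentiable at y" if "y \<in> S" for y
    using g that by (simp add: numeral_2_eq_2)
  have d2: "(\<lambda>y. D g y u) differentiable at y" if "y \<in> S" for y
    using g that by (simp add: numeral_2_eq_2)
  have "((\<lambda>a. g (x + t *\<^sub>R v + a *\<^sub>R u) - g (x + a *\<^sub>R u)) has_real_derivative
      D g (x + t *\<^sub>R v + a *\<^sub>R u) u - D g (x + a *\<^sub>R u) u) (at a)" if "0 \<le> a" "a \<le> t" for a
    using S[of a t] S[of a 0] \<open>t > 0\<close> that
    by (intro DERIV_diff has_real_derivative_along_line d1) (simp_all add: algebra_simps)
  from MVT2[OF \<open>t > 0\<close> this] obtain a where a: "0 < a" "a < t" and
    1: "g (x + t *\<^sub>R v + t *\<^sub>R u) - g (x + t *\<^sub>R u) - (g (x + t *\<^sub>R v + 0 *\<^sub>R u) - g (x + 0 *\<^sub>R u))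
      = (t - 0) * (D g (x + t *\<^sub>R v + a *\<^sub>R u) u - D g (x + a *\<^sub>R u) u)"
    by blast
  have "((\<lambda>b. D g (x + a *\<^sub>R u + b *\<^sub>R v) u) has_real_derivative
      D (\<lambda>y. D g y u) (x + a *\<^sub>R u + b *\<^sub>R v) v) (at b)" if "0 \<le> b" "b \<le> t" for b
    using S[of a b] a that by (intro has_real_derivative_along_line d2) simp
  from MVT2[OF \<open>t > 0\<close> this] obtain b where b: "0 < b" "b < t" and
    2: "D g (x + a *\<^sub>R u + t *\<^sub>R v) u - D g (x + a *\<^sub>R u + 0 *\<^sub>R v) u
      = (t - 0) * D (\<lambda>y. D g y u) (x + a *\<^sub>R u + b *\<^sub>R v) v"
    by blast
  show ?thesis
    by (rule that[OF a b]) (use 1 2 in \<open>simp add: algebra_simps\<close>)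
qed

text \<open>Both mixed derivatives take the same value at points arbitrarily close to \<open>x\<close>, and both are continuous.\<close>

lemma symmetric_second_derivative_real:
  fixes g :: "'a::real_normed_vector \<Rightarrow> real"
  assumes "open S" "Ck_on 2 S g" "x \<in> S"
  shows "D (\<lambda>y. D g y u) x v = D (\<lambda>y. D g y v) x u"
proof (rule ccontr)
  define h where "h = (\<lambda>y. D (\<lambda>y. D g y u) y v)"
  define k where "k = (\<lambda>y. D (\<lambda>y. D g y v) y u)"
  assume "\<not> ?thesis"
  then have e: "\<bar>h x - k x\<bar> / 2 > 0" by (simp add: h_def k_def)
  have "continuous_on S h" "continuous_on S k"
    using assms(2) by (simp_all add: numeral_2_eq_2 h_def k_def)
  then have "isCont h x" "isCont k x"
    using assms by (auto simp: continuous_on_eq_continuous_at)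
  then have "\<forall>\<^sub>F y in nhds x. dist (h y) (h x) < \<bar>h x - k x\<bar> / 2"
    "\<forall>\<^sub>F y in nhds x. dist (k y) (k x) < \<bar>h x - k x\<bar> / 2"
    using tendstoD[OF _ e] by (simp_all only: isCont_def tendsto_at_iff_tendsto_nhds)
  moreover have "\<forall>\<^sub>F y in nhds x. y \<in> S"
    using assms by (simp add: eventually_nhds_in_open)
  ultimately have "\<forall>\<^sub>F y in nhds x. dist (h y) (h x) < \<bar>h x - k x\<bar> / 2 \<and>
      dist (k y) (k x) < \<bar>h x - k x\<bar> / 2 \<and> y \<in> S"
    by (intro eventually_conj)
  then obtain d where "d > 0" and d: "\<And>y. dist y x < d \<Longrightarrow>
      dist (h y) (h x) < \<bar>h x - k x\<bar> / 2 \<and> dist (k y) (k x) < \<bar>h x - k x\<bar> / 2 \<and> y \<in> S"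
    by (auto simp: eventually_nhds_metric)
  \<comment> \<open>With this choice the whole parallelogram with sides \<open>t u\<close> and \<open>t v\<close> lies in the ball of radius \<open>d\<close>.\<close>
  define t where "t = d / (norm u + norm v + 1)"
  have pos: "norm u + norm v + 1 > 0" by (simp add: add_nonneg_pos)
  then have "t > 0" using \<open>d > 0\<close> by (simp add: t_def)
  have near: "dist (x + a *\<^sub>R u + b *\<^sub>R v) x < d" if "0 \<le> a" "a \<le> t" "0 \<le> b" "b \<le> t" for a b
  proof -
    have "norm (a *\<^sub>R u + b *\<^sub>R v) \<le> norm (a *\<^sub>R u) + norm (b *\<^sub>R v)"
      by (rule norm_triangle_ineq)
    also have "\<dots> \<le> t * norm u + t * norm v"
      using that by (auto intro!: add_mono mult_right_mono)
    also have "\<dots> < t * (norm u + norm v + 1)"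
      using \<open>t > 0\<close> by (simp add: algebra_simps)
    also have "\<dots> = d" using pos by (simp add: t_def)
    finally show ?thesis by (simp add: dist_norm add.assoc)
  qed
  obtain a b where 1: "0 < a" "a < t" "0 < b" "b < t"
    "g (x + t *\<^sub>R u + t *\<^sub>R v) - g (x + t *\<^sub>R u) - g (x + t *\<^sub>R v) + g x
      = t * (t * h (x + a *\<^sub>R u + b *\<^sub>R v))"
    using second_difference_mean_value[OF assms(2) \<open>t > 0\<close>, of x u v] near d unfolding h_def by metis
  have near': "dist (x + a *\<^sub>R v + b *\<^sub>R u) x < d" if "0 \<le> a" "a \<le> t" "0 \<le> b" "b \<le> t" for a b
    using near[of b a] that by (simp add: algebra_simps)
  obtain a' b' where 2: "0 < a'" "a' < t" "0 < b'" "b' < t"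
    "g (x + t *\<^sub>R v + t *\<^sub>R u) - g (x + t *\<^sub>R v) - g (x + t *\<^sub>R u) + g x
      = t * (t * k (x + a' *\<^sub>R v + b' *\<^sub>R u))"
    using second_difference_mean_value[OF assms(2) \<open>t > 0\<close>, of x v u] near' d unfolding k_def by metis
  have "t * (t * h (x + a *\<^sub>R u + b *\<^sub>R v)) = t * (t * k (x + a' *\<^sub>R v + b' *\<^sub>R u))"
    using 1(5) 2(5) by (simp add: algebra_simps)
  then have "h (x + a *\<^sub>R u + b *\<^sub>R v) = k (x + a' *\<^sub>R v + b' *\<^sub>R u)"
    using \<open>t > 0\<close> by simp
  moreover have "dist (h (x + a *\<^sub>R u + b *\<^sub>R v)) (h x) < \<bar>h x - k x\<bar> / 2"
    using d near 1 by simp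
  moreover have "dist (k (x + a' *\<^sub>R v + b' *\<^sub>R u)) (k x) < \<bar>h x - k x\<bar> / 2"
    using d near' 2 by simp
  ultimately show False unfolding dist_real_def by argo
qed

text \<open>Pairing with a fixed vector reduces the claim to real-valued functions.\<close>

lemma symmetric_second_derivative:
  fixes f :: "'a::real_normed_vector \<Rightarrow> 'b::real_inner"
  assumes "open S" "smooth_on S f" "x \<in> S"
  shows "D (\<lambda>y. D f y u) x v = D (\<lambda>y. D f y v) x u"
proof -
  have *: "D (\<lambda>y. D (\<lambda>y. f y \<bullet> w) y u) x v = D (\<lambda>y. D f y u) x v \<bullet> w" for u v w
  proof -
    have "D (\<lambda>y. f y \<bullet> w) y u = D f y u \<bullet> w" if "y \<in> S" for y
      using D_eqI[OF bounded_linear.has_derivative[OF bounded_linear_inner_left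
          smooth_on_has_derivative[OF assms(2) that]]] by simp
    moreover have der: "((\<lambda>y. D f y u \<bullet> w) has_derivative (\<lambda>v. D (\<lambda>y. D f y u) x v \<bullet> w)) (at x)"
      by (intro bounded_linear.has_derivative[OF bounded_linear_inner_left]
          smooth_on_has_derivative[OF smooth_on_D_const[OF assms(2)] assms(3)])
    ultimately have "((\<lambda>y. D (\<lambda>y. f y \<bullet> w) y u) has_derivative (\<lambda>v. D (\<lambda>y. D f y u) x v \<bullet> w)) (at x)"
      by (intro has_derivative_transform_within_open[OF der assms(1,3)]) simp
    from D_eqI[OF this] show ?thesis by simp
  qed
  have "Ck_on 2 S (\<lambda>y. f y \<bullet> w)" for w
    using smooth_on_bounded_linear_comp[OF bounded_linear_inner_left assms(1,2)] by (simp add: smooth_on_def)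
  from symmetric_second_derivative_real[OF assms(1) this assms(3), of _ u v]
  have "\<And>w. D (\<lambda>y. D f y u) x v \<bullet> w = D (\<lambda>y. D f y v) x u \<bullet> w" by (simp only: *)
  then show ?thesis by (metis vector_eq_rdot)
qed

section \<open>Local existence for ordinary differential equations\<close>

text \<open>The primitive of \<open>\<phi>\<close> vanishing at zero, continued constantly outside \<open>[-\<epsilon>, \<epsilon>]\<close>. The continuation
makes it a bounded function on the whole line, so that the Picard operator acts on the complete space of
bounded continuous functions.\<close>

definition clamped_integral :: "real \<Rightarrow> (real \<Rightarrow> 'a) \<Rightarrow> real \<Rightarrow> 'a::banach" where
  "clamped_integral \<epsilon> \<phi> t = integral {- \<epsilon>..max (- \<epsilon>) (min t \<epsilon>)} \<phi> - integral {- \<epsilon>..0} \<phi>"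

lemma clamped_integral:
  assumes "\<epsilon> > 0" and \<phi>: "continuous_on UNIV \<phi>"
  shows "(\<And>t. norm (\<phi> t) \<le> N) \<Longrightarrow> norm (clamped_integral \<epsilon> \<phi> t - clamped_integral \<epsilon> \<phi> s) \<le> N * \<bar>t - s\<bar>"
    and "(\<And>t. norm (\<phi> t) \<le> N) \<Longrightarrow> norm (clamped_integral \<epsilon> \<phi> t) \<le> N * \<epsilon>"
    and "clamped_integral \<epsilon> \<phi> 0 = 0"
    and "continuous_on UNIV \<psi> \<Longrightarrow>
      clamped_integral \<epsilon> (\<lambda>s. \<phi> s - \<psi> s) t = clamped_integral \<epsilon> \<phi> t - clamped_integral \<epsilon> \<psi> t"
    and "- \<epsilon> < t \<Longrightarrow> t < \<epsilon> \<Longrightarrow> (clamped_integral \<epsilon> \<phi> has_vector_derivative \<phi> t) (at t)"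
proof -
  define cl where "cl = (\<lambda>t. max (- \<epsilon>) (min t \<epsilon>))"
  note cl_defs = clamped_integral_def cl_def
  have int: "\<phi> integrable_on {a..b}" if "continuous_on UNIV \<phi>" for a b and \<phi> :: "real \<Rightarrow> 'a"
    using that by (intro integrable_continuous_real) (auto intro: continuous_on_subset)
  have half: "norm (clamped_integral \<epsilon> \<phi> t - clamped_integral \<epsilon> \<phi> s) \<le> N * (cl t - cl s)"
    if "s \<le> t" "\<And>t. norm (\<phi> t) \<le> N" for s t N
  proof -
    have "cl s \<le> cl t" "- \<epsilon> \<le> cl s" using that by (auto simp: cl_def)
    then have "clamped_integral \<epsilon> \<phi> t - clamped_integral \<epsilon> \<phi> s = integral {cl s..cl t} \<phi>"
      using Henstock_Kurzweil_Integration.integral_combine[OF _ _ int[OF \<phi>], of "- \<epsilon>" "cl s" "cl t"]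
      by (simp add: cl_defs algebra_simps)
    also have "norm \<dots> \<le> N * (cl t - cl s)"
      using \<open>cl s \<le> cl t\<close> \<phi> that by (intro integral_bound) (auto intro: continuous_on_subset)
    finally show ?thesis .
  qed
  have ab: "norm (clamped_integral \<epsilon> \<phi> t - clamped_integral \<epsilon> \<phi> s) \<le> N * \<bar>cl t - cl s\<bar>" if "\<And>t. norm (\<phi> t) \<le> N" for s t N
  proof (cases "s \<le> t")
    case True
    then have "cl s \<le> cl t" by (auto simp: cl_def)
    then show ?thesis using half[OF True that] by simp
  next
    case False
    then have "cl t \<le> cl s" by (auto simp: cl_def)
    then show ?thesis using half[of t s N, OF _ that] False by (simp add: norm_minus_commute)
  qed
  show K0: "clamped_integral \<epsilon> \<phi> 0 = 0" using \<open>\<epsilon> > 0\<close> by (simp add: cl_defs)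
  { assume N: "\<And>t. norm (\<phi> t) \<le> N"
    then have "N \<ge> 0" using order_trans[OF norm_ge_zero] by blast
    have "\<bar>cl t - cl s\<bar> \<le> \<bar>t - s\<bar>" by (auto simp: cl_def)
    with ab[OF N] show "norm (clamped_integral \<epsilon> \<phi> t - clamped_integral \<epsilon> \<phi> s) \<le> N * \<bar>t - s\<bar>"
      using \<open>N \<ge> 0\<close> by (meson mult_left_mono order_trans)
    have "\<bar>cl t - cl 0\<bar> \<le> \<epsilon>" using \<open>\<epsilon> > 0\<close> by (auto simp: cl_def)
    with ab[OF N, of t 0] show "norm (clamped_integral \<epsilon> \<phi> t) \<le> N * \<epsilon>"
      using \<open>N \<ge> 0\<close> K0 by (metis diff_zero mult_left_mono order_trans)
  }
  show "clamped_integral \<epsilon> (\<lambda>s. \<phi> s - \<psi> s) t = clamped_integral \<epsilon> \<phi> t - clamped_integral \<epsilon> \<psi> t" if "continuous_on UNIV \<psi>"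
    using int[OF \<phi>] int[OF that] by (simp add: clamped_integral_def integral_diff)
  show "(clamped_integral \<epsilon> \<phi> has_vector_derivative \<phi> t) (at t)" if t: "- \<epsilon> < t" "t < \<epsilon>"
  proof -
    have "((\<lambda>u. integral {- \<epsilon>..u} \<phi>) has_vector_derivative \<phi> t) (at t within {- \<epsilon>..\<epsilon>})"
      using \<phi> t by (intro integral_has_vector_derivative) (auto intro: continuous_on_subset)
    then have "((\<lambda>u. integral {- \<epsilon>..u} \<phi> - integral {- \<epsilon>..0} \<phi>) has_vector_derivative \<phi> t)
        (at t within {- \<epsilon><..<\<epsilon>})"
      using t by (auto intro!: derivative_eq_intros elim: has_vector_derivative_within_subset)
    moreover have "at t within {- \<epsilon><..<\<epsilon>} = at t"
      using t by (intro at_within_open) auto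
    ultimately have "((\<lambda>u. integral {- \<epsilon>..u} \<phi> - integral {- \<epsilon>..0} \<phi>) has_vector_derivative \<phi> t) (at t)"
      by simp
    then show ?thesis
      by (rule has_vector_derivative_transform_within_open[where S = "{- \<epsilon><..<\<epsilon>}"])
         (use t in \<open>auto simp: cl_defs\<close>)
  qed
qed

text \<open>On the bounded continuous curves in the ball of radius \<open>r\<close>, the Picard operator is a self-map because
\<open>M \<epsilon> \<le> r\<close> for a bound \<open>M\<close> of \<open>V\<close>, and a contraction because \<open>L \<epsilon> \<le> 1/2\<close>. Its fixed point solves the
equation.\<close>

lemma picard_local_existence:
  fixes V :: "'a::banach \<Rightarrow> 'a"
  assumes "r > 0" and "L \<ge> 0"
    and lip: "\<And>x y. x \<in> cball x0 r \<Longrightarrow> y \<in> cball x0 r \<Longrightarrow> norm (V x - V y) \<le> L * norm (x - y)"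
  obtains \<epsilon> x where "\<epsilon> > 0" "x 0 = x0"
    "\<And>t. - \<epsilon> < t \<Longrightarrow> t < \<epsilon> \<Longrightarrow> x t \<in> cball x0 r \<and> (x has_vector_derivative V (x t)) (at t)"
proof -
  define M where "M = norm (V x0) + L * r + 1"
  have "M > 0" using assms(1,2) by (simp add: M_def add_nonneg_pos)
  have VM: "norm (V x) \<le> M" if "x \<in> cball x0 r" for x
  proof -
    have "norm (V x - V x0) \<le> L * norm (x - x0)" using lip that assms by simp
    also have "\<dots> \<le> L * r" using that \<open>L \<ge> 0\<close> by (intro mult_left_mono) (auto simp: dist_norm norm_minus_commute)
    finally show ?thesis using norm_triangle_ineq2[of "V x" "V x0"] by (simp add: M_def)
  qed
  have contV: "continuous_on (cball x0 r) V"
    by (rule lipschitz_on_continuous_on[of L])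
       (use lip \<open>L \<ge> 0\<close> in \<open>auto simp: lipschitz_on_def dist_norm\<close>)
  define \<epsilon> where "\<epsilon> = min (r / M) (1 / (2 * (L + 1)))"
  have "\<epsilon> > 0" using \<open>M > 0\<close> assms by (simp add: \<epsilon>_def)
  have Mr: "M * \<epsilon> \<le> r"
  proof -
    have "\<epsilon> \<le> r / M" by (simp add: \<epsilon>_def)
    then show ?thesis using \<open>M > 0\<close> by (simp add: field_simps)
  qed
  have Lh: "L * \<epsilon> \<le> 1 / 2"
  proof -
    have "\<epsilon> \<le> 1 / (2 * (L + 1))" by (simp add: \<epsilon>_def)
    then have "\<epsilon> * (2 * (L + 1)) \<le> 1" using \<open>L \<ge> 0\<close> by (simp add: field_simps)
    then show ?thesis using \<open>\<epsilon> > 0\<close> by (simp add: algebra_simps)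
  qed
  note K = clamped_integral[OF \<open>\<epsilon> > 0\<close>]
  define X where "X = {f :: real \<Rightarrow>\<^sub>C 'a. \<forall>t. f t \<in> cball x0 r}"
  have X: "continuous_on UNIV (\<lambda>s. V (f s))" "\<And>s. norm (V (f s)) \<le> M" if "f \<in> X" for f
    using that VM by (auto simp: X_def intro!: continuous_on_compose2[OF contV])
  define P where "P = (\<lambda>f :: real \<Rightarrow>\<^sub>C 'a. Bcontfun (\<lambda>t. x0 + clamped_integral \<epsilon> (\<lambda>s. V (f s)) t))"
  have inX: "x0 + clamped_integral \<epsilon> (\<lambda>s. V (f s)) t \<in> cball x0 r" if "f \<in> X" for f t
    using K(2)[OF X[OF that], of t] Mr by (simp add: dist_norm)
  have P: "apply_bcontfun (P f) t = x0 + clamped_integral \<epsilon> (\<lambda>s. V (f s)) t" if "f \<in> X" for f t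
  proof -
    have "M-lipschitz_on UNIV (clamped_integral \<epsilon> (\<lambda>s. V (f s)))"
      using K(1)[OF X[OF that]] \<open>M > 0\<close> by (auto simp: lipschitz_on_def dist_norm)
    then have "continuous_on UNIV (\<lambda>t. x0 + clamped_integral \<epsilon> (\<lambda>s. V (f s)) t)"
      by (intro continuous_intros lipschitz_on_continuous_on)
    moreover have "bounded (range (\<lambda>t. x0 + clamped_integral \<epsilon> (\<lambda>s. V (f s)) t))"
      by (rule bounded_subset[OF bounded_cball[of x0 r]]) (use inX[OF that] in \<open>auto simp del: mem_cball\<close>)
    ultimately show ?thesis by (simp add: P_def Bcontfun_inverse bcontfun_def)
  qed
  have "X = PiC UNIV (\<lambda>_. cball x0 r)"
    by (auto simp: X_def mem_PiC_iff Pi_iff)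
  then have "closed X" by (simp add: closed_PiC)
  then have "complete X" by (simp add: complete_eq_closed)
  moreover have "const_bcontfun x0 \<in> X"
    using \<open>r > 0\<close> by (simp add: X_def const_bcontfun.rep_eq)
  moreover have "P ` X \<subseteq> X" using inX P by (auto simp: X_def)
  moreover have "dist (P f) (P g) \<le> 1 / 2 * dist f g" if "f \<in> X" "g \<in> X" for f g
  proof (rule dist_bound)
    fix t
    have "norm (V (f s) - V (g s)) \<le> L * dist f g" for s
    proof -
      have "norm (V (f s) - V (g s)) \<le> L * dist (f s) (g s)"
        using lip that by (simp add: X_def dist_norm)
      also have "\<dots> \<le> L * dist f g" using \<open>L \<ge> 0\<close> by (intro mult_left_mono dist_bounded)
      finally show ?thesis .
    qed
    then have "norm (clamped_integral \<epsilon> (\<lambda>s. V (f s) - V (g s)) t) \<le> L * dist f g * \<epsilon>"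
      using X that by (intro K(2)) (auto intro: continuous_intros)
    also have "\<dots> \<le> 1 / 2 * dist f g"
      using mult_right_mono[OF Lh, of "dist f g"] by (simp add: mult_ac)
    finally show "dist (P f t) (P g t) \<le> 1 / 2 * dist f g"
      using that by (simp add: P dist_norm K(4)[OF X(1) X(1)])
  qed
  ultimately have "\<exists>!f\<in>X. P f = f"
    by (intro Banach_fix[of X "1/2"]) auto
  then obtain f where f: "f \<in> X" "P f = f" by blast
  have fe: "apply_bcontfun f = (\<lambda>t. x0 + clamped_integral \<epsilon> (\<lambda>s. V (f s)) t)"
    using P[OF f(1)] unfolding f(2) by (rule ext)
  have der: "(apply_bcontfun f has_vector_derivative V (f t)) (at t)" if "- \<epsilon> < t" "t < \<epsilon>" for t
    by (subst fe) (use K(5)[OF X(1)[OF f(1)] that] in \<open>auto intro!: derivative_eq_intros\<close>)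
  show ?thesis
    by (rule that[OF \<open>\<epsilon> > 0\<close>, of f])
       (use f der K(3)[OF X(1)[OF f(1)]] fun_cong[OF fe, of 0] in \<open>auto simp: X_def\<close>)
qed

text \<open>The sum \<open>K\<close> of the norms of the partial derivatives along the frame dominates the operator norm of
the derivative. Being continuous, it is bounded near \<open>x0\<close>, and the mean value inequality
applies on a ball.\<close>

lemma smooth_on_locally_lipschitz:
  fixes f :: "'a::real_inner \<Rightarrow> 'b::real_normed_vector"
  assumes C: "frame (C :: 'a set)" and "open S" and f: "smooth_on S f" and "x0 \<in> S"
  obtains r L where "r > 0" "L \<ge> 0" "cball x0 r \<subseteq> S"
    "\<And>x y. x \<in> cball x0 r \<Longrightarrow> y \<in> cball x0 r \<Longrightarrow> norm (f x - f y) \<le> L * norm (x - y)"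
proof -
  define K where "K = (\<lambda>x. \<Sum>b\<in>C. norm b * norm (D f x b))"
  have "continuous_on S K"
    unfolding K_def by (intro continuous_intros smooth_on_imp_continuous smooth_on_D_const f)
  then have "\<forall>\<^sub>F x in nhds x0. dist (K x) (K x0) < 1"
    using tendstoD[OF filterlim_nhds_if_continuous_on[OF _ assms(2,4)], of K 1] by simp
  moreover have "\<forall>\<^sub>F x in nhds x0. x \<in> S" using assms by (simp add: eventually_nhds_in_open)
  ultimately have "\<forall>\<^sub>F x in nhds x0. dist (K x) (K x0) < 1 \<and> x \<in> S" by (rule eventually_conj)
  then obtain d where "d > 0" and d: "\<And>x. dist x x0 < d \<Longrightarrow> dist (K x) (K x0) < 1 \<and> x \<in> S"
    by (auto simp: eventually_nhds_metric)
  define r where "r = d / 2"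
  have r: "r > 0" using \<open>d > 0\<close> by (simp add: r_def)
  have rd: "dist (K x) (K x0) < 1 \<and> x \<in> S" if "x \<in> cball x0 r" for x
    using that \<open>d > 0\<close> by (intro d) (auto simp: r_def dist_commute)
  have "0 \<le> K x0" unfolding K_def by (intro sum_nonneg) auto
  have on: "onorm (D f x) \<le> K x0 + 1" if x: "x \<in> cball x0 r" for x
  proof (rule onorm_bound)
    fix v
    have lin: "linear (D f x)" using rd[OF x] f by (intro linear_D smooth_on_imp_differentiable[of S]) auto
    have "norm (D f x v) = norm (\<Sum>b\<in>C. (v \<bullet> b) *\<^sub>R D f x b)" by (simp add: frame_linear[OF C lin])
    also have "\<dots> \<le> (\<Sum>b\<in>C. norm v * norm b * norm (D f x b))"
      by (rule sum_norm_le) (simp add: mult_right_mono Cauchy_Schwarz_ineq2)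
    also have "\<dots> = K x * norm v" by (simp add: K_def sum_distrib_left mult_ac)
    also have "\<dots> \<le> (K x0 + 1) * norm v"
      using rd[OF x] by (intro mult_right_mono) (auto simp: dist_real_def)
    finally show "norm (D f x v) \<le> (K x0 + 1) * norm v" .
  qed (use \<open>0 \<le> K x0\<close> in simp)
  show ?thesis
  proof (rule that[OF r, of "K x0 + 1"])
    show "norm (f x - f y) \<le> (K x0 + 1) * norm (x - y)" if "x \<in> cball x0 r" "y \<in> cball x0 r" for x y
      by (rule differentiable_bound[OF convex_cball _ on that])
         (use rd in \<open>blast intro: has_derivative_at_withinI smooth_on_has_derivative[OF f]\<close>)+
  qed (use \<open>0 \<le> K x0\<close> rd in auto)
qed

text \<open>Bootstrapping: if \<open>x\<close> is \<open>C\<^sup>k\<close>, then so is \<open>x' = V \<circ> x\<close>.\<close>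

lemma ode_solution_smooth:
  fixes x :: "real \<Rightarrow> 'a::real_inner"
  assumes C: "frame (C :: 'a set)" and "open I" and "open S" and V: "smooth_on S V"
    and x: "\<And>t. t \<in> I \<Longrightarrow> x t \<in> S" "\<And>t. t \<in> I \<Longrightarrow> (x has_vector_derivative V (x t)) (at t)"
  shows "smooth_on I x"
  unfolding smooth_on_def
proof
  fix k show "Ck_on k I x"
  proof (induction k)
    case 0
    show ?case using x(2) by (auto intro!: continuous_at_imp_continuous_on has_vector_derivative_continuous)
  next
    case (Suc k)
    have der: "(x has_derivative (\<lambda>h. h *\<^sub>R V (x t))) (at t)" if "t \<in> I" for t
      using x(2)[OF that] by (simp add: has_vector_derivative_def)
    have Vx: "Ck_on k I (\<lambda>t. V (x t))"
      by (rule Ck_on_compose[OF C \<open>open I\<close> \<open>open S\<close>]) (use x V Suc in \<open>auto simp: smooth_on_def\<close>)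
    have Vh: "Ck_on k I (\<lambda>t. h *\<^sub>R V (x t))" for h
      by (rule Ck_on_bounded_linear_comp[OF bounded_linear_scaleR_right \<open>open I\<close> Vx])
    have "Ck_on k I (\<lambda>t. D x t h)" for h
      by (rule Ck_on_cong[OF \<open>open I\<close> _ Vh[of h]]) (simp add: D_eqI[OF der])
    then show ?case using der by (auto simp: differentiable_def)
  qed
qed

section \<open>Linear algebra of a contact form at a point\<close>

text \<open>A form of degree \<open>k\<close> is applied to an infinite sequence of vectors, so that it ignores all entries
from position \<open>k\<close> on has to be demanded.\<close>

definition multilinear :: "nat \<Rightarrow> ((nat \<Rightarrow> 'e::real_vector) \<Rightarrow> real) \<Rightarrow> bool" where
  "multilinear k f \<longleftrightarrow> (\<forall>v w. (\<forall>i<k. v i = w i) \<longrightarrow> f v = f w) \<and>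
     (\<forall>j<k. \<forall>v. linear (\<lambda>x. f (v(j := x))))"

lemma multilinear_cong: "multilinear k f \<Longrightarrow> (\<And>i. i < k \<Longrightarrow> v i = w i) \<Longrightarrow> f v = f w"
  by (simp add: multilinear_def)

lemma multilinear_linear: "multilinear k f \<Longrightarrow> j < k \<Longrightarrow> linear (\<lambda>x. f (v(j := x)))"
  by (simp add: multilinear_def)

text \<open>Changing the argument number \<open>j\<close> affects, in the summand of \<open>\<sigma>\<close>, exactly one argument of one factor: the
one at position \<open>\<sigma>\<^sup>-\<^sup>1 j\<close>. This reduces multilinearity and vanishing of a wedge to its factors.\<close>

lemma wedge_summand_update:
  fixes v :: "nat \<Rightarrow> 'e::real_vector" and \<sigma> :: "nat \<Rightarrow> nat" and j :: nat
  assumes "multilinear k \<alpha>" and "\<sigma> permutes {..<k + l}"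
  defines "w \<equiv> \<lambda>i. v (\<sigma> i)" and "m \<equiv> inv_into UNIV \<sigma> j"
  shows "m < k \<Longrightarrow> \<alpha> (\<lambda>i. (v(j := x)) (\<sigma> i)) * \<beta> (\<lambda>i. (v(j := x)) (\<sigma> (k + i)))
        = \<alpha> (w(m := x)) * \<beta> (\<lambda>i. w (k + i))"
    and "k \<le> m \<Longrightarrow> \<alpha> (\<lambda>i. (v(j := x)) (\<sigma> i)) * \<beta> (\<lambda>i. (v(j := x)) (\<sigma> (k + i)))
        = \<alpha> w * \<beta> ((\<lambda>i. w (k + i))(m - k := x))"
proof -
  have \<sigma>: "\<sigma> i = j \<longleftrightarrow> i = m" for i
    using permutes_inverses[OF assms(2)] by (auto simp: m_def)
  have upd: "(v(j := x)) (\<sigma> i) = (w(m := x)) i" for i by (simp add: w_def \<sigma>)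
  { assume "m < k"
    then have "(\<lambda>i. (w(m := x)) (k + i)) = (\<lambda>i. w (k + i))" by auto
    then show "\<alpha> (\<lambda>i. (v(j := x)) (\<sigma> i)) * \<beta> (\<lambda>i. (v(j := x)) (\<sigma> (k + i)))
        = \<alpha> (w(m := x)) * \<beta> (\<lambda>i. w (k + i))"
      by (simp only: upd)
  }
  { assume m: "k \<le> m"
    then have "(\<lambda>i. (w(m := x)) (k + i)) = (\<lambda>i. w (k + i))(m - k := x)" by (auto simp: fun_eq_iff)
    moreover have "\<alpha> (w(m := x)) = \<alpha> w"
      using m by (intro multilinear_cong[OF assms(1)]) simp
    ultimately show "\<alpha> (\<lambda>i. (v(j := x)) (\<sigma> i)) * \<beta> (\<lambda>i. (v(j := x)) (\<sigma> (k + i)))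
        = \<alpha> w * \<beta> ((\<lambda>i. w (k + i))(m - k := x))"
      by (simp only: upd)
  }
qed

lemma permutes_inv_less: "\<sigma> permutes {..<N::nat} \<Longrightarrow> j < N \<Longrightarrow> inv_into UNIV \<sigma> j < N"
  using permutes_in_image[OF permutes_inv, of \<sigma> "{..<N}" j] by simp

lemma multilinear_wedge:
  assumes \<alpha>: "multilinear k \<alpha>" and \<beta>: "multilinear l \<beta>"
  shows "multilinear (k + l) (wedge k l \<alpha> \<beta>)"
  unfolding multilinear_def
proof (intro conjI allI impI)
  fix v w :: "nat \<Rightarrow> 'a" assume vw: "\<forall>i<k + l. v i = w i"
  have "\<alpha> (\<lambda>i. v (\<sigma> i)) = \<alpha> (\<lambda>i. w (\<sigma> i))" "\<beta> (\<lambda>i. v (\<sigma> (k + i))) = \<beta> (\<lambda>i. w (\<sigma> (k + i)))"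
    if "\<sigma> permutes {..<k + l}" for \<sigma>
    using vw permutes_in_image[OF that]
    by (auto intro!: multilinear_cong[OF \<alpha>] multilinear_cong[OF \<beta>])
  then show "wedge k l \<alpha> \<beta> v = wedge k l \<alpha> \<beta> w" by (simp add: wedge_def)
next
  fix j v assume j: "j < k + l"
  have "linear (\<lambda>x. \<alpha> (\<lambda>i. (v(j := x)) (\<sigma> i)) * \<beta> (\<lambda>i. (v(j := x)) (\<sigma> (k + i))))"
    if \<sigma>: "\<sigma> permutes {..<k + l}" for \<sigma>
  proof (cases "inv_into UNIV \<sigma> j < k")
    case True
    have "linear (\<lambda>x. \<alpha> ((\<lambda>i. v (\<sigma> i))(inv_into UNIV \<sigma> j := x)))" by (rule multilinear_linear[OF \<alpha> True])
    then show ?thesis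
      unfolding wedge_summand_update(1)[OF \<alpha> \<sigma> True]
      by (simp add: linear_iff algebra_simps)
  next
    case False
    then have "linear (\<lambda>x. \<beta> ((\<lambda>i. v (\<sigma> (k + i)))(inv_into UNIV \<sigma> j - k := x)))"
      using permutes_inv_less[OF \<sigma> j] by (intro multilinear_linear[OF \<beta>]) simp
    then show ?thesis
      using wedge_summand_update(2)[OF \<alpha> \<sigma>, of j v _ \<beta>] False
      by (simp add: linear_iff algebra_simps)
  qed
  then have "linear (\<lambda>x. (\<Sum>\<sigma> | \<sigma> permutes {..<k + l}. (of_int (sign \<sigma>) / (fact k * fact l)) *\<^sub>R
      (\<alpha> (\<lambda>i. (v(j := x)) (\<sigma> i)) * \<beta> (\<lambda>i. (v(j := x)) (\<sigma> (k + i))))))"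
    by (intro linear_compose_sum ballI linear_compose_scale_right) simp
  then show "linear (\<lambda>x. wedge k l \<alpha> \<beta> (v(j := x)))"
    by (simp add: wedge_def sum_divide_distrib mult.assoc)
qed

lemma wedge_vanishes:
  assumes \<alpha>: "multilinear k \<alpha>" and \<beta>: "multilinear l \<beta>"
    and "\<And>j v. j < k \<Longrightarrow> \<alpha> (v(j := u)) = 0" and "\<And>j v. j < l \<Longrightarrow> \<beta> (v(j := u)) = 0"
    and j: "j < k + l"
  shows "wedge k l \<alpha> \<beta> (v(j := u)) = 0"
proof -
  have "\<alpha> (\<lambda>i. (v(j := u)) (\<sigma> i)) * \<beta> (\<lambda>i. (v(j := u)) (\<sigma> (k + i))) = 0"
    if \<sigma>: "\<sigma> permutes {..<k + l}" for \<sigma>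
  proof (cases "inv_into UNIV \<sigma> j < k")
    case True
    then show ?thesis unfolding wedge_summand_update(1)[OF \<alpha> \<sigma> True] using assms(3) by simp
  next
    case False
    then show ?thesis
      using wedge_summand_update(2)[OF \<alpha> \<sigma>, of j v u \<beta>] assms(4)[of "inv_into UNIV \<sigma> j - k"] permutes_inv_less[OF \<sigma> j]
      by simp
  qed
  then show ?thesis unfolding wedge_def
    by (subst sum.neutral) (simp_all only: mult.assoc, simp_all)
qed

text \<open>A wedge alternates because it is a signed sum over all permutations, which can be reindexed by
\<open>\<tau>\<close>.\<close>

lemma wedge_permute:
  assumes \<tau>: "\<tau> permutes {..<k + l}"
  shows "wedge k l \<alpha> \<beta> (\<lambda>i. v (\<tau> i)) = of_int (sign \<tau>) * wedge k l \<alpha> \<beta> v"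
proof -
  let ?t = "\<lambda>\<sigma>. of_int (sign \<sigma>) * \<alpha> (\<lambda>i. v (\<sigma> i)) * \<beta> (\<lambda>i. v (\<sigma> (k + i))) :: real"
  let ?P = "{\<sigma>. \<sigma> permutes {..<k + l}}"
  have "sum ?t ?P = (\<Sum>\<sigma>\<in>?P. ?t (\<tau> \<circ> \<sigma>))"
    by (rule setum_permutations_compose_left[OF \<tau>])
  also have "\<dots> = (\<Sum>\<sigma>\<in>?P. of_int (sign \<tau>) * (of_int (sign \<sigma>) * \<alpha> (\<lambda>i. v (\<tau> (\<sigma> i))) * \<beta> (\<lambda>i. v (\<tau> (\<sigma> (k + i))))))"
  proof (rule sum.cong)
    fix \<sigma> assume "\<sigma> \<in> ?P"
    then have "sign (\<tau> \<circ> \<sigma>) = sign \<tau> * sign \<sigma>"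
      using \<tau> by (intro sign_compose) (auto intro: permutation_permutes[THEN iffD2])
    then show "?t (\<tau> \<circ> \<sigma>) = of_int (sign \<tau>) * (of_int (sign \<sigma>) * \<alpha> (\<lambda>i. v (\<tau> (\<sigma> i))) * \<beta> (\<lambda>i. v (\<tau> (\<sigma> (k + i)))))"
      by simp
  qed simp
  finally have "sum ?t ?P = of_int (sign \<tau>) * (\<Sum>\<sigma>\<in>?P. of_int (sign \<sigma>) * \<alpha> (\<lambda>i. v (\<tau> (\<sigma> i))) * \<beta> (\<lambda>i. v (\<tau> (\<sigma> (k + i)))))"
    by (simp add: sum_distrib_left)
  moreover have "of_int (sign \<tau>) * of_int (sign \<tau>) = (1 :: real)"
    by (simp add: sign_def)
  ultimately show ?thesis
    by (simp add: wedge_def mult.assoc[symmetric])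
qed

lemma wedge_repeated_argument:
  assumes "a < k + l" "b < k + l" "a \<noteq> b" "v a = v b"
  shows "wedge k l \<alpha> \<beta> v = 0"
proof -
  have "(\<lambda>i. v (Transposition.transpose a b i)) = v" using assms by (auto simp: Transposition.transpose_def)
  moreover have "Transposition.transpose a b permutes {..<k + l}" using assms by (intro permutes_swap_id) auto
  ultimately show ?thesis
    using wedge_permute[of "Transposition.transpose a b" k l \<alpha> \<beta> v] assms by (simp add: sign_swap_id)
qed

text \<open>Cramer's rule: by linearity in argument \<open>j\<close>, only the term without a repeated argument survives.\<close>

lemma wedge_linear_combination:
  assumes ml: "multilinear (k + l) (wedge k l \<alpha> \<beta>)" and "j < k + l"
  shows "wedge k l \<alpha> \<beta> (w(j := \<Sum>i<k + l. c i *\<^sub>R w i)) = c j * wedge k l \<alpha> \<beta> w"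
proof -
  have lin: "linear (\<lambda>x. wedge k l \<alpha> \<beta> (w(j := x)))" by (rule multilinear_linear[OF assms])
  have "wedge k l \<alpha> \<beta> (w(j := \<Sum>i<k + l. c i *\<^sub>R w i)) = (\<Sum>i<k + l. c i * wedge k l \<alpha> \<beta> (w(j := w i)))"
    by (simp only: linear_sum[OF lin] linear_scale[OF lin] real_scaleR_def)
  also have "\<dots> = (\<Sum>i<k + l. if i = j then c j * wedge k l \<alpha> \<beta> w else 0)"
    using assms(2) wedge_repeated_argument[of _ k l j "w(j := w _)"]
    by (intro sum.cong) (auto simp: fun_upd_idem)
  finally show ?thesis using assms(2) by simp
qed

lemma multilinear_wedge_power:
  assumes "\<And>y. linear (\<lambda>x. \<omega> x y)" "\<And>x. linear (\<omega> x)"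
  shows "multilinear (2 * n) (wedge_power (\<lambda>w. \<omega> (w 0) (w 1)) n)"
proof (induction n)
  case 0
  show ?case by (simp add: multilinear_def)
next
  case (Suc n)
  have "multilinear 2 (\<lambda>w. \<omega> (w 0) (w 1))"
    using assms by (auto simp: multilinear_def less_2_cases_iff)
  from multilinear_wedge[OF this Suc] show ?case by simp
qed

lemma wedge_power_vanishes:
  assumes "\<And>y. linear (\<lambda>x. \<omega> x y)" "\<And>x. linear (\<omega> x)"
    and "\<And>x. \<omega> u x = 0" "\<And>x. \<omega> x u = 0" and "j < 2 * n"
  shows "wedge_power (\<lambda>w. \<omega> (w 0) (w 1)) n (v(j := u)) = 0"
  using assms(5)
proof (induction n arbitrary: j v)
  case (Suc n)
  have "multilinear 2 (\<lambda>w. \<omega> (w 0) (w 1))"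
    using assms by (auto simp: multilinear_def less_2_cases_iff)
  then show ?case
    unfolding wedge_power.simps
  proof (rule wedge_vanishes[OF _ multilinear_wedge_power[OF assms(1,2)]])
    fix i :: nat and v assume "i < 2"
    then show "\<omega> ((v(i := u)) 0) ((v(i := u)) 1) = 0"
      using assms(3,4) by (auto simp: less_2_cases_iff)
  qed (use Suc.IH in blast, use Suc.prems in simp)
qed simp

text \<open>Let \<open>w\<close> be vectors on which the volume form \<open>\<theta> \<and> \<omega>\<^sup>n\<close> does not vanish. By Cramer's rule the coefficients of a
linear combination of \<open>w\<close> can be read off from the volume form, so the \<open>2n + 1\<close> vectors are independent and hence
span. The form vanishes when \<open>u\<close> is put into any argument; expressing \<open>u\<close> in terms of \<open>w\<close> shows that all
its coefficients are zero.\<close>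

lemma contact_form_nondegenerate:
  fixes \<theta> :: "'e::euclidean_space \<Rightarrow> real"
  assumes dim: "DIM('e) = 2 * n + 1" and \<theta>: "linear \<theta>"
    and \<omega>: "\<And>y. linear (\<lambda>x. \<omega> x y)" "\<And>x. linear (\<omega> x)"
    and nz: "wedge 1 (2 * n) (\<lambda>w. \<theta> (w 0)) (wedge_power (\<lambda>w. \<omega> (w 0) (w 1)) n) w \<noteq> 0"
    and u: "\<theta> u = 0" "\<And>x. \<omega> u x = 0" "\<And>x. \<omega> x u = 0"
  shows "u = 0"
proof -
  define vol where "vol = wedge 1 (2 * n) (\<lambda>w. \<theta> (w 0)) (wedge_power (\<lambda>w. \<omega> (w 0) (w 1)) n)"
  have ml1: "multilinear 1 (\<lambda>w. \<theta> (w 0))" using \<theta> by (simp add: multilinear_def)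
  note ml = multilinear_wedge[OF ml1 multilinear_wedge_power[OF \<omega>]]
  note comb = wedge_linear_combination[OF ml[of n], folded vol_def]
  obtain b :: "nat \<Rightarrow> 'e" where b: "bij_betw b {..<1 + 2 * n} Basis"
    using ex_bij_betw_nat_finite[OF finite_Basis[where 'a = 'e]] dim by (auto simp: atLeast0LessThan)
  \<comment> \<open>Coordinates of the space itself serve as coefficients, so that injective implies surjective.\<close>
  define T where "T = (\<lambda>x. \<Sum>i<1 + 2 * n. (x \<bullet> b i) *\<^sub>R w i)"
  have "linear T"
    unfolding T_def by (auto simp: linear_iff inner_add_left scaleR_add_left scaleR_add_right sum.distrib scaleR_sum_right)
  have coord: "x = 0" if "\<And>j. j < 1 + 2 * n \<Longrightarrow> vol (w(j := T x)) = 0" for x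
  proof (rule euclidean_eqI)
    fix e :: 'e assume "e \<in> Basis"
    then obtain j where "j < 1 + 2 * n" "e = b j" using b by (auto simp: bij_betw_def)
    then show "x \<bullet> e = 0 \<bullet> e"
      using comb[of j w "\<lambda>i. x \<bullet> b i"] that[of j] nz by (simp add: T_def vol_def)
  qed
  have "inj T"
    unfolding linear_injective_0[OF \<open>linear T\<close>]
  proof (intro allI impI)
    fix x assume "T x = 0"
    then have "vol (w(j := T x)) = 0" if "j < 1 + 2 * n" for j
      using linear_0[OF multilinear_linear[OF ml[of n] that]] by (simp add: vol_def)
    then show "x = 0" by (rule coord)
  qed
  then obtain x where x: "u = T x"
    using linear_injective_imp_surjective[OF \<open>linear T\<close>] by (metis surjD)
  have "vol (w(j := T x)) = 0" if "j < 1 + 2 * n" for j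
    unfolding vol_def x[symmetric]
    by (rule wedge_vanishes[OF ml1 multilinear_wedge_power[OF \<omega>]], use u in simp,
        rule wedge_power_vanishes[OF \<omega> u(2,3)], assumption, rule that)
  then have "x = 0" by (rule coord)
  then show "u = 0" using linear_0[OF \<open>linear T\<close>] x by simp
qed

text \<open>If \<open>\<omega> e f = 1\<close>, then \<open>S\<close> is the direct sum of the plane spanned by \<open>e\<close> and \<open>f\<close> and the \<open>\<omega>\<close>-orthogonal
complement of this plane, on which \<open>\<omega>\<close> is again nondegenerate.\<close>

lemma even_dim_if_skew_nondegenerate:
  fixes S :: "'e::euclidean_space set" and \<omega> :: "'e \<Rightarrow> 'e \<Rightarrow> real"
  assumes \<omega>: "\<And>y. linear (\<lambda>x. \<omega> x y)" "\<And>x y. \<omega> x y = - \<omega> y x"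
    and "subspace S" and nd: "\<And>x. x \<in> S \<Longrightarrow> (\<And>y. y \<in> S \<Longrightarrow> \<omega> x y = 0) \<Longrightarrow> x = 0"
  shows "even (dim S)"
  using assms(3,4)
proof (induction "dim S" arbitrary: S rule: less_induct)
  case less
  show ?case
  proof (cases "dim S = 0")
    case False
    note add = linear_add[OF \<omega>(1)] and sub = linear_diff[OF \<omega>(1)] and sc = linear_scale[OF \<omega>(1)]
    have self: "\<omega> x x = (0::real)" for x using \<omega>(2)[of x x] by simp
    obtain e where e: "e \<in> S" "e \<noteq> 0" using False by auto
    then obtain f0 where f0: "f0 \<in> S" "\<omega> e f0 \<noteq> 0" using less.prems(2) by blast
    define f where "f = (1 / \<omega> e f0) *\<^sub>R f0"
    have f: "f \<in> S" using f0 less.prems(1) by (simp add: f_def subspace_scale)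
    have fe: "\<omega> f e = -1" using f0 \<omega>(2)[of f0 e] by (simp add: f_def sc)
    then have ef: "\<omega> e f = 1" using \<omega>(2)[of e f] by simp
    define S' where "S' = {v \<in> S. \<omega> v e = 0 \<and> \<omega> v f = 0}"
    have sS': "subspace S'"
      using less.prems(1) by (auto simp: S'_def subspace_def add sc linear_0[OF \<omega>(1)])
    have span': "span S' = S'" using sS' by simp
    have "f \<notin> span S'" unfolding span' using fe by (simp add: S'_def)
    moreover have "e \<notin> span (insert f S')"
    proof
      assume "e \<in> span (insert f S')"
      then obtain c where "e - c *\<^sub>R f \<in> S'" using span_breakdown_eq[of e f S'] span' by auto
      then have "\<omega> (e - c *\<^sub>R f) f = 0" by (simp add: S'_def)
      then show False using ef self by (simp add: sub sc)
    qed
    ultimately have d: "dim (insert e (insert f S')) = dim S' + 2" by (simp add: dim_insert)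
    have "S \<subseteq> span (insert e (insert f S'))"
    proof
      fix v assume v: "v \<in> S"
      \<comment> \<open>The component of \<open>v\<close> in the complement of the plane.\<close>
      define s where "s = v - \<omega> v f *\<^sub>R e + \<omega> v e *\<^sub>R f"
      have "s \<in> S'"
        using v e f less.prems(1) ef fe self
        by (auto simp: S'_def s_def add sub sc intro!: subspace_add subspace_diff subspace_scale)
      moreover have "v = s + \<omega> v f *\<^sub>R e - \<omega> v e *\<^sub>R f" by (simp add: s_def)
      ultimately show "v \<in> span (insert e (insert f S'))"
        by (metis insertCI span_add span_base span_diff span_scale)
    qed
    moreover have "insert e (insert f S') \<subseteq> S" using e f by (auto simp: S'_def)
    ultimately have "dim S = dim S' + 2"
      using d dim_subset[of "insert e (insert f S')" S] dim_subset[of S "span (insert e (insert f S'))"]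
      by (simp add: dim_span)
    moreover have "even (dim S')"
    proof (rule less.hyps)
      show "dim S' < dim S" using \<open>dim S = dim S' + 2\<close> by simp
      show "subspace S'" by (rule sS')
      fix x assume x: "x \<in> S'" "\<And>y. y \<in> S' \<Longrightarrow> \<omega> x y = 0"
      show "x = 0"
      proof (rule less.prems(2))
        show "x \<in> S" using x by (simp add: S'_def)
        fix v assume v: "v \<in> S"
        define s where "s = v - \<omega> v f *\<^sub>R e + \<omega> v e *\<^sub>R f"
        have "s \<in> S'"
          using v e f less.prems(1) ef fe self
          by (auto simp: S'_def s_def add sub sc intro!: subspace_add subspace_diff subspace_scale)
        then have "\<omega> s x = 0" using x(2) \<omega>(2)[of s x] by simp
        moreover have "\<omega> e x = 0" "\<omega> f x = 0" using x(1) \<omega>(2)[of e x] \<omega>(2)[of f x] by (auto simp: S'_def)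
        ultimately have "\<omega> v x = 0" by (simp add: s_def add sub sc)
        then show "\<omega> x v = 0" using \<omega>(2)[of x v] by simp
      qed
    qed
    ultimately show ?thesis by simp
  next
    case True
    show ?thesis unfolding True by simp
  qed
qed

text \<open>In odd dimension the skew form \<open>\<omega>\<close> has a nonzero kernel vector. By the hypothesis of nondegeneracy \<open>\<theta>\<close> does
not vanish on it, and it can be rescaled.\<close>

lemma reeb_vector_exists:
  fixes \<theta> :: "'e::euclidean_space \<Rightarrow> real" and \<omega> :: "'e \<Rightarrow> 'e \<Rightarrow> real"
  assumes "odd DIM('e)" and \<theta>: "linear \<theta>"
    and \<omega>: "\<And>y. linear (\<lambda>x. \<omega> x y)" "\<And>x y. \<omega> x y = - \<omega> y x"
    and nd: "\<And>u. \<theta> u = 0 \<Longrightarrow> (\<And>w. \<omega> u w = 0) \<Longrightarrow> u = 0"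
  shows "\<exists>v. \<theta> v = 1 \<and> (\<forall>w. \<omega> v w = 0)"
proof -
  have "\<not> even (dim (UNIV :: 'e set))" using assms(1) by (simp add: dim_UNIV)
  then obtain x where x: "x \<noteq> 0" "\<And>y. \<omega> x y = 0"
    using even_dim_if_skew_nondegenerate[OF \<omega>, of UNIV] by auto
  then have "\<theta> x \<noteq> 0" using nd by blast
  then have "\<theta> ((1 / \<theta> x) *\<^sub>R x) = 1" "\<And>w. \<omega> ((1 / \<theta> x) *\<^sub>R x) w = 0"
    using linear_scale[OF \<theta>] linear_scale[OF \<omega>(1)] x by simp_all
  then show ?thesis by blast
qed

section \<open>Charts and tangent maps\<close>

lemma chart_at:
  assumes "smooth_atlas A"
  shows "chart_at A p \<in> A" "p \<in> fst (chart_at A p)"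
proof -
  have "(\<Union>c\<in>A. fst c) = UNIV" using assms by (simp add: smooth_atlas_def)
  then have "\<exists>c. c \<in> A \<and> p \<in> fst c" by blast
  from someI_ex[OF this] show "chart_at A p \<in> A" "p \<in> fst (chart_at A p)"
    by (simp_all add: chart_at_def)
qed

context
  fixes A :: "('m::topological_space, 'e::real_normed_vector) atlas" and c
  assumes A: "smooth_atlas A" "c \<in> A"
begin

lemma chart_homeomorphism: "homeomorphism (fst c) (snd c ` fst c) (snd c) (chart_inv c)"
  using A by (simp add: smooth_atlas_def)

lemma open_chart_domain: "open (fst c)"
  and open_chart_range: "open (snd c ` fst c)"
  using A by (simp_all add: smooth_atlas_def)

lemma chart_inv_chart [simp]: "p \<in> fst c \<Longrightarrow> chart_inv c (snd c p) = p"
  using chart_homeomorphism by (simp add: homeomorphism_def)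

lemma chart_chart_inv [simp]: "x \<in> snd c ` fst c \<Longrightarrow> snd c (chart_inv c x) = x"
  by auto

lemma chart_inv_in [simp]: "x \<in> snd c ` fst c \<Longrightarrow> chart_inv c x \<in> fst c"
  using chart_homeomorphism by (auto simp: homeomorphism_def)

lemma continuous_on_chart_inv: "continuous_on (snd c ` fst c) (chart_inv c)"
  using chart_homeomorphism by (simp add: homeomorphism_def)

lemma filterlim_chart: "p \<in> fst c \<Longrightarrow> filterlim (snd c) (nhds (snd c p)) (nhds p)"
  using chart_homeomorphism open_chart_domain
  by (intro filterlim_nhds_if_continuous_on) (auto simp: homeomorphism_def)

lemma filterlim_chart_inv:
  "x \<in> snd c ` fst c \<Longrightarrow> filterlim (chart_inv c) (nhds (chart_inv c x)) (nhds x)"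
  by (rule filterlim_nhds_if_continuous_on[OF continuous_on_chart_inv open_chart_range])

lemma open_chart_image:
  assumes "open W"
  shows "open (snd c ` (fst c \<inter> W))"
proof -
  have "snd c ` (fst c \<inter> W) = snd c ` fst c \<inter> chart_inv c -` W" by auto
  then show ?thesis
    using continuous_open_preimage[OF continuous_on_chart_inv open_chart_range assms] by simp
qed

lemma smooth_on_transition:
  "d \<in> A \<Longrightarrow> smooth_on (snd c ` (fst c \<inter> fst d)) (\<lambda>x. snd d (chart_inv c x))"
  using A by (simp add: smooth_atlas_def o_def)

end

lemma chart_at_std [simp]: "chart_at std_atlas x = (UNIV, id)"
  unfolding chart_at_def by (rule some_equality) (auto simp: std_atlas_def)

lemma chart_inv_std [simp]: "chart_inv (UNIV, id) = id"
  by (simp add: chart_inv_def fun_eq_iff)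

lemma smooth_atlas_std:
  assumes "finite S" and "span S = (UNIV :: 'a::real_normed_vector set)"
  shows "smooth_atlas (std_atlas :: ('a, 'a) atlas)"
  using assms
  by (auto simp: smooth_atlas_def std_atlas_def homeomorphism_def smooth_on_ident[folded id_def]
      intro!: exI[of _ S])

lemma smooth_atlas_std_model: "smooth_atlas (A :: ('m::topological_space, 'e::real_normed_vector) atlas) \<Longrightarrow> smooth_atlas (std_atlas :: ('e, 'e) atlas)"
  by (metis smooth_atlas_def smooth_atlas_std)

lemma smooth_atlas_std_real: "smooth_atlas (std_atlas :: (real, real) atlas)"
  by (rule smooth_atlas_std[of "{1}"]) (auto simp: span_singleton intro!: exI[of _ "_ :: real"])

text \<open>Differentiability at \<open>p\<close>, with the derivative read in the preferred charts. The coordinate expression of \<open>f\<close>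
is meaningful only where \<open>f\<close> takes values in the chart around \<open>f p\<close>; continuity at \<open>p\<close> ensures this on a
neighbourhood.\<close>

definition has_tangent_map :: "('m::topological_space, 'e::real_normed_vector) atlas \<Rightarrow>
    ('k::topological_space, 'f::real_normed_vector) atlas \<Rightarrow> ('m \<Rightarrow> 'k) \<Rightarrow> 'm \<Rightarrow> ('e \<Rightarrow> 'f) \<Rightarrow> bool" where
  "has_tangent_map A B f p L \<longleftrightarrow> filterlim f (nhds (f p)) (nhds p) \<and>
     ((\<lambda>x. snd (chart_at B (f p)) (f (chart_inv (chart_at A p) x))) has_derivative L)
       (at (snd (chart_at A p) p))"

lemma tangent_map_eqI: "has_tangent_map A B f p L \<Longrightarrow> tangent_map A B f p = L"
  by (simp add: has_tangent_map_def tangent_map_def o_def D_eqI)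

lemma has_tangent_map_tangent_map:
  "has_tangent_map A B f p L \<Longrightarrow> has_tangent_map A B f p (tangent_map A B f p)"
  by (simp add: tangent_map_eqI)

lemma has_tangent_map_linear: "has_tangent_map A B f p L \<Longrightarrow> linear L"
  unfolding has_tangent_map_def by (blast intro: has_derivative_linear)

lemma has_tangent_map_filterlim: "has_tangent_map A B f p L \<Longrightarrow> filterlim f (nhds (f p)) (nhds p)"
  by (simp add: has_tangent_map_def)

lemma has_tangent_map_std_iff:
  "has_tangent_map std_atlas std_atlas f x L \<longleftrightarrow> (f has_derivative L) (at x)"
proof -
  have "filterlim f (nhds (f x)) (nhds x)" if "(f has_derivative L) (at x)"
    using has_derivative_continuous[OF that] by (simp add: isCont_def tendsto_at_iff_tendsto_nhds)
  then show ?thesis by (auto simp: has_tangent_map_def)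
qed

text \<open>The outer and the inner map use the same preferred chart at \<open>f p\<close>, so the chain rule in coordinates
applies without a change of charts.\<close>

lemma has_tangent_map_compose:
  assumes A: "smooth_atlas A" and B: "smooth_atlas B"
    and f: "has_tangent_map A B f p L" and g: "has_tangent_map B C g (f p) L'"
  shows "has_tangent_map A C (\<lambda>x. g (f x)) p (\<lambda>v. L' (L v))"
proof -
  let ?c = "chart_at A p" and ?d = "chart_at B (f p)" and ?k = "chart_at C (g (f p))"
  note c = chart_at[OF A, of p] and d = chart_at[OF B, of "f p"]
  let ?F = "\<lambda>x. snd ?d (f (chart_inv ?c x))" and ?G = "\<lambda>y. snd ?k (g (chart_inv ?d y))"
  have lim: "filterlim (\<lambda>x. f (chart_inv ?c x)) (nhds (f p)) (nhds (snd ?c p))"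
    using filterlim_chart_inv[OF A c(1), of "snd ?c p"] c
    by (intro filterlim_compose[OF has_tangent_map_filterlim[OF f]]) (simp add: chart_inv_chart[OF A c(1)])
  have "eventually (\<lambda>q. q \<in> fst ?d) (nhds (f p))"
    using d open_chart_domain[OF B d(1)] by (simp add: eventually_nhds_in_open)
  from filterlim_iff[THEN iffD1, OF lim, rule_format, OF this]
  have ev: "\<forall>\<^sub>F x in nhds (snd ?c p). f (chart_inv ?c x) \<in> fst ?d" .
  have F0: "?F (snd ?c p) = snd ?d (f p)" using c by (simp add: chart_inv_chart[OF A c(1)])
  have "(?F has_derivative L) (at (snd ?c p))" "(?G has_derivative L') (at (?F (snd ?c p)))"
    using f g unfolding F0 by (simp_all add: has_tangent_map_def)
  from has_derivative_compose[OF this(1), of ?G L'] this(2)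
  have "((\<lambda>x. ?G (?F x)) has_derivative (\<lambda>v. L' (L v))) (at (snd ?c p))" by simp
  then have "((\<lambda>x. snd ?k (g (f (chart_inv ?c x)))) has_derivative (\<lambda>v. L' (L v))) (at (snd ?c p))"
  proof (rule has_derivative_transform_eventually)
    show "\<forall>\<^sub>F x in at (snd ?c p). ?G (?F x) = snd ?k (g (f (chart_inv ?c x)))"
      using filter_leD[OF at_le[OF order_refl, of "snd ?c p" UNIV], simplified] ev
      unfolding eventually_at_filter
      by (auto elim!: eventually_mono simp: chart_inv_chart[OF B d(1)])
  qed (use c d in \<open>auto simp: chart_inv_chart[OF A c(1)] chart_inv_chart[OF B d(1)]\<close>)
  moreover have "filterlim (\<lambda>x. g (f x)) (nhds (g (f p))) (nhds p)"
    by (rule filterlim_compose[OF has_tangent_map_filterlim[OF g] has_tangent_map_filterlim[OF f]])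
  ultimately show ?thesis by (simp add: has_tangent_map_def)
qed

lemma has_tangent_map_cong:
  assumes A: "smooth_atlas A" and f: "has_tangent_map A B f p L"
    and ev: "\<forall>\<^sub>F q in nhds p. f q = g q"
  shows "has_tangent_map A B g p L"
proof -
  let ?c = "chart_at A p"
  note c = chart_at[OF A, of p]
  have p: "f p = g p" using eventually_nhds_x_imp_x[OF ev] .
  have lim: "filterlim (chart_inv ?c) (nhds p) (nhds (snd ?c p))"
    using filterlim_chart_inv[OF A c(1), of "snd ?c p"] c by (simp add: chart_inv_chart[OF A c(1)])
  from filterlim_iff[THEN iffD1, OF lim, rule_format, OF ev]
  have ev': "\<forall>\<^sub>F x in nhds (snd ?c p). f (chart_inv ?c x) = g (chart_inv ?c x)" .
  have "((\<lambda>x. snd (chart_at B (f p)) (f (chart_inv ?c x))) has_derivative L) (at (snd ?c p))"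
    using f by (simp add: has_tangent_map_def)
  then have "((\<lambda>x. snd (chart_at B (f p)) (g (chart_inv ?c x))) has_derivative L) (at (snd ?c p))"
    by (rule has_derivative_transform_eventually)
       (use ev' p c in \<open>auto simp: eventually_at_filter chart_inv_chart[OF A c(1)] elim: eventually_mono\<close>)
  moreover have "filterlim g (nhds (g p)) (nhds p)"
    using has_tangent_map_filterlim[OF f] filterlim_cong[OF refl refl ev] p by simp
  ultimately show ?thesis by (simp add: has_tangent_map_def p)
qed

lemma has_tangent_map_const: "has_tangent_map A B (\<lambda>x. q) p (\<lambda>v. 0)"
  by (simp add: has_tangent_map_def tendsto_const)

lemma has_tangent_map_ident:
  assumes A: "smooth_atlas A"
  shows "has_tangent_map A A (\<lambda>x. x) p (\<lambda>v. v)"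
proof -
  let ?c = "chart_at A p"
  note c = chart_at[OF A, of p]
  have "((\<lambda>x. snd ?c (chart_inv ?c x)) has_derivative (\<lambda>v. v)) (at (snd ?c p))"
    by (rule has_derivative_transform_within_open[OF has_derivative_ident open_chart_range[OF A c(1)]])
       (use c in \<open>auto simp: chart_inv_chart[OF A c(1)]\<close>)
  then show ?thesis by (simp add: has_tangent_map_def filterlim_ident)
qed

lemma has_tangent_map_chart:
  assumes A: "smooth_atlas A" and c: "c \<in> A" and p: "p \<in> fst c"
  shows "has_tangent_map A std_atlas (snd c) p (tangent_map A std_atlas (snd c) p)"
proof -
  note d = chart_at[OF A, of p]
  have "((\<lambda>x. snd c (chart_inv (chart_at A p) x)) has_derivative
      D (\<lambda>x. snd c (chart_inv (chart_at A p) x)) (snd (chart_at A p) p)) (at (snd (chart_at A p) p))"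
    by (rule smooth_on_has_derivative[OF smooth_on_transition[OF A d(1) c]]) (use d p in auto)
  then have "has_tangent_map A std_atlas (snd c) p (D (\<lambda>x. snd c (chart_inv (chart_at A p) x)) (snd (chart_at A p) p))"
    using filterlim_chart[OF A c p] by (simp add: has_tangent_map_def)
  then show ?thesis by (rule has_tangent_map_tangent_map)
qed

lemma has_tangent_map_chart_inv:
  assumes A: "smooth_atlas A" and c: "c \<in> A" and x: "x \<in> snd c ` fst c"
  shows "has_tangent_map std_atlas A (chart_inv c) x (tangent_map std_atlas A (chart_inv c) x)"
proof -
  define p where "p = chart_inv c x"
  note d = chart_at[OF A, of p]
  have "((\<lambda>x. snd (chart_at A p) (chart_inv c x)) has_derivative
      D (\<lambda>x. snd (chart_at A p) (chart_inv c x)) x) (at x)"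
    by (rule smooth_on_has_derivative[OF smooth_on_transition[OF A c d(1)]])
       (use d x in \<open>auto simp: p_def chart_inv_chart[OF A c]\<close>)
  then have "has_tangent_map std_atlas A (chart_inv c) x (D (\<lambda>x. snd (chart_at A p) (chart_inv c x)) x)"
    using filterlim_chart_inv[OF A c x] by (simp add: has_tangent_map_def p_def)
  then show ?thesis by (rule has_tangent_map_tangent_map)
qed

lemma tangent_map_chart_inv_chart:
  assumes A: "smooth_atlas A" and c: "c \<in> A" and p: "p \<in> fst c"
  shows "tangent_map std_atlas A (chart_inv c) (snd c p) (tangent_map A std_atlas (snd c) p v) = v"
proof -
  have "has_tangent_map A A (\<lambda>x. chart_inv c (snd c x)) p
      (\<lambda>v. tangent_map std_atlas A (chart_inv c) (snd c p) (tangent_map A std_atlas (snd c) p v))"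
    by (rule has_tangent_map_compose[OF A smooth_atlas_std_model[OF A] has_tangent_map_chart[OF A c p]
        has_tangent_map_chart_inv[OF A c imageI[OF p]]])
  moreover have "\<forall>\<^sub>F y in nhds p. chart_inv c (snd c y) = y"
    using eventually_nhds_in_open[OF open_chart_domain[OF A c] p]
    by (auto elim!: eventually_mono simp: chart_inv_chart[OF A c])
  ultimately have "has_tangent_map A A (\<lambda>x. x) p
      (\<lambda>v. tangent_map std_atlas A (chart_inv c) (snd c p) (tangent_map A std_atlas (snd c) p v))"
    by (rule has_tangent_map_cong[OF A])
  from tangent_map_eqI[OF this] tangent_map_eqI[OF has_tangent_map_ident[OF A]]
  show ?thesis by metis
qed

text \<open>Tangent vectors are components in preferred charts. In arbitrary charts, the coordinate expression is
the composition of an inverse chart, the map and a chart, to which the chain rule applies.\<close>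

lemma has_tangent_map_in_charts:
  assumes A: "smooth_atlas A" and B: "smooth_atlas B" and f: "has_tangent_map A B f p L"
    and c: "c \<in> A" "p \<in> fst c" and d: "d \<in> B" "f p \<in> fst d"
  shows "((\<lambda>x. snd d (f (chart_inv c x))) has_derivative
     (\<lambda>w. tangent_map B std_atlas (snd d) (f p) (L (tangent_map std_atlas A (chart_inv c) (snd c p) w)))) (at (snd c p))"
proof -
  note std = smooth_atlas_std_model[OF A]
  have p: "chart_inv c (snd c p) = p" using chart_inv_chart[OF A c] by simp
  have "has_tangent_map std_atlas B (\<lambda>x. f (chart_inv c x)) (snd c p)
      (\<lambda>w. L (tangent_map std_atlas A (chart_inv c) (snd c p) w))"
    using has_tangent_map_compose[OF std A has_tangent_map_chart_inv[OF A c(1) imageI[OF c(2)]], of B f L] f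
    by (simp add: p)
  from has_tangent_map_compose[OF std B this, of std_atlas "snd d"] has_tangent_map_chart[OF B d]
  show ?thesis by (simp add: p has_tangent_map_std_iff)
qed

lemma has_tangent_map_from_charts:
  assumes A: "smooth_atlas A" and B: "smooth_atlas B" and f: "filterlim f (nhds (f p)) (nhds p)"
    and c: "c \<in> A" "p \<in> fst c" and d: "d \<in> B" "f p \<in> fst d"
    and M: "((\<lambda>x. snd d (f (chart_inv c x))) has_derivative M) (at (snd c p))"
  shows "has_tangent_map A B f p
     (\<lambda>v. tangent_map std_atlas B (chart_inv d) (snd d (f p)) (M (tangent_map A std_atlas (snd c) p v)))"
proof -
  have p: "chart_inv c (snd c p) = p" using chart_inv_chart[OF A c] by simp
  have "has_tangent_map A std_atlas (\<lambda>q. snd d (f (chart_inv c (snd c q)))) p (\<lambda>v. M (tangent_map A std_atlas (snd c) p v))"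
    by (rule has_tangent_map_compose[OF A smooth_atlas_std_model[OF A] has_tangent_map_chart[OF A c]])
       (use M in \<open>simp add: has_tangent_map_std_iff\<close>)
  from has_tangent_map_compose[OF A smooth_atlas_std_model[OF B] this, of B "chart_inv d"
      "tangent_map std_atlas B (chart_inv d) (snd d (f p))"]
  have "has_tangent_map A B (\<lambda>q. chart_inv d (snd d (f (chart_inv c (snd c q))))) p
     (\<lambda>v. tangent_map std_atlas B (chart_inv d) (snd d (f p)) (M (tangent_map A std_atlas (snd c) p v)))"
    using has_tangent_map_chart_inv[OF B d(1) imageI[OF d(2)]] by (simp add: p)
  moreover have "\<forall>\<^sub>F q in nhds p. q \<in> fst c \<and> f q \<in> fst d"
    using eventually_nhds_in_open[OF open_chart_domain[OF A c(1)] c(2)]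
      filterlim_iff[THEN iffD1, OF f, rule_format, OF eventually_nhds_in_open[OF open_chart_domain[OF B d(1)] d(2)]]
    by (rule eventually_conj)
  then have "\<forall>\<^sub>F q in nhds p. chart_inv d (snd d (f (chart_inv c (snd c q)))) = f q"
    by (rule eventually_mono) (simp add: chart_inv_chart[OF A c(1)] chart_inv_chart[OF B d(1)])
  ultimately show ?thesis by (rule has_tangent_map_cong[OF A])
qed

section \<open>Smooth maps between manifolds\<close>

lemma model_frame_exists:
  fixes A :: "('m::topological_space, 'e::real_inner) atlas"
  assumes "smooth_atlas A"
  obtains C :: "'e set" where "frame C"
  using assms frame_exists unfolding smooth_atlas_def by blast

lemma smooth_map_in_charts:
  assumes A: "smooth_atlas A" and B: "smooth_atlas B" and f: "smooth_map A B f" and "c \<in> A" "d \<in> B"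
  shows "open {x \<in> snd c ` fst c. f (chart_inv c x) \<in> fst d}"
    and "smooth_on {x \<in> snd c ` fst c. f (chart_inv c x) \<in> fst d} (\<lambda>x. snd d (f (chart_inv c x)))"
proof -
  have eq: "{x \<in> snd c ` fst c. f (chart_inv c x) \<in> fst d} = snd c ` (fst c \<inter> f -` fst d)"
    using chart_inv_chart[OF A \<open>c \<in> A\<close>] by auto
  have "continuous_on UNIV f" using f by (simp add: smooth_map_def)
  then have "open (f -` fst d)" using open_chart_domain[OF B \<open>d \<in> B\<close>] by (simp add: open_vimage)
  then show "open {x \<in> snd c ` fst c. f (chart_inv c x) \<in> fst d}"
    unfolding eq by (rule open_chart_image[OF A \<open>c \<in> A\<close>])
  show "smooth_on {x \<in> snd c ` fst c. f (chart_inv c x) \<in> fst d} (\<lambda>x. snd d (f (chart_inv c x)))"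
    unfolding eq using f assms(4,5) by (simp add: smooth_map_def o_def)
qed

lemma smooth_map_filterlim: "smooth_map A B f \<Longrightarrow> filterlim f (nhds (f p)) (nhds p)"
  by (intro filterlim_nhds_if_continuous_on[of UNIV]) (auto simp: smooth_map_def)

lemma smooth_map_has_tangent_map:
  assumes A: "smooth_atlas A" and B: "smooth_atlas B" and f: "smooth_map A B f"
  shows "has_tangent_map A B f p (tangent_map A B f p)"
proof -
  note c = chart_at[OF A, of p] and d = chart_at[OF B, of "f p"]
  have "snd (chart_at A p) p \<in> {x \<in> snd (chart_at A p) ` fst (chart_at A p).
      f (chart_inv (chart_at A p) x) \<in> fst (chart_at B (f p))}"
    using c d by (simp add: chart_inv_chart[OF A c(1)])
  from has_tangent_map_from_charts[OF A B smooth_map_filterlim[OF f] c d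
      smooth_on_has_derivative[OF smooth_map_in_charts(2)[OF A B f c(1) d(1)] this]]
  show ?thesis by (rule has_tangent_map_tangent_map)
qed

lemma chart_inv_prod:
  assumes A: "smooth_atlas A" "c \<in> A" and B: "smooth_atlas B" "d \<in> B"
    and "x \<in> snd c ` fst c" "y \<in> snd d ` fst d"
  shows "chart_inv (fst c \<times> fst d, map_prod (snd c) (snd d)) (x, y) = (chart_inv c x, chart_inv d y)"
proof -
  have "inj_on (snd c) (fst c)" "inj_on (snd d) (fst d)"
    using chart_inv_chart[OF A] chart_inv_chart[OF B] by (metis inj_onI)+
  then have "inj_on (map_prod (snd c) (snd d)) (fst c \<times> fst d)" by (rule map_prod_inj_on)
  then show ?thesis
    unfolding chart_inv_def[of "(_, _)"] fst_conv snd_conv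
    by (rule inv_into_f_eq)
       (use assms(5,6) in \<open>simp_all add: chart_inv_in[OF A] chart_inv_in[OF B] chart_chart_inv[OF A] chart_chart_inv[OF B]\<close>)
qed

text \<open>The product atlas enters only through this coordinate expression. The
preferred chart of the product atlas at a pair need not be the product of the preferred charts, so
derivatives of maps of two variables are taken in coordinates.\<close>

lemma smooth_map_prod_in_charts:
  fixes f :: "'m::topological_space \<Rightarrow> 'k::topological_space \<Rightarrow> 'l::topological_space"
  assumes A: "smooth_atlas A" and B: "smooth_atlas B" and C: "smooth_atlas C"
    and f: "smooth_map (prod_atlas A B) C (\<lambda>(a, b). f a b)"
    and c: "c \<in> A" and d: "d \<in> B" and k: "k \<in> C"
  defines "\<Omega> \<equiv> {z. fst z \<in> snd c ` fst c \<and> snd z \<in> snd d ` fst d \<and>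
      f (chart_inv c (fst z)) (chart_inv d (snd z)) \<in> fst k}"
  shows "open \<Omega>" and "smooth_on \<Omega> (\<lambda>z. snd k (f (chart_inv c (fst z)) (chart_inv d (snd z))))"
proof -
  have cont: "continuous_on UNIV (\<lambda>(a, b). f a b)" using f by (simp add: smooth_map_def)
  let ?R = "(snd c ` fst c) \<times> (snd d ` fst d)"
  have "continuous_on ?R (\<lambda>z. (chart_inv c (fst z), chart_inv d (snd z)))"
    by (intro continuous_on_Pair continuous_on_compose2[OF continuous_on_chart_inv[OF A c]]
        continuous_on_compose2[OF continuous_on_chart_inv[OF B d]] continuous_on_fst continuous_on_snd
        continuous_on_id) auto
  then have "continuous_on ?R (\<lambda>z. f (chart_inv c (fst z)) (chart_inv d (snd z)))"
    using continuous_on_compose2[OF cont, of ?R "\<lambda>z. (chart_inv c (fst z), chart_inv d (snd z))"] by simp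
  from continuous_open_preimage[OF this _ open_chart_domain[OF C k]]
  have "open (?R \<inter> (\<lambda>z. f (chart_inv c (fst z)) (chart_inv d (snd z))) -` fst k)"
    using open_chart_range[OF A c] open_chart_range[OF B d] by (simp add: open_Times)
  also have "\<dots> = \<Omega>" by (auto simp: \<Omega>_def)
  finally show o: "open \<Omega>" .
  let ?p = "(fst c \<times> fst d, map_prod (snd c) (snd d))"
  have "?p \<in> prod_atlas A B" unfolding prod_atlas_def using c d by blast
  then have "smooth_on (snd ?p ` (fst ?p \<inter> (\<lambda>(a, b). f a b) -` fst k)) (\<lambda>z. snd k ((\<lambda>(a, b). f a b) (chart_inv ?p z)))"
    using f k unfolding smooth_map_def o_def by blast
  moreover have "\<Omega> \<subseteq> snd ?p ` (fst ?p \<inter> (\<lambda>(a, b). f a b) -` fst k)"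
  proof
    fix z assume z: "z \<in> \<Omega>"
    then have "z = snd ?p (chart_inv c (fst z), chart_inv d (snd z))"
      by (simp add: \<Omega>_def chart_chart_inv[OF A c] chart_chart_inv[OF B d])
    moreover have "(chart_inv c (fst z), chart_inv d (snd z)) \<in> fst ?p \<inter> (\<lambda>(a, b). f a b) -` fst k"
      using z by (simp add: \<Omega>_def chart_inv_in[OF A c] chart_inv_in[OF B d])
    ultimately show "z \<in> snd ?p ` (fst ?p \<inter> (\<lambda>(a, b). f a b) -` fst k)" by (rule image_eqI)
  qed
  ultimately have "smooth_on \<Omega> (\<lambda>z. snd k ((\<lambda>(a, b). f a b) (chart_inv ?p z)))"
    by (rule smooth_on_subset)
  then show "smooth_on \<Omega> (\<lambda>z. snd k (f (chart_inv c (fst z)) (chart_inv d (snd z))))"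
  proof (rule smooth_on_cong[OF o, rotated])
    fix z assume z: "z \<in> \<Omega>"
    then have "chart_inv ?p z = (chart_inv c (fst z), chart_inv d (snd z))"
      using chart_inv_prod[OF A c B d, of "fst z" "snd z"] by (simp add: \<Omega>_def)
    then show "snd k ((\<lambda>(a, b). f a b) (chart_inv ?p z)) = snd k (f (chart_inv c (fst z)) (chart_inv d (snd z)))"
      by simp
  qed
qed

text \<open>The Leibniz rule for an arbitrary smooth operation of two variables: the derivative of its coordinate
expression is the sum of the two partial derivatives, and these are tangent maps of the
sections of \<open>f\<close>. Applied to group multiplication it computes velocities of products of curves.\<close>

lemma has_tangent_map_combine:
  fixes f :: "'m::topological_space \<Rightarrow> 'k::topological_space \<Rightarrow> 'l::topological_space"
  assumes A: "smooth_atlas A" and B: "smooth_atlas B" and B': "smooth_atlas B'" and C: "smooth_atlas C"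
    and f: "smooth_map (prod_atlas B B') C (\<lambda>(a, b). f a b)"
    and u: "has_tangent_map A B u p Lu" and v: "has_tangent_map A B' v p Lv"
  shows "has_tangent_map A C (\<lambda>x. f (u x) (v x)) p (\<lambda>w.
     tangent_map B C (\<lambda>a. f a (v p)) (u p) (Lu w) + tangent_map B' C (f (u p)) (v p) (Lv w))"
proof -
  let ?a = "chart_at A p" and ?b = "chart_at B (u p)" and ?b' = "chart_at B' (v p)"
    and ?k = "chart_at C (f (u p) (v p))"
  note a = chart_at[OF A, of p] and b = chart_at[OF B, of "u p"] and b' = chart_at[OF B', of "v p"]
    and k = chart_at[OF C, of "f (u p) (v p)"]
  define F where "F = (\<lambda>z. snd ?k (f (chart_inv ?b (fst z)) (chart_inv ?b' (snd z))))"
  define x0 where "x0 = snd ?b (u p)"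
  define y0 where "y0 = snd ?b' (v p)"
  have inv: "chart_inv ?a (snd ?a p) = p" "chart_inv ?b x0 = u p" "chart_inv ?b' y0 = v p"
    using a b b' by (simp_all add: x0_def y0_def chart_inv_chart[OF A a(1)] chart_inv_chart[OF B b(1)] chart_inv_chart[OF B' b'(1)])
  have dF: "(F has_derivative D F (x0, y0)) (at (x0, y0))"
    unfolding F_def
    by (rule smooth_on_has_derivative[OF smooth_map_prod_in_charts(2)[OF B B' C f b(1) b'(1) k(1)]])
       (use b b' k in \<open>simp add: inv, simp add: x0_def y0_def\<close>)
  have lin: "linear (D F (x0, y0))" using dF by (rule has_derivative_linear)
  have U: "((\<lambda>x. snd ?b (u (chart_inv ?a x))) has_derivative Lu) (at (snd ?a p))"
    and V: "((\<lambda>x. snd ?b' (v (chart_inv ?a x))) has_derivative Lv) (at (snd ?a p))"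
    using u v by (simp_all add: has_tangent_map_def)
  have "((\<lambda>x. F (snd ?b (u (chart_inv ?a x)), snd ?b' (v (chart_inv ?a x)))) has_derivative
      (\<lambda>w. D F (x0, y0) (Lu w, Lv w))) (at (snd ?a p))"
    by (rule has_derivative_compose[OF has_derivative_Pair[OF U V], of F "D F (x0, y0)"])
       (use dF in \<open>simp add: inv, simp add: x0_def y0_def\<close>)
  moreover have lim: "filterlim (chart_inv ?a) (nhds p) (nhds (snd ?a p))"
    using filterlim_chart_inv[OF A a(1) imageI[OF a(2)]] by (simp add: inv)
  have "\<forall>\<^sub>F q in nhds p. u q \<in> fst ?b \<and> v q \<in> fst ?b'"
    using filterlim_iff[THEN iffD1, OF has_tangent_map_filterlim[OF u], rule_format,
        OF eventually_nhds_in_open[OF open_chart_domain[OF B b(1)] b(2)]]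
      filterlim_iff[THEN iffD1, OF has_tangent_map_filterlim[OF v], rule_format,
        OF eventually_nhds_in_open[OF open_chart_domain[OF B' b'(1)] b'(2)]]
    by (rule eventually_conj)
  from filterlim_iff[THEN iffD1, OF lim, rule_format, OF this]
  have ev: "\<forall>\<^sub>F x in nhds (snd ?a p). F (snd ?b (u (chart_inv ?a x)), snd ?b' (v (chart_inv ?a x)))
      = snd ?k (f (u (chart_inv ?a x)) (v (chart_inv ?a x)))"
    by (rule eventually_mono) (simp add: F_def chart_inv_chart[OF B b(1)] chart_inv_chart[OF B' b'(1)])
  have "((\<lambda>x. snd ?k (f (u (chart_inv ?a x)) (v (chart_inv ?a x)))) has_derivative
      (\<lambda>w. D F (x0, y0) (Lu w, Lv w))) (at (snd ?a p))"
    by (rule has_derivative_transform_eventually[OF calculation])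
       (use ev in \<open>auto simp: eventually_at_filter dest: eventually_nhds_x_imp_x elim: eventually_mono\<close>)
  moreover have "D F (x0, y0) (r, s)
      = tangent_map B C (\<lambda>a. f a (v p)) (u p) r + tangent_map B' C (f (u p)) (v p) s" for r s
  proof -
    have "((\<lambda>x. F (x, y0)) has_derivative (\<lambda>r. D F (x0, y0) (r, 0))) (at x0)"
      by (rule has_derivative_compose[of "\<lambda>x. (x, y0)" "\<lambda>r. (r, 0)" x0 UNIV F "D F (x0, y0)", OF _ dF])
         (auto intro!: derivative_eq_intros)
    then have 1: "tangent_map B C (\<lambda>a. f a (v p)) (u p) r = D F (x0, y0) (r, 0)"
      by (simp add: tangent_map_def o_def F_def inv D_eqI flip: x0_def)
    have "((\<lambda>y. F (x0, y)) has_derivative (\<lambda>s. D F (x0, y0) (0, s))) (at y0)"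
      by (rule has_derivative_compose[of "\<lambda>y. (x0, y)" "\<lambda>s. (0, s)" y0 UNIV F "D F (x0, y0)", OF _ dF])
         (auto intro!: derivative_eq_intros)
    then have 2: "tangent_map B' C (f (u p)) (v p) s = D F (x0, y0) (0, s)"
      by (simp add: tangent_map_def o_def F_def inv D_eqI flip: y0_def)
    show ?thesis using linear_add[OF lin, of "(r, 0)" "(0, s)"] by (simp add: 1 2)
  qed
  moreover have "filterlim (\<lambda>x. f (u x) (v x)) (nhds (f (u p) (v p))) (nhds p)"
  proof -
    have "filterlim (\<lambda>x. (u x, v x)) (nhds (u p, v p)) (nhds p)"
      unfolding nhds_prod
      by (intro filterlim_Pair has_tangent_map_filterlim[OF u] has_tangent_map_filterlim[OF v])
    from filterlim_compose[OF smooth_map_filterlim[OF f] this] show ?thesis by simp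
  qed
  ultimately show ?thesis by (simp add: has_tangent_map_def)
qed

lemma has_tangent_map_combine_left:
  assumes B: "smooth_atlas B" and B': "smooth_atlas B'" and C: "smooth_atlas C"
    and f: "smooth_map (prod_atlas B B') C (\<lambda>(a, b). f a b)"
  shows "has_tangent_map B C (\<lambda>a. f a b) a (tangent_map B C (\<lambda>a. f a b) a)"
  using has_tangent_map_combine[OF B B B' C f has_tangent_map_ident[OF B] has_tangent_map_const]
  by (rule has_tangent_map_tangent_map)

lemma has_tangent_map_combine_right:
  assumes B: "smooth_atlas B" and B': "smooth_atlas B'" and C: "smooth_atlas C"
    and f: "smooth_map (prod_atlas B B') C (\<lambda>(a, b). f a b)"
  shows "has_tangent_map B' C (f a) b (tangent_map B' C (f a) b)"
  using has_tangent_map_combine[OF B' B B' C f has_tangent_map_const has_tangent_map_ident[OF B']]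
  by (rule has_tangent_map_tangent_map)

text \<open>In a chart around \<open>\<delta> t\<close> the derivative vanishes on an interval, so \<open>\<delta>\<close> is locally constant.\<close>

lemma constant_if_tangent_map_zero:
  fixes \<delta> :: "real \<Rightarrow> 'm::topological_space"
  assumes A: "smooth_atlas A" and I: "open I" "connected I"
    and \<delta>: "\<And>t. t \<in> I \<Longrightarrow> has_tangent_map std_atlas A \<delta> t (\<lambda>s. 0)"
    and "s \<in> I" "t \<in> I"
  shows "\<delta> s = \<delta> t"
proof (rule connected_local_const[OF I(2) \<open>s \<in> I\<close> \<open>t \<in> I\<close>], intro ballI)
  fix t assume t: "t \<in> I"
  let ?c = "chart_at A (\<delta> t)"
  note c = chart_at[OF A, of "\<delta> t"]
  have "\<forall>\<^sub>F s in nhds t. \<delta> s \<in> fst ?c \<and> s \<in> I"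
    using filterlim_iff[THEN iffD1, OF has_tangent_map_filterlim[OF \<delta>[OF t]], rule_format,
        OF eventually_nhds_in_open[OF open_chart_domain[OF A c(1)] c(2)]]
      eventually_nhds_in_open[OF I(1) t]
    by (rule eventually_conj)
  then obtain d where "d > 0" and d: "\<And>s. dist s t < d \<Longrightarrow> \<delta> s \<in> fst ?c \<and> s \<in> I"
    by (auto simp: eventually_nhds_metric)
  have "((\<lambda>s. snd ?c (\<delta> s)) has_derivative (\<lambda>s. 0)) (at s within ball t d)" if "s \<in> ball t d" for s
  proof -
    have s: "\<delta> s \<in> fst ?c" "s \<in> I" using d[of s] that by (auto simp: dist_commute)
    from has_tangent_map_in_charts[OF smooth_atlas_std_real A \<delta>[OF s(2)], of "(UNIV, id)" ?c] s c
    have "((\<lambda>s. snd ?c (\<delta> s)) has_derivative (\<lambda>s. 0)) (at s)"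
      using linear_0[OF has_tangent_map_linear[OF has_tangent_map_chart[OF A c(1) s(1)]]]
      by (simp add: std_atlas_def)
    then show ?thesis by (rule has_derivative_at_withinI)
  qed
  then have const: "snd ?c (\<delta> s) = snd ?c (\<delta> t)" if "s \<in> ball t d" for s
    using has_derivative_zero_constant[of "ball t d" "\<lambda>s. snd ?c (\<delta> s)"] that \<open>d > 0\<close>
    by (metis centre_in_ball convex_ball)
  have "\<delta> t = \<delta> s" if "s \<in> ball t d" for s
  proof -
    have "\<delta> s \<in> fst ?c" using d[of s] that by (auto simp: dist_commute)
    then show ?thesis using const[OF that] c(2) chart_inv_chart[OF A c(1)] by metis
  qed
  then have "\<forall>\<^sub>F s in nhds t. \<delta> t = \<delta> s"
    using \<open>d > 0\<close> by (auto simp: eventually_nhds_metric dist_commute)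
  then show "\<forall>\<^sub>F s in at t within I. \<delta> t = \<delta> s"
    by (auto simp: eventually_at_filter elim: eventually_mono)
qed

lemma smooth_mapI:
  assumes A: "smooth_atlas A" and "continuous_on UNIV f"
    and "\<And>c d x. c \<in> A \<Longrightarrow> d \<in> B \<Longrightarrow> x \<in> snd c ` fst c \<Longrightarrow> f (chart_inv c x) \<in> fst d \<Longrightarrow>
      \<exists>U. open U \<and> x \<in> U \<and> smooth_on U (\<lambda>x. snd d (f (chart_inv c x)))"
  shows "smooth_map A B f"
  unfolding smooth_map_def o_def
proof (intro conjI ballI assms(2) smooth_on_local)
  fix c d x assume cd: "c \<in> A" "d \<in> B" and x: "x \<in> snd c ` (fst c \<inter> f -` fst d)"
  then have "x \<in> snd c ` fst c" "f (chart_inv c x) \<in> fst d"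
    by (auto simp: chart_inv_chart[OF A cd(1)])
  then show "\<exists>U. open U \<and> x \<in> U \<and> smooth_on U (\<lambda>x. snd d (f (chart_inv c x)))"
    by (rule assms(3)[OF cd])
qed

lemma smooth_map_compose:
  fixes B :: "('k::topological_space, 'f::real_inner) atlas"
  assumes A: "smooth_atlas A" and B: "smooth_atlas B" and C: "smooth_atlas C"
    and f: "smooth_map A B f" and g: "smooth_map B C g"
  shows "smooth_map A C (\<lambda>x. g (f x))"
proof (rule smooth_mapI[OF A])
  show "continuous_on UNIV (\<lambda>x. g (f x))"
    using f g continuous_on_compose2[of UNIV g UNIV f] by (simp add: smooth_map_def)
  fix c k x assume c: "c \<in> A" and k: "k \<in> C" and x: "x \<in> snd c ` fst c" "g (f (chart_inv c x)) \<in> fst k"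
  obtain E :: "'f set" where E: "frame E" by (rule model_frame_exists[OF B])
  let ?d = "chart_at B (f (chart_inv c x))"
  note d = chart_at[OF B, of "f (chart_inv c x)"]
  let ?F = "\<lambda>x. snd ?d (f (chart_inv c x))"
  let ?U = "{x \<in> snd c ` fst c. f (chart_inv c x) \<in> fst ?d}"
  let ?V = "{y \<in> snd ?d ` fst ?d. g (chart_inv ?d y) \<in> fst k}"
  note F = smooth_map_in_charts[OF A B f c d(1)] and G = smooth_map_in_charts[OF B C g d(1) k]
  define S where "S = ?U \<inter> ?F -` ?V"
  have "open S"
    unfolding S_def by (rule continuous_open_preimage[OF smooth_on_imp_continuous[OF F(2)] F(1) G(1)])
  moreover have "x \<in> S" using x d by (simp add: S_def chart_inv_chart[OF B d(1)])
  moreover have "smooth_on S (\<lambda>x. snd k (g (chart_inv ?d (?F x))))"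
    by (rule smooth_on_compose[OF E \<open>open S\<close> G(1) _ G(2)])
       (auto simp: S_def intro: smooth_on_subset[OF F(2)])
  then have "smooth_on S (\<lambda>x. snd k (g (f (chart_inv c x))))"
    by (rule smooth_on_cong[OF \<open>open S\<close>, rotated]) (auto simp: S_def chart_inv_chart[OF B d(1)])
  ultimately show "\<exists>U. open U \<and> x \<in> U \<and> smooth_on U (\<lambda>x. snd k (g (f (chart_inv c x))))" by blast
qed

lemma smooth_map_stdI:
  fixes f :: "'a::real_normed_vector \<Rightarrow> 'b::real_normed_vector"
  assumes A: "smooth_atlas (std_atlas :: ('a, 'a) atlas)" and f: "smooth_on UNIV f"
  shows "smooth_map std_atlas std_atlas f"
  by (rule smooth_mapI[OF A]) (use f in \<open>auto simp: std_atlas_def smooth_on_imp_continuous intro!: exI[of _ UNIV]\<close>)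

text \<open>Fixing one variable amounts to composing the coordinate expression with an affine inclusion.\<close>

lemma smooth_map_section:
  fixes A :: "('m::topological_space, 'e::real_inner) atlas" and B :: "('k::topological_space, 'f::real_inner) atlas"
  assumes A: "smooth_atlas A" and B: "smooth_atlas B" and C: "smooth_atlas C"
    and f: "smooth_map (prod_atlas A B) C (\<lambda>(a, b). f a b)"
  shows "smooth_map A C (\<lambda>a. f a b)" and "smooth_map B C (\<lambda>b. f a b)"
proof -
  obtain E :: "'e set" where E: "frame E" by (rule model_frame_exists[OF A])
  obtain E' :: "'f set" where E': "frame E'" by (rule model_frame_exists[OF B])
  have cont: "continuous_on UNIV (\<lambda>(a, b). f a b)" using f by (simp add: smooth_map_def)
  show "smooth_map A C (\<lambda>a. f a b)"
  proof (rule smooth_mapI[OF A])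
    show "continuous_on UNIV (\<lambda>a. f a b)"
      using continuous_on_compose2[OF cont, of UNIV "\<lambda>a. (a, b)"] by (simp add: continuous_on_Pair)
    fix c k x assume c: "c \<in> A" and k: "k \<in> C" and x: "x \<in> snd c ` fst c" "f (chart_inv c x) b \<in> fst k"
    note d = chart_at[OF B, of b]
    show "\<exists>U. open U \<and> x \<in> U \<and> smooth_on U (\<lambda>x. snd k (f (chart_inv c x) b))"
      using x d open_section(1)[OF smooth_map_prod_in_charts(1)[OF A B C f c d(1) k], of "snd (chart_at B b) b"]
        smooth_on_section(1)[OF E E' smooth_map_prod_in_charts[OF A B C f c d(1) k], of "snd (chart_at B b) b"]
      by (intro exI conjI) (assumption | simp add: chart_inv_chart[OF B d(1)])+
  qed
  show "smooth_map B C (\<lambda>b. f a b)"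
  proof (rule smooth_mapI[OF B])
    show "continuous_on UNIV (\<lambda>b. f a b)"
      using continuous_on_compose2[OF cont, of UNIV "\<lambda>b. (a, b)"] by (simp add: continuous_on_Pair)
    fix d k y assume d: "d \<in> B" and k: "k \<in> C" and y: "y \<in> snd d ` fst d" "f a (chart_inv d y) \<in> fst k"
    note c = chart_at[OF A, of a]
    show "\<exists>U. open U \<and> y \<in> U \<and> smooth_on U (\<lambda>y. snd k (f a (chart_inv d y)))"
      using y c open_section(2)[OF smooth_map_prod_in_charts(1)[OF A B C f c(1) d k], of "snd (chart_at A a) a"]
        smooth_on_section(2)[OF E E' smooth_map_prod_in_charts[OF A B C f c(1) d k], of "snd (chart_at A a) a"]
      by (intro exI conjI) (assumption | simp add: chart_inv_chart[OF A c(1)])+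
  qed
qed

text \<open>Changing from the preferred chart at \<open>f p\<close> to another chart \<open>d\<close> replaces the tangent map by a plain
derivative of the coordinate expression, which depends smoothly on parameters in \<open>f\<close>. This is how
smoothness of vector fields defined by tangent maps is seen.\<close>

lemma tangent_map_in_target_chart:
  assumes A: "smooth_atlas A" and B: "smooth_atlas B" and f: "has_tangent_map A B f p L"
    and d: "d \<in> B" "f p \<in> fst d"
  shows "tangent_map B std_atlas (snd d) (f p) (L v)
     = D (\<lambda>x. snd d (f (chart_inv (chart_at A p) x))) (snd (chart_at A p) p) v"
proof -
  have "has_tangent_map A std_atlas (\<lambda>x. snd d (f x)) p (\<lambda>v. tangent_map B std_atlas (snd d) (f p) (L v))"
    by (rule has_tangent_map_compose[OF A B f has_tangent_map_chart[OF B d]])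
  then have "((\<lambda>x. snd d (f (chart_inv (chart_at A p) x))) has_derivative
      (\<lambda>v. tangent_map B std_atlas (snd d) (f p) (L v))) (at (snd (chart_at A p) p))"
    by (simp add: has_tangent_map_def)
  from D_eqI[OF this] show ?thesis by simp
qed

section \<open>One-parameter subgroups of a Lie group\<close>

text \<open>Put \<open>\<gamma> t = c (t / N)\<^sup>N\<close> for any \<open>N\<close> large enough. Passing to the common refinement \<open>t / (M N)\<close> shows that the
value does not depend on \<open>N\<close>, and for a common \<open>N\<close> the factors \<open>c (s / N)\<close> and \<open>c (t / N)\<close> commute.\<close>

lemma (in group) local_homomorphism_extends:
  fixes c :: "real \<Rightarrow> 'a" and \<epsilon> :: real
  assumes "\<epsilon> > 0" and in_carrier: "\<And>t. c t \<in> carrier G"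
    and hom: "\<And>s t. \<bar>s\<bar> < \<epsilon> \<Longrightarrow> \<bar>t\<bar> < \<epsilon> \<Longrightarrow> \<bar>s + t\<bar> < \<epsilon> \<Longrightarrow> c (s + t) = c s \<otimes> c t"
  shows "\<exists>\<gamma>. (\<forall>s t. \<gamma> (s + t) = \<gamma> s \<otimes> \<gamma> t) \<and> (\<forall>t. \<bar>t\<bar> < \<epsilon> \<longrightarrow> \<gamma> t = c t)"
proof -
  have c0: "c 0 = \<one>"
    using hom[of 0 0] \<open>\<epsilon> > 0\<close> in_carrier[of 0] l_cancel_one'[of "c 0" "c 0"] by simp
  have pow: "c (real k * s) = c s [^] k" if "\<bar>real k * s\<bar> < \<epsilon>" "\<bar>s\<bar> < \<epsilon>" for k s
    using that
  proof (induction k)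
    case 0
    then show ?case by (simp add: c0)
  next
    case (Suc k)
    have "\<bar>real k * s\<bar> \<le> \<bar>real (Suc k) * s\<bar>" by (simp add: abs_mult mult_right_mono)
    then have k: "\<bar>real k * s\<bar> < \<epsilon>" using Suc.prems by simp
    have "c (real (Suc k) * s) = c (real k * s + s)" by (simp add: algebra_simps)
    also have "\<dots> = c (real k * s) \<otimes> c s"
      using Suc.prems k by (intro hom) (simp_all add: algebra_simps)
    finally show ?case using Suc.IH[OF k Suc.prems(2)] by simp
  qed
  have indep: "c (t / real M) [^] M = c (t / real N) [^] N"
    if "M > 0" "N > 0" "\<bar>t / real M\<bar> < \<epsilon>" "\<bar>t / real N\<bar> < \<epsilon>" for t and M N :: nat
  proof -
    have le: "\<bar>t / real (M * N)\<bar> \<le> \<bar>t / real M\<bar>"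
    proof -
      have "1 \<le> real N" using that by simp
      then have "real M * 1 \<le> real M * real N" by (intro mult_left_mono) auto
      then show ?thesis using that by (simp add: frac_le)
    qed
    have 1: "c (t / real M) = c (t / real (M * N)) [^] N"
      using pow[of N "t / real (M * N)"] that le by simp
    have 2: "c (t / real N) = c (t / real (M * N)) [^] M"
      using pow[of M "t / real (M * N)"] that le by simp
    show ?thesis unfolding 1 2 by (simp add: nat_pow_pow in_carrier mult.commute)
  qed
  \<comment> \<open>The exponent is positive and strictly larger than \<open>\<bar>t\<bar> / \<epsilon>\<close>.\<close>
  define \<gamma> where "\<gamma> = (\<lambda>t. c (t / real (Suc (nat \<lceil>\<bar>t\<bar> / \<epsilon>\<rceil>))) [^] Suc (nat \<lceil>\<bar>t\<bar> / \<epsilon>\<rceil>))"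
  have big: "\<bar>t / real N\<bar> < \<epsilon>" if "\<bar>t\<bar> / \<epsilon> < real N" "N > 0" for t N
    using that \<open>\<epsilon> > 0\<close> by (simp add: field_simps)
  have big': "\<bar>t\<bar> / \<epsilon> < real (Suc (nat \<lceil>\<bar>t\<bar> / \<epsilon>\<rceil>))" for t
    using real_nat_ceiling_ge[of "\<bar>t\<bar> / \<epsilon>"] by linarith
  have \<gamma>: "\<gamma> t = c (t / real N) [^] N" if "N > 0" "\<bar>t / real N\<bar> < \<epsilon>" for t N
    unfolding \<gamma>_def by (rule indep[OF _ that(1) big[OF big'] that(2)]) simp_all
  show ?thesis
  proof (intro exI[of _ \<gamma>] conjI allI impI)
    show "\<gamma> t = c t" if "\<bar>t\<bar> < \<epsilon>" for t using \<gamma>[of 1 t] that in_carrier by simp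
    show "\<gamma> (s + t) = \<gamma> s \<otimes> \<gamma> t" for s t
    proof -
      define N where "N = Suc (nat \<lceil>(\<bar>s\<bar> + \<bar>t\<bar>) / \<epsilon>\<rceil>)"
      have N: "(\<bar>s\<bar> + \<bar>t\<bar>) / \<epsilon> < real N" "N > 0"
        using big'[of "\<bar>s\<bar> + \<bar>t\<bar>"] by (simp_all add: N_def)
      have le: "\<bar>u\<bar> / \<epsilon> < real N" if "\<bar>u\<bar> \<le> \<bar>s\<bar> + \<bar>t\<bar>" for u
        using N(1) divide_right_mono[OF that, of \<epsilon>] \<open>\<epsilon> > 0\<close> by linarith
      have small: "\<bar>s / real N\<bar> < \<epsilon>" "\<bar>t / real N\<bar> < \<epsilon>" "\<bar>(s + t) / real N\<bar> < \<epsilon>"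
        by (rule big[OF le N(2)]; simp)+
      have sum: "s / real N + t / real N = (s + t) / real N" by (simp add: add_divide_distrib)
      have "c ((s + t) / real N) = c (s / real N) \<otimes> c (t / real N)"
        using hom[of "s / real N" "t / real N"] small sum by simp
      moreover have "c ((s + t) / real N) = c (t / real N) \<otimes> c (s / real N)"
        using hom[of "t / real N" "s / real N"] small sum by (simp add: add.commute)
      ultimately show ?thesis
        using pow_mult_distrib[of "c (s / real N)" "c (t / real N)" N] in_carrier
        by (simp add: \<gamma>[OF N(2) small(1)] \<gamma>[OF N(2) small(2)] \<gamma>[OF N(2) small(3)])
    qed
  qed
qed

locale lie_grp =
  fixes G :: "'g::topological_space monoid" (structure) and B :: "('g, 'h::{real_inner, banach}) atlas"
  assumes lie: "lie_group G B"
begin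

lemma group_G: "group G" and carrier_UNIV [simp]: "carrier G = UNIV"
  and atlas_B: "smooth_atlas B"
  and mult_smooth: "smooth_map (prod_atlas B B) B (\<lambda>(g, h). g \<otimes> h)"
  and inv_smooth: "smooth_map B B (\<lambda>g. inv g)"
  using lie by (simp_all add: lie_group_def)

sublocale group G by (rule group_G)

lemma mult_eqs [simp]: "\<one> \<otimes> g = g" "g \<otimes> \<one> = g" "inv g \<otimes> g = \<one>" "g \<otimes> inv g = \<one>" "inv g \<otimes> (g \<otimes> h) = h"
  "g \<otimes> (inv g \<otimes> h) = h" "inv (inv g) = g" "g \<otimes> h \<otimes> k = g \<otimes> (h \<otimes> k)"
  by (simp_all add: m_assoc flip: m_assoc[of "inv g" g h] m_assoc[of g "inv g" h])

lemma left_mult_tangent: "has_tangent_map B B (\<lambda>h. g \<otimes> h) h (tangent_map B B (\<lambda>h. g \<otimes> h) h)"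
  using has_tangent_map_combine_right[OF atlas_B atlas_B atlas_B mult_smooth] .

lemma right_mult_tangent: "has_tangent_map B B (\<lambda>h. h \<otimes> g) h (tangent_map B B (\<lambda>h. h \<otimes> g) h)"
  using has_tangent_map_combine_left[OF atlas_B atlas_B atlas_B mult_smooth] .

lemma inv_tangent: "has_tangent_map B B (\<lambda>h. inv h) h (tangent_map B B (\<lambda>h. inv h) h)"
  by (rule smooth_map_has_tangent_map[OF atlas_B atlas_B inv_smooth])

lemma left_inv_field_one [simp]: "left_inv_field G B X \<one> = X"
  using tangent_map_eqI[OF has_tangent_map_ident[OF atlas_B]] by (simp add: left_inv_field_def)

lemma left_inv_field_translate:
  "tangent_map B B (\<lambda>h. k \<otimes> h) g (left_inv_field G B X g) = left_inv_field G B X (k \<otimes> g)"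
proof -
  have "has_tangent_map B B (\<lambda>h. k \<otimes> (g \<otimes> h)) \<one>
      (\<lambda>v. tangent_map B B (\<lambda>h. k \<otimes> h) g (tangent_map B B (\<lambda>h. g \<otimes> h) \<one> v))"
    by (rule has_tangent_map_compose[OF atlas_B atlas_B left_mult_tangent]) (simp add: left_mult_tangent)
  from tangent_map_eqI[OF this] show ?thesis by (simp add: left_inv_field_def)
qed

text \<open>Both sections of the multiplication through the identity are identity maps, so its derivative there
is addition.\<close>

lemma mult_tangent_at_one:
  assumes A: "smooth_atlas A" and u: "has_tangent_map A B u p Lu" "u p = \<one>"
    and v: "has_tangent_map A B v p Lv" "v p = \<one>"
  shows "has_tangent_map A B (\<lambda>x. u x \<otimes> v x) p (\<lambda>w. Lu w + Lv w)"
  using has_tangent_map_combine[OF A atlas_B atlas_B atlas_B mult_smooth u(1) v(1)]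
    tangent_map_eqI[OF has_tangent_map_ident[OF atlas_B, of \<one>]]
  by (simp add: u(2) v(2))

text \<open>Differentiate \<open>g g\<^sup>-\<^sup>1 = \<one>\<close>.\<close>

lemma tangent_map_inv_one: "tangent_map B B (\<lambda>h. inv h) \<one> v = - v"
proof -
  have "has_tangent_map B B (\<lambda>g. g \<otimes> inv g) \<one> (\<lambda>w. w + tangent_map B B (\<lambda>h. inv h) \<one> w)"
    by (rule mult_tangent_at_one[OF atlas_B has_tangent_map_ident[OF atlas_B] _ inv_tangent]) simp_all
  then have "has_tangent_map B B (\<lambda>g. \<one>) \<one> (\<lambda>w. w + tangent_map B B (\<lambda>h. inv h) \<one> w)" by simp
  from tangent_map_eqI[OF this] tangent_map_eqI[OF has_tangent_map_const[of B B "\<one>" "\<one>"]]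
  have "(\<lambda>w. w + tangent_map B B (\<lambda>h. inv h) \<one> w) = (\<lambda>w. 0)" by simp
  from fun_cong[OF this, of v] show ?thesis by (simp add: eq_neg_iff_add_eq_0 add.commute)
qed

definition integral_curve :: "'h \<Rightarrow> (real \<Rightarrow> 'g) \<Rightarrow> real \<Rightarrow> bool" where
  "integral_curve X c t \<longleftrightarrow> has_tangent_map std_atlas B c t (\<lambda>s. s *\<^sub>R left_inv_field G B X (c t))"

lemma integral_curve_translate:
  assumes "integral_curve X c t"
  shows "integral_curve X (\<lambda>s. g \<otimes> c s) t"
proof -
  have "has_tangent_map std_atlas B (\<lambda>s. g \<otimes> c s) t
      (\<lambda>s. tangent_map B B (\<lambda>h. g \<otimes> h) (c t) (s *\<^sub>R left_inv_field G B X (c t)))"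
    using assms unfolding integral_curve_def
    by (rule has_tangent_map_compose[OF smooth_atlas_std_real atlas_B _ left_mult_tangent])
  then show ?thesis
    by (simp add: integral_curve_def linear_scale[OF has_tangent_map_linear[OF left_mult_tangent]] left_inv_field_translate)
qed

lemma integral_curve_shift:
  assumes "integral_curve X c (s + t)"
  shows "integral_curve X (\<lambda>t. c (s + t)) t"
proof -
  have "has_tangent_map std_atlas std_atlas (\<lambda>t. s + t) t (\<lambda>h. h)"
    unfolding has_tangent_map_std_iff by (auto intro!: derivative_eq_intros)
  from has_tangent_map_compose[OF smooth_atlas_std_real smooth_atlas_std_real this assms[unfolded integral_curve_def]]
  show ?thesis by (simp add: integral_curve_def)
qed

text \<open>Write \<open>c s = c(t) u(s)\<close> and \<open>d s = d(t) v(s)\<close>, where \<open>u\<close> and \<open>v\<close> pass through the identity with velocity \<open>X\<close>. Then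
\<open>c d\<^sup>-\<^sup>1 = c(t) (u v\<^sup>-\<^sup>1) d(t)\<^sup>-\<^sup>1\<close>, and \<open>u v\<^sup>-\<^sup>1\<close> has velocity \<open>X - X = 0\<close>. This replaces a uniqueness theorem for
differential equations.\<close>

lemma quotient_of_integral_curves:
  assumes c: "integral_curve X c t" and d: "integral_curve X d t"
  shows "has_tangent_map std_atlas B (\<lambda>s. c s \<otimes> inv (d s)) t (\<lambda>s. 0)"
proof -
  note std = smooth_atlas_std_real
  have u: "has_tangent_map std_atlas B (\<lambda>s. inv (c t) \<otimes> c s) t (\<lambda>s. s *\<^sub>R X)"
    using integral_curve_translate[OF c, of "inv (c t)"] by (simp add: integral_curve_def)
  have "has_tangent_map std_atlas B (\<lambda>s. inv (d t) \<otimes> d s) t (\<lambda>s. s *\<^sub>R X)"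
    using integral_curve_translate[OF d, of "inv (d t)"] by (simp add: integral_curve_def)
  from has_tangent_map_compose[OF std atlas_B this inv_tangent]
  have v: "has_tangent_map std_atlas B (\<lambda>s. inv (inv (d t) \<otimes> d s)) t (\<lambda>s. - (s *\<^sub>R X))"
    by (simp add: tangent_map_inv_one)
  have "has_tangent_map std_atlas B (\<lambda>s. (inv (c t) \<otimes> c s) \<otimes> inv (inv (d t) \<otimes> d s)) t (\<lambda>s. s *\<^sub>R X + - (s *\<^sub>R X))"
    by (rule mult_tangent_at_one[OF std u _ v]) simp_all
  then have "has_tangent_map std_atlas B (\<lambda>s. (inv (c t) \<otimes> c s) \<otimes> inv (inv (d t) \<otimes> d s)) t (\<lambda>s. 0)" by simp
  from has_tangent_map_compose[OF std atlas_B has_tangent_map_compose[OF std atlas_B this left_mult_tangent[of "c t"]]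
      right_mult_tangent[of "inv (d t)"]]
  show ?thesis
    by (simp add: inv_mult_group linear_0[OF has_tangent_map_linear[OF left_mult_tangent]]
        linear_0[OF has_tangent_map_linear[OF right_mult_tangent]] del: mult_eqs(7) cong: if_cong)
qed

lemma integral_curves_quotient_constant:
  assumes "open I" "connected I" and "\<And>t. t \<in> I \<Longrightarrow> integral_curve X c t" "\<And>t. t \<in> I \<Longrightarrow> integral_curve X d t"
    and "s \<in> I" "t \<in> I"
  shows "c s \<otimes> inv (d s) = c t \<otimes> inv (d t)"
  using quotient_of_integral_curves assms
  by (intro constant_if_tangent_map_zero[OF atlas_B assms(1,2), of "\<lambda>s. c s \<otimes> inv (d s)"]) blast+

lemma one_param_subgroup_zero: "one_param_subgroup G B \<gamma> \<Longrightarrow> \<gamma> 0 = \<one>"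
  unfolding one_param_subgroup_def by (metis add_0 carrier_UNIV UNIV_I l_cancel_one')

lemma one_param_subgroup_integral_curve:
  assumes "one_param_subgroup G B \<gamma>"
  shows "integral_curve (velocity B \<gamma> 0) \<gamma> t"
proof -
  have hom: "\<gamma> (s + t) = \<gamma> s \<otimes> \<gamma> t" for s t using assms by (simp add: one_param_subgroup_def)
  have sm: "smooth_map std_atlas B \<gamma>" using assms by (simp add: one_param_subgroup_def)
  have tm: "has_tangent_map std_atlas B \<gamma> 0 (tangent_map std_atlas B \<gamma> 0)"
    by (rule smooth_map_has_tangent_map[OF smooth_atlas_std_real atlas_B sm])
  have "tangent_map std_atlas B \<gamma> 0 s = s *\<^sub>R velocity B \<gamma> 0" for s
    using linear_scale[OF has_tangent_map_linear[OF tm], of s 1] by (simp add: velocity_def)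
  then have "tangent_map std_atlas B \<gamma> 0 = (\<lambda>s. s *\<^sub>R velocity B \<gamma> 0)" by blast
  then have "integral_curve (velocity B \<gamma> 0) \<gamma> 0"
    using tm one_param_subgroup_zero[OF assms] by (simp add: integral_curve_def)
  then have "integral_curve (velocity B \<gamma> 0) (\<lambda>s. \<gamma> (- t + s)) t"
    by (intro integral_curve_shift) simp
  from integral_curve_translate[OF this, of "\<gamma> t"]
  show ?thesis by (simp flip: hom)
qed

lemma one_param_subgroup_unique:
  assumes "one_param_subgroup G B \<gamma>" "one_param_subgroup G B \<delta>" "velocity B \<gamma> 0 = velocity B \<delta> 0"
  shows "\<gamma> = \<delta>"
proof
  fix t
  have "\<gamma> t \<otimes> inv (\<delta> t) = \<gamma> 0 \<otimes> inv (\<delta> 0)"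
    using one_param_subgroup_integral_curve[OF assms(1)] one_param_subgroup_integral_curve[OF assms(2)] assms(3)
    by (intro integral_curves_quotient_constant[of UNIV]) auto
  then have "\<gamma> t \<otimes> inv (\<delta> t) = \<one>"
    using one_param_subgroup_zero[OF assms(1)] one_param_subgroup_zero[OF assms(2)] by simp
  then have "\<gamma> t \<otimes> inv (\<delta> t) \<otimes> \<delta> t = \<one> \<otimes> \<delta> t" by (simp only:)
  then show "\<gamma> t = \<delta> t" by simp
qed

text \<open>In coordinates the field is the partial derivative of the multiplication in the second variable, at
the identity and in direction \<open>X\<close>; it depends smoothly on the first variable.\<close>

lemma smooth_left_inv_field:
  assumes c: "c \<in> B"
  shows "smooth_on (snd c ` fst c) (local_field B c (left_inv_field G B X))"
proof -
  obtain E :: "'h set" where E: "frame E" by (rule model_frame_exists[OF atlas_B])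
  let ?c1 = "chart_at B \<one>" and ?e = "snd (chart_at B \<one>) \<one>"
  note c1 = chart_at[OF atlas_B, of \<one>]
  have inv1: "chart_inv ?c1 ?e = \<one>" using c1 by (simp add: chart_inv_chart[OF atlas_B c1(1)])
  let ?F = "\<lambda>z. snd c (chart_inv c (fst z) \<otimes> chart_inv ?c1 (snd z))"
  let ?\<Omega> = "{z. fst z \<in> snd c ` fst c \<and> snd z \<in> snd ?c1 ` fst ?c1 \<and> chart_inv c (fst z) \<otimes> chart_inv ?c1 (snd z) \<in> fst c}"
  note F = smooth_map_prod_in_charts[OF atlas_B atlas_B atlas_B mult_smooth c c1(1) c]
  have in_\<Omega>: "(x, ?e) \<in> ?\<Omega>" if "x \<in> snd c ` fst c" for x
    using that c1 by (simp add: inv1 chart_inv_in[OF atlas_B c])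
  have eq: "local_field B c (left_inv_field G B X) x = D ?F (x, ?e) (0, X)" if x: "x \<in> snd c ` fst c" for x
  proof -
    have "local_field B c (left_inv_field G B X) x = D (\<lambda>y. snd c (chart_inv c x \<otimes> chart_inv ?c1 y)) ?e X"
      using tangent_map_in_target_chart[OF atlas_B atlas_B left_mult_tangent c, of "chart_inv c x" \<one>]
      by (simp add: local_field_def left_inv_field_def chart_inv_in[OF atlas_B c x])
    also have "\<dots> = D ?F (x, ?e) (0, X)"
      using D_eqI[OF D_section(2)[OF smooth_on_imp_differentiable[OF F(2) in_\<Omega>[OF x]]]] by simp
    finally show ?thesis .
  qed
  have "smooth_on (snd c ` fst c) (\<lambda>x. D ?F (x, ?e) (0, X))"
    by (rule smooth_on_subset[OF smooth_on_section(1)[OF E E F(1) smooth_on_D_const[OF F(2)], of ?e]])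
       (use in_\<Omega> in blast)
  then show ?thesis
    by (rule smooth_on_cong[OF open_chart_range[OF atlas_B c], rotated]) (simp add: eq)
qed

text \<open>The coordinate expression \<open>x\<close> of the curve is part of the conclusion because its smoothness carries over
to the one-parameter subgroup.\<close>

lemma local_integral_curve_exists:
  "\<exists>\<epsilon>>0. \<exists>x :: real \<Rightarrow> 'h. smooth_on {- \<epsilon><..<\<epsilon>} x \<and> x 0 = snd (chart_at B \<one>) \<one> \<and>
     (\<forall>t\<in>{- \<epsilon><..<\<epsilon>}. x t \<in> snd (chart_at B \<one>) ` fst (chart_at B \<one>) \<and>
        integral_curve X (\<lambda>t. chart_inv (chart_at B \<one>) (x t)) t)"
proof -
  obtain E :: "'h set" where E: "frame E" by (rule model_frame_exists[OF atlas_B])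
  let ?c = "chart_at B \<one>" and ?V = "local_field B (chart_at B \<one>) (left_inv_field G B X)"
  let ?S = "snd ?c ` fst ?c"
  note c = chart_at[OF atlas_B, of \<one>]
  note S = open_chart_range[OF atlas_B c(1)]
  have V: "smooth_on ?S ?V" by (rule smooth_left_inv_field[OF c(1)])
  obtain r L where r: "r > 0" "L \<ge> 0" "cball (snd ?c \<one>) r \<subseteq> ?S"
    and lip: "\<And>x y. x \<in> cball (snd ?c \<one>) r \<Longrightarrow> y \<in> cball (snd ?c \<one>) r \<Longrightarrow> norm (?V x - ?V y) \<le> L * norm (x - y)"
    using smooth_on_locally_lipschitz[OF E S V imageI[OF c(2)]] by blast
  obtain \<epsilon> x where \<epsilon>: "\<epsilon> > 0" and x0: "x 0 = snd ?c \<one>"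
    and x: "\<And>t. - \<epsilon> < t \<Longrightarrow> t < \<epsilon> \<Longrightarrow> x t \<in> cball (snd ?c \<one>) r \<and> (x has_vector_derivative ?V (x t)) (at t)"
    using picard_local_existence[OF r(1,2) lip] by metis
  have xS: "x t \<in> ?S" if "t \<in> {- \<epsilon><..<\<epsilon>}" for t using x[of t] that r(3) by auto
  show ?thesis
  proof (intro exI[of _ \<epsilon>] exI[of _ x] conjI ballI \<epsilon> x0)
    show "smooth_on {- \<epsilon><..<\<epsilon>} x"
      by (rule ode_solution_smooth[OF E _ S V xS]) (use x in auto)
    show "x t \<in> ?S" if "t \<in> {- \<epsilon><..<\<epsilon>}" for t by (rule xS[OF that])
    fix t assume t: "t \<in> {- \<epsilon><..<\<epsilon>}"
    let ?g = "chart_inv ?c (x t)"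
    have "has_tangent_map std_atlas std_atlas x t (\<lambda>s. s *\<^sub>R ?V (x t))"
      using x[of t] t by (simp add: has_tangent_map_std_iff has_vector_derivative_def)
    from has_tangent_map_compose[OF smooth_atlas_std_real smooth_atlas_std_model[OF atlas_B] this
        has_tangent_map_chart_inv[OF atlas_B c(1) xS[OF t]]]
    have tm: "has_tangent_map std_atlas B (\<lambda>t. chart_inv ?c (x t)) t
        (\<lambda>s. tangent_map std_atlas B (chart_inv ?c) (x t) (s *\<^sub>R ?V (x t)))" .
    have "tangent_map std_atlas B (chart_inv ?c) (x t) (?V (x t)) = left_inv_field G B X ?g"
      using tangent_map_chart_inv_chart[OF atlas_B c(1) chart_inv_in[OF atlas_B c(1) xS[OF t]]]
      by (simp add: local_field_def chart_chart_inv[OF atlas_B c(1) xS[OF t]])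
    then show "integral_curve X (\<lambda>t. chart_inv ?c (x t)) t"
      using tm linear_scale[OF has_tangent_map_linear[OF has_tangent_map_chart_inv[OF atlas_B c(1) xS[OF t]]]]
      by (simp add: integral_curve_def)
  qed
qed

text \<open>For a fixed \<open>s\<close> the curves \<open>t \<mapsto> c (s + t)\<close> and \<open>c\<close> are integral curves, so their quotient is constant with value
\<open>c s\<close>: the local integral curve is a local homomorphism. Its extension \<open>\<gamma>\<close> satisfies
\<open>\<gamma> s = \<gamma> t c(s - t)\<close> for \<open>s\<close> near \<open>t\<close>, and this reduces smoothness of \<open>\<gamma>\<close> to smoothness of \<open>c\<close>.\<close>

lemma one_param_subgroup_exists:
  "\<exists>\<gamma>. one_param_subgroup G B \<gamma> \<and> velocity B \<gamma> 0 = X"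
proof -
  obtain E :: "'h set" where E: "frame E" by (rule model_frame_exists[OF atlas_B])
  let ?c1 = "chart_at B \<one>"
  note c1 = chart_at[OF atlas_B, of \<one>]
  obtain \<epsilon> x where \<epsilon>: "\<epsilon> > 0" and sx: "smooth_on {- \<epsilon><..<\<epsilon>} x" and x0: "x 0 = snd ?c1 \<one>"
    and xS: "\<And>t. t \<in> {- \<epsilon><..<\<epsilon>} \<Longrightarrow> x t \<in> snd ?c1 ` fst ?c1"
    and ic: "\<And>t. t \<in> {- \<epsilon><..<\<epsilon>} \<Longrightarrow> integral_curve X (\<lambda>t. chart_inv ?c1 (x t)) t"
    using local_integral_curve_exists[of X] by blast
  define c where "c = (\<lambda>t. chart_inv ?c1 (x t))"
  have c0: "c 0 = \<one>" using c1 by (simp add: c_def x0 chart_inv_chart[OF atlas_B c1(1)])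
  have hom: "c (s + t) = c s \<otimes> c t" if "\<bar>s\<bar> < \<epsilon>" "\<bar>t\<bar> < \<epsilon>" "\<bar>s + t\<bar> < \<epsilon>" for s t
  proof -
    \<comment> \<open>The parameters \<open>t\<close> for which both \<open>t\<close> and \<open>s + t\<close> are in the domain of \<open>c\<close>; zero is one of them.\<close>
    let ?I = "{- \<epsilon><..<\<epsilon>} \<inter> {- \<epsilon> - s<..<\<epsilon> - s}"
    have "c (s + t) \<otimes> inv (c t) = c (s + 0) \<otimes> inv (c 0)"
    proof (rule integral_curves_quotient_constant[of ?I X "\<lambda>t. c (s + t)" c])
      show "connected ?I" by (intro convex_connected convex_Int) auto
      show "integral_curve X (\<lambda>t. c (s + t)) t" if "t \<in> ?I" for t
        using that ic[of "s + t"] by (intro integral_curve_shift) (auto simp: c_def)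
    qed (use that ic in \<open>auto simp: c_def abs_if split: if_splits\<close>)
    then have "c (s + t) \<otimes> inv (c t) \<otimes> c t = c s \<otimes> c t" by (simp only: add_0_right c0) simp
    then show ?thesis by simp
  qed
  obtain \<gamma> where \<gamma>: "\<And>s t. \<gamma> (s + t) = \<gamma> s \<otimes> \<gamma> t" and \<gamma>c: "\<And>t. \<bar>t\<bar> < \<epsilon> \<Longrightarrow> \<gamma> t = c t"
    using local_homomorphism_extends[of \<epsilon> c, OF \<epsilon> _ hom] by (metis UNIV_I carrier_UNIV)
  have near: "\<gamma> s = \<gamma> t \<otimes> c (- t + s)" if "\<bar>s - t\<bar> < \<epsilon>" for s t
    using \<gamma>[of t "s - t"] \<gamma>c[OF that] by (simp add: add.commute)
  have int: "integral_curve X \<gamma> t" for t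
  proof -
    have "integral_curve X c (- t + t)" using ic[of 0] \<epsilon> by (simp add: c_def)
    from integral_curve_translate[OF integral_curve_shift[OF this], of "\<gamma> t"]
    have "integral_curve X (\<lambda>s. \<gamma> t \<otimes> c (- t + s)) t" .
    moreover have "\<forall>\<^sub>F s in nhds t. \<gamma> t \<otimes> c (- t + s) = \<gamma> s"
      using near \<epsilon> by (auto simp: eventually_nhds_metric dist_real_def intro!: exI[of _ \<epsilon>])
    moreover have "\<gamma> t \<otimes> c (- t + t) = \<gamma> t" by (simp add: c0)
    ultimately show ?thesis
      unfolding integral_curve_def using has_tangent_map_cong[OF smooth_atlas_std_real] by fastforce
  qed
  have "smooth_map std_atlas B \<gamma>"
  proof (rule smooth_mapI[OF smooth_atlas_std_real])
    show "continuous_on UNIV \<gamma>"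
      using has_tangent_map_filterlim[OF int[unfolded integral_curve_def]]
      by (simp add: continuous_on_def tendsto_at_iff_tendsto_nhds)
    fix c' d and t :: real assume "c' \<in> (std_atlas :: (real, real) atlas)" and d: "d \<in> B" and "\<gamma> (chart_inv c' t) \<in> fst d"
    then have c': "c' = (UNIV, id)" and t: "\<gamma> t \<in> fst d" by (auto simp: std_atlas_def)
    have "smooth_map B B (\<lambda>h. \<gamma> t \<otimes> h)"
      by (rule smooth_map_section(2)[OF atlas_B atlas_B atlas_B mult_smooth])
    note F = smooth_map_in_charts[OF atlas_B atlas_B this c1(1) d]
    let ?W = "{y \<in> snd ?c1 ` fst ?c1. \<gamma> t \<otimes> chart_inv ?c1 y \<in> fst d}"
    \<comment> \<open>Near \<open>t\<close> the curve is the left translate by \<open>\<gamma> t\<close> of the local curve, with coordinates \<open>y\<close>.\<close>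
    let ?J = "{t - \<epsilon><..<t + \<epsilon>}"
    define y where "y = (\<lambda>s. x (s - t))"
    have sy: "smooth_on ?J y"
      unfolding y_def
      by (rule smooth_on_compose[OF frame_Basis _ _ _ sx])
         (auto intro!: smooth_on_add[of _ "\<lambda>s. s" "\<lambda>s. - t", simplified] smooth_on_ident smooth_on_const)
    define U where "U = ?J \<inter> y -` ?W"
    have U: "open U"
      unfolding U_def by (rule continuous_open_preimage[OF smooth_on_imp_continuous[OF sy] _ F(1)]) simp
    have "t \<in> U"
      using t xS[of 0] \<epsilon> c0 by (simp add: U_def y_def c_def)
    moreover have "smooth_on U (\<lambda>s. snd d (\<gamma> t \<otimes> chart_inv ?c1 (y s)))"
      by (rule smooth_on_compose[OF E U F(1) _ F(2)]) (auto simp: U_def intro: smooth_on_subset[OF sy])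
    then have "smooth_on U (\<lambda>s. snd d (\<gamma> s))"
    proof (rule smooth_on_cong[OF U, rotated])
      fix s assume "s \<in> U"
      then have "\<bar>s - t\<bar> < \<epsilon>" by (auto simp: U_def)
      from near[OF this] show "snd d (\<gamma> t \<otimes> chart_inv ?c1 (y s)) = snd d (\<gamma> s)"
        by (simp add: c_def y_def add.commute)
    qed
    ultimately show "\<exists>U. open U \<and> t \<in> U \<and> smooth_on U (\<lambda>s. snd d (\<gamma> (chart_inv c' s)))"
      using U by (auto simp: c')
  qed
  then have "one_param_subgroup G B \<gamma>" using \<gamma> by (simp add: one_param_subgroup_def)
  moreover have "velocity B \<gamma> 0 = X"
  proof -
    have "\<gamma> 0 = \<one>" using \<gamma>c[of 0] \<epsilon> c0 by simp
    then show ?thesis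
      using tangent_map_eqI[OF int[of 0, unfolded integral_curve_def]] by (simp add: velocity_def)
  qed
  ultimately show ?thesis by blast
qed

definition exp_curve :: "'h \<Rightarrow> real \<Rightarrow> 'g" where
  "exp_curve X = (THE \<gamma>. one_param_subgroup G B \<gamma> \<and> velocity B \<gamma> 0 = X)"

lemma exp_curve: "one_param_subgroup G B (exp_curve X)" "velocity B (exp_curve X) 0 = X"
proof -
  have "\<exists>!\<gamma>. one_param_subgroup G B \<gamma> \<and> velocity B \<gamma> 0 = X"
    using one_param_subgroup_exists one_param_subgroup_unique by metis
  from theI'[OF this] show "one_param_subgroup G B (exp_curve X)" "velocity B (exp_curve X) 0 = X"
    by (simp_all add: exp_curve_def)
qed

text \<open>Reparametrising the one-parameter subgroup of \<open>X\<close> by the factor \<open>t\<close> gives the one of \<open>t X\<close>.\<close>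

lemma lie_exp_scale: "lie_exp G B (t *\<^sub>R X) = exp_curve X t"
proof -
  let ?\<gamma> = "\<lambda>s. exp_curve X (t * s)"
  have sm: "smooth_map std_atlas B (exp_curve X)" and hom: "exp_curve X (s + s') = exp_curve X s \<otimes> exp_curve X s'" for s s'
    using exp_curve(1)[of X] by (simp_all add: one_param_subgroup_def)
  have "smooth_map std_atlas B ?\<gamma>"
    by (rule smooth_map_compose[OF smooth_atlas_std_real smooth_atlas_std_real atlas_B _ sm])
       (intro smooth_map_stdI smooth_atlas_std_real smooth_on_bounded_linear_comp[OF bounded_linear_mult_right] open_UNIV smooth_on_ident)
  then have op: "one_param_subgroup G B ?\<gamma>" using hom by (simp add: one_param_subgroup_def distrib_left)
  have "has_tangent_map std_atlas std_atlas (\<lambda>s. t * s) 0 (\<lambda>s. t * s)"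
    unfolding has_tangent_map_std_iff by (auto intro!: derivative_eq_intros)
  from has_tangent_map_compose[OF smooth_atlas_std_real smooth_atlas_std_real this, of B "exp_curve X"]
    one_param_subgroup_integral_curve[OF exp_curve(1), of X 0]
  have "has_tangent_map std_atlas B ?\<gamma> 0 (\<lambda>s. (t * s) *\<^sub>R X)"
    using one_param_subgroup_zero[OF exp_curve(1)[of X]] by (simp add: integral_curve_def exp_curve(2))
  then have "velocity B ?\<gamma> 0 = t *\<^sub>R X" by (simp add: velocity_def tangent_map_eqI)
  then have "exp_curve (t *\<^sub>R X) = ?\<gamma>"
    using one_param_subgroup_unique[OF exp_curve(1) op] exp_curve(2) by simp
  then show ?thesis by (simp add: lie_exp_def flip: exp_curve_def)
qed

lemma lie_exp_tangent: "has_tangent_map std_atlas B (\<lambda>t. lie_exp G B (- (t *\<^sub>R X))) 0 (\<lambda>s. s *\<^sub>R (- X))"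
proof -
  have "lie_exp G B (- (t *\<^sub>R X)) = exp_curve (- X) t" for t using lie_exp_scale[of t "- X"] by simp
  then show ?thesis
    using one_param_subgroup_integral_curve[OF exp_curve(1), of "- X" 0]
      one_param_subgroup_zero[OF exp_curve(1)[of "- X"]] by (simp add: integral_curve_def exp_curve(2))
qed

lemma lie_exp_zero: "lie_exp G B 0 = \<one>"
  using lie_exp_scale[of 0 0] one_param_subgroup_zero[OF exp_curve(1)[of 0]] by simp

end

section \<open>Vector fields and forms in charts\<close>

text \<open>The Leibniz rule for the pairing of a varying linear map with a varying vector. The linear maps are
only known through their values on fixed vectors, so both are expanded along the frame.\<close>

lemma has_derivative_linear_eval:
  fixes \<Theta> :: "'a::real_normed_vector \<Rightarrow> 'b::real_inner \<Rightarrow> 'c::real_normed_vector"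
  assumes C: "frame (C :: 'b set)" and S: "open S" "x \<in> S" and lin: "\<And>y. y \<in> S \<Longrightarrow> linear (\<Theta> y)"
    and \<Theta>: "\<And>b. (\<lambda>y. \<Theta> y b) differentiable at x" and W: "(W has_derivative W') (at x)"
  shows "((\<lambda>y. \<Theta> y (W y)) has_derivative (\<lambda>v. D (\<lambda>y. \<Theta> y (W x)) x v + \<Theta> x (W' v))) (at x)"
proof -
  have expand: "\<Theta> y w = (\<Sum>b\<in>C. (w \<bullet> b) *\<^sub>R \<Theta> y b)" if "y \<in> S" for y w
    using frame_linear[OF C lin[OF that]] by simp
  have "((\<lambda>y. \<Sum>b\<in>C. (W y \<bullet> b) *\<^sub>R \<Theta> y b) has_derivative
      (\<lambda>v. \<Sum>b\<in>C. (W x \<bullet> b) *\<^sub>R D (\<lambda>y. \<Theta> y b) x v + (W' v \<bullet> b) *\<^sub>R \<Theta> x b)) (at x)"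
    by (intro has_derivative_sum has_derivative_scaleR has_derivative_D[OF \<Theta>]
        bounded_linear.has_derivative[OF bounded_linear_inner_left W])
  from has_derivative_transform_within_open[OF this S]
  have 1: "((\<lambda>y. \<Theta> y (W y)) has_derivative
      (\<lambda>v. \<Sum>b\<in>C. (W x \<bullet> b) *\<^sub>R D (\<lambda>y. \<Theta> y b) x v + (W' v \<bullet> b) *\<^sub>R \<Theta> x b)) (at x)"
    using expand by simp
  have "((\<lambda>y. \<Sum>b\<in>C. (W x \<bullet> b) *\<^sub>R \<Theta> y b) has_derivative (\<lambda>v. \<Sum>b\<in>C. (W x \<bullet> b) *\<^sub>R D (\<lambda>y. \<Theta> y b) x v)) (at x)"
    by (intro has_derivative_sum has_derivative_scaleR_right has_derivative_D[OF \<Theta>])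
  from has_derivative_transform_within_open[OF this S]
  have "((\<lambda>y. \<Theta> y (W x)) has_derivative (\<lambda>v. \<Sum>b\<in>C. (W x \<bullet> b) *\<^sub>R D (\<lambda>y. \<Theta> y b) x v)) (at x)"
    using expand by simp
  from D_eqI[OF this] have "D (\<lambda>y. \<Theta> y (W x)) x v = (\<Sum>b\<in>C. (W x \<bullet> b) *\<^sub>R D (\<lambda>y. \<Theta> y b) x v)" for v
    by simp
  with 1 show ?thesis by (simp add: sum.distrib flip: expand[OF S(2)])
qed

text \<open>Differentiate \<open>D f y (V y) = W (f y)\<close>. In the difference of the two resulting equations the second derivative
of \<open>f\<close> cancels by symmetry.\<close>

lemma related_fields_bracket:
  fixes f :: "'a::real_inner \<Rightarrow> 'b::real_inner"
  assumes C: "frame (C :: 'a set)" and S: "open S" "x \<in> S" and f: "smooth_on S f"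
    and V: "V1 differentiable at x" "V2 differentiable at x"
    and W: "W1 differentiable at (f x)" "W2 differentiable at (f x)"
    and rel: "\<And>y. y \<in> S \<Longrightarrow> D f y (V1 y) = W1 (f y)" "\<And>y. y \<in> S \<Longrightarrow> D f y (V2 y) = W2 (f y)"
  shows "D f x (D V2 x (V1 x) - D V1 x (V2 x)) = D W2 (f x) (W1 (f x)) - D W1 (f x) (W2 (f x))"
proof -
  have lin: "linear (D f y)" if "y \<in> S" for y using smooth_on_imp_differentiable[OF f that] by (rule linear_D)
  have *: "D (\<lambda>y. D f y (V x)) x u + D f x (D V x u) = D W (f x) (D f x u)"
    if "V differentiable at x" "W differentiable at (f x)" "\<And>y. y \<in> S \<Longrightarrow> D f y (V y) = W (f y)" for V W u
  proof -
    have 1: "((\<lambda>y. D f y (V y)) has_derivative (\<lambda>v. D (\<lambda>y. D f y (V x)) x v + D f x (D V x v))) (at x)"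
      by (rule has_derivative_linear_eval[OF C S lin smooth_on_imp_differentiable[OF smooth_on_D_const[OF f] S(2)]
            has_derivative_D[OF that(1)]])
    have "((\<lambda>y. W (f y)) has_derivative (\<lambda>u. D W (f x) (D f x u))) (at x)"
      using has_derivative_compose[OF smooth_on_has_derivative[OF f S(2)] has_derivative_D[OF that(2)]] .
    then have "((\<lambda>y. D f y (V y)) has_derivative (\<lambda>u. D W (f x) (D f x u))) (at x)"
      by (rule has_derivative_transform_within_open[OF _ S]) (simp add: that(3))
    from fun_cong[OF has_derivative_unique[OF 1 this]] show ?thesis .
  qed
  have 1: "D (\<lambda>y. D f y (V2 x)) x (V1 x) + D f x (D V2 x (V1 x)) = D W2 (f x) (W1 (f x))"
    using *[OF V(2) W(2) rel(2), of "V1 x"] rel(1)[OF S(2)] by simp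
  have 2: "D (\<lambda>y. D f y (V1 x)) x (V2 x) + D f x (D V1 x (V2 x)) = D W1 (f x) (W2 (f x))"
    using *[OF V(1) W(1) rel(1), of "V2 x"] rel(2)[OF S(2)] by simp
  have 3: "D (\<lambda>y. D f y (V2 x)) x (V1 x) = D (\<lambda>y. D f y (V1 x)) x (V2 x)"
    by (rule symmetric_second_derivative[OF S(1) f S(2)])
  show ?thesis
    unfolding linear_diff[OF lin[OF S(2)]] 1[symmetric] 2[symmetric] 3 by simp
qed

lemma tangent_map_preferred_chart:
  assumes A: "smooth_atlas A"
  shows "tangent_map A std_atlas (snd (chart_at A p)) p v = v"
    and "tangent_map std_atlas A (chart_inv (chart_at A p)) (snd (chart_at A p) p) v = v"
proof -
  note d = chart_at[OF A, of p]
  have "((\<lambda>x. snd (chart_at A p) (chart_inv (chart_at A p) x)) has_derivative (\<lambda>v. v)) (at (snd (chart_at A p) p))"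
    using has_tangent_map_ident[OF A, of p] by (simp add: has_tangent_map_def)
  from D_eqI[OF this] show 1: "tangent_map A std_atlas (snd (chart_at A p)) p v = v" for v
    by (simp add: tangent_map_def o_def)
  show "tangent_map std_atlas A (chart_inv (chart_at A p)) (snd (chart_at A p) p) v = v"
    using tangent_map_chart_inv_chart[OF A d, of v] by (simp only: 1)
qed

lemma local_field_preferred_chart:
  assumes A: "smooth_atlas A"
  shows "local_field A (chart_at A p) X (snd (chart_at A p) p) = X p"
  using chart_at[OF A, of p]
  by (simp add: local_field_def chart_inv_chart[OF A] tangent_map_preferred_chart[OF A])

lemma local_form_preferred_chart:
  assumes A: "smooth_atlas A"
  shows "local_form A (chart_at A p) \<theta> (snd (chart_at A p) p) = \<theta> p"
  using chart_at[OF A, of p]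
  by (simp add: fun_eq_iff local_form_def chart_inv_chart[OF A] tangent_map_preferred_chart[OF A])

lemma form_in_chart:
  assumes A: "smooth_atlas A" and c: "c \<in> A" "p \<in> fst c"
  shows "\<theta> p v = local_form A c \<theta> (snd c p) (tangent_map A std_atlas (snd c) p v)"
  using c by (simp add: local_form_def chart_inv_chart[OF A] tangent_map_chart_inv_chart[OF A])

locale one_form =
  fixes A :: "('m::topological_space, 'e::real_inner) atlas" and \<theta> :: "'m \<Rightarrow> 'e \<Rightarrow> real"
  assumes atlas_A: "smooth_atlas A" and form: "smooth_one_form A \<theta>"
begin

lemma form_linear: "linear (\<theta> p)"
  using form by (simp add: smooth_one_form_def)

lemma local_form_linear:
  assumes "c \<in> A" "x \<in> snd c ` fst c"
  shows "linear (local_form A c \<theta> x)"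
proof -
  have "linear (tangent_map std_atlas A (chart_inv c) x)"
    by (rule has_tangent_map_linear[OF has_tangent_map_chart_inv[OF atlas_A assms]])
  from linear_compose[OF this form_linear] show ?thesis by (simp add: local_form_def[abs_def] o_def)
qed

lemma local_form_smooth: "c \<in> A \<Longrightarrow> smooth_on (snd c ` fst c) (\<lambda>x. local_form A c \<theta> x w)"
  using form by (simp add: smooth_one_form_def)

lemma local_form_field:
  assumes "c \<in> A" "x \<in> snd c ` fst c"
  shows "\<theta> (chart_inv c x) (X (chart_inv c x)) = local_form A c \<theta> x (local_field A c X x)"
  using form_in_chart[OF atlas_A assms(1) chart_inv_in[OF atlas_A assms], of \<theta>]
  by (simp add: local_field_def chart_chart_inv[OF atlas_A assms])

text \<open>In every chart \<open>\<theta>(X)\<close> is the sum over the frame of products of components.\<close>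

lemma form_field_smooth:
  assumes X: "\<And>c. c \<in> A \<Longrightarrow> smooth_on (snd c ` fst c) (local_field A c X)"
  shows "(\<lambda>p. \<theta> p (X p)) \<in> smooth_functions A"
proof -
  obtain E :: "'e set" where E: "frame E" by (rule model_frame_exists[OF atlas_A])
  let ?f = "\<lambda>p. \<theta> p (X p)"
  have sm: "smooth_on (snd c ` fst c) (\<lambda>x. ?f (chart_inv c x))" if c: "c \<in> A" for c
  proof -
    note o = open_chart_range[OF atlas_A c]
    have "smooth_on (snd c ` fst c) (\<lambda>x. \<Sum>b\<in>E. (local_field A c X x \<bullet> b) * local_form A c \<theta> x b)"
      by (intro smooth_on_sum[OF o] smooth_on_bilinear[OF bounded_bilinear_mult o] local_form_smooth[OF c]
          smooth_on_bounded_linear_comp[OF bounded_linear_inner_left o] X[OF c])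
    then show ?thesis
      by (rule smooth_on_cong[OF o, rotated])
         (use frame_linear[OF E local_form_linear[OF c]] in \<open>simp add: local_form_field[OF c]\<close>)
  qed
  have "smooth_map A std_atlas ?f"
  proof (rule smooth_mapI[OF atlas_A])
    have lim: "filterlim ?f (nhds (?f p)) (nhds p)" for p
    proof -
      note c = chart_at[OF atlas_A, of p]
      let ?c = "chart_at A p"
      have "filterlim (\<lambda>x. ?f (chart_inv ?c x)) (nhds (?f (chart_inv ?c (snd ?c p)))) (nhds (snd ?c p))"
        by (rule filterlim_nhds_if_continuous_on[OF smooth_on_imp_continuous[OF sm[OF c(1)]] open_chart_range[OF atlas_A c(1)]])
           (use c in simp)
      from filterlim_compose[OF this filterlim_chart[OF atlas_A c]]
      have "filterlim (\<lambda>q. ?f (chart_inv ?c (snd ?c q))) (nhds (?f p)) (nhds p)"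
        using c by (simp add: chart_inv_chart[OF atlas_A])
      moreover have "\<forall>\<^sub>F q in nhds p. ?f (chart_inv ?c (snd ?c q)) = ?f q"
        using eventually_nhds_in_open[OF open_chart_domain[OF atlas_A c(1)] c(2)]
        by (rule eventually_mono) (simp add: chart_inv_chart[OF atlas_A c(1)])
      ultimately show ?thesis by (simp add: filterlim_cong)
    qed
    show "continuous_on UNIV ?f"
      unfolding continuous_on_def using tendsto_at_iff_tendsto_nhds[of ?f] lim by auto
    fix c d x assume "c \<in> A" "d \<in> (std_atlas :: (real, real) atlas)" "x \<in> snd c ` fst c"
    then show "\<exists>U. open U \<and> x \<in> U \<and> smooth_on U (\<lambda>x. snd d (?f (chart_inv c x)))"
      using open_chart_range[OF atlas_A \<open>c \<in> A\<close>] sm[OF \<open>c \<in> A\<close>]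
      by (intro exI[of _ "snd c ` fst c"]) (simp add: std_atlas_def)
  qed
  then show ?thesis by (simp add: smooth_functions_def)
qed

lemma differential_form_field:
  fixes p :: 'm
  defines "c \<equiv> chart_at A p" and "x \<equiv> snd (chart_at A p) p"
  assumes X: "local_field A c X differentiable at x"
  shows "differential A (\<lambda>p. \<theta> p (X p)) p v =
     D (\<lambda>y. local_form A c \<theta> y (X p)) x v + \<theta> p (D (local_field A c X) x v)"
proof -
  obtain E :: "'e set" where E: "frame E" by (rule model_frame_exists[OF atlas_A])
  have xd: "x = snd c p" by (simp add: c_def x_def)
  have c: "c \<in> A" and xS: "x \<in> snd c ` fst c" using chart_at[OF atlas_A, of p] by (auto simp: c_def x_def)
  note S = open_chart_range[OF atlas_A c]
  have "((\<lambda>y. local_form A c \<theta> y (local_field A c X y)) has_derivative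
      (\<lambda>v. D (\<lambda>y. local_form A c \<theta> y (local_field A c X x)) x v + local_form A c \<theta> x (D (local_field A c X) x v))) (at x)"
    by (rule has_derivative_linear_eval[OF E S xS local_form_linear[OF c]
          smooth_on_imp_differentiable[OF local_form_smooth[OF c] xS] has_derivative_D[OF X]])
  then have "((\<lambda>y. \<theta> (chart_inv c y) (X (chart_inv c y))) has_derivative
      (\<lambda>v. D (\<lambda>y. local_form A c \<theta> y (local_field A c X x)) x v + local_form A c \<theta> x (D (local_field A c X) x v))) (at x)"
    by (rule has_derivative_transform_within_open[OF _ S xS]) (simp add: local_form_field[OF c])
  from D_eqI[OF this] show ?thesis
    using local_field_preferred_chart[OF atlas_A, of p X] local_form_preferred_chart[OF atlas_A, of p \<theta>]
    by (simp add: differential_def tangent_map_def o_def xd flip: c_def)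
qed

lemma ext_deriv_skew: "ext_deriv A \<theta> p u v = - ext_deriv A \<theta> p v u"
  by (simp add: ext_deriv_def Let_def)

lemma ext_deriv_linear_left: "linear (\<lambda>u. ext_deriv A \<theta> p u v)"
proof -
  let ?c = "chart_at A p" and ?x = "snd (chart_at A p) p"
  note c = chart_at[OF atlas_A, of p]
  note S = open_chart_range[OF atlas_A c(1)] and x = imageI[OF c(2), of "snd ?c"]
  have d: "(\<lambda>y. local_form A ?c \<theta> y w) differentiable at ?x" for w
    by (rule smooth_on_imp_differentiable[OF local_form_smooth[OF c(1)] x])
  have 1: "linear (D (\<lambda>y. local_form A ?c \<theta> y w) ?x)" for w by (rule linear_D[OF d])
  have "linear (\<lambda>u. D (\<lambda>y. local_form A ?c \<theta> y u) ?x v)"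
  proof (rule linearI)
    fix u w
    have "((\<lambda>y. local_form A ?c \<theta> y u + local_form A ?c \<theta> y w) has_derivative
        (\<lambda>v. D (\<lambda>y. local_form A ?c \<theta> y u) ?x v + D (\<lambda>y. local_form A ?c \<theta> y w) ?x v)) (at ?x)"
      by (intro has_derivative_add has_derivative_D d)
    then have "((\<lambda>y. local_form A ?c \<theta> y (u + w)) has_derivative
        (\<lambda>v. D (\<lambda>y. local_form A ?c \<theta> y u) ?x v + D (\<lambda>y. local_form A ?c \<theta> y w) ?x v)) (at ?x)"
      by (rule has_derivative_transform_within_open[OF _ S x])
         (simp add: linear_add[OF local_form_linear[OF c(1)]])
    from D_eqI[OF this]
    show "D (\<lambda>y. local_form A ?c \<theta> y (u + w)) ?x v = D (\<lambda>y. local_form A ?c \<theta> y u) ?x v + D (\<lambda>y. local_form A ?c \<theta> y w) ?x v"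
      by simp
  next
    fix r u
    have "((\<lambda>y. r *\<^sub>R local_form A ?c \<theta> y u) has_derivative (\<lambda>v. r *\<^sub>R D (\<lambda>y. local_form A ?c \<theta> y u) ?x v)) (at ?x)"
      by (intro has_derivative_scaleR_right has_derivative_D d)
    then have "((\<lambda>y. local_form A ?c \<theta> y (r *\<^sub>R u)) has_derivative (\<lambda>v. r *\<^sub>R D (\<lambda>y. local_form A ?c \<theta> y u) ?x v)) (at ?x)"
      by (rule has_derivative_transform_within_open[OF _ S x])
         (simp add: linear_scale[OF local_form_linear[OF c(1)]])
    from D_eqI[OF this]
    show "D (\<lambda>y. local_form A ?c \<theta> y (r *\<^sub>R u)) ?x v = r *\<^sub>R D (\<lambda>y. local_form A ?c \<theta> y u) ?x v"
      by simp
  qed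
  then show ?thesis unfolding ext_deriv_def Let_def by (intro linear_compose_sub 1)
qed

lemma ext_deriv_linear_right: "linear (ext_deriv A \<theta> p u)"
proof -
  have "ext_deriv A \<theta> p u = (\<lambda>v. - ext_deriv A \<theta> p v u)" using ext_deriv_skew by blast
  then show ?thesis using linear_compose_neg[OF ext_deriv_linear_left] by simp
qed

end

section \<open>The fundamental vector fields of an action\<close>

locale lie_action = lie_grp G B
  for G :: "'g::topological_space monoid" (structure) and B :: "('g, 'h::{real_inner, banach}) atlas" +
  fixes A :: "('m::topological_space, 'e::real_inner) atlas" and act :: "'g \<Rightarrow> 'm \<Rightarrow> 'm"
  assumes atlas_A: "smooth_atlas A" and action: "smooth_action G B A act"
begin

abbreviation "fund \<equiv> fundamental_field G B A act"

lemma act_smooth: "smooth_map (prod_atlas B A) A (\<lambda>(g, p). act g p)"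
  and group_action: "group_action G UNIV act"
  using action by (simp_all add: smooth_action_def)

lemma act_one [simp]: "act \<one> p = p"
  using fun_cong[OF group_action.id_eq_one[OF group_action], of p] by simp

lemma act_mult: "act (g \<otimes> h) p = act g (act h p)"
  using group_action.composition_rule[OF group_action] by simp

lemma orbit_tangent: "has_tangent_map B A (\<lambda>g. act g p) g (tangent_map B A (\<lambda>g. act g p) g)"
  by (rule has_tangent_map_combine_left[OF atlas_B atlas_A atlas_A act_smooth])

lemma act_tangent: "has_tangent_map A A (act g) p (tangent_map A A (act g) p)"
  by (rule has_tangent_map_combine_right[OF atlas_B atlas_A atlas_A act_smooth])

text \<open>The chain rule for \<open>g \<mapsto> act g p\<close> along the curve \<open>t \<mapsto> exp(-tX)\<close>.\<close>

lemma fund_eq: "fund X p = tangent_map B A (\<lambda>g. act g p) \<one> (- X)"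
proof -
  have "has_tangent_map std_atlas A (\<lambda>t. act (lie_exp G B (- (t *\<^sub>R X))) p) 0
      (\<lambda>s. tangent_map B A (\<lambda>g. act g p) \<one> (s *\<^sub>R (- X)))"
    by (rule has_tangent_map_compose[OF smooth_atlas_std_real atlas_B lie_exp_tangent])
       (simp add: lie_exp_zero orbit_tangent)
  from tangent_map_eqI[OF this] show ?thesis by (simp add: fundamental_field_def velocity_def)
qed

lemma fund_add: "fund (X + Y) p = fund X p + fund Y p"
  using linear_add[OF has_tangent_map_linear[OF orbit_tangent[of p \<one>]], of "- X" "- Y"] by (simp add: fund_eq)

lemma fund_scale: "fund (a *\<^sub>R X) p = a *\<^sub>R fund X p"
  using linear_scale[OF has_tangent_map_linear[OF orbit_tangent[of p \<one>]], of a "- X"] by (simp add: fund_eq)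

text \<open>The action near the identity in coordinates. Source and target use the same chart \<open>d\<close>, so that at the
coordinate of the identity this is the identity in the second variable.\<close>

definition local_act :: "('m, 'e) chart \<Rightarrow> 'h \<times> 'e \<Rightarrow> 'e" where
  "local_act d z = snd d (act (chart_inv (chart_at B \<one>) (fst z)) (chart_inv d (snd z)))"

definition local_act_domain :: "('m, 'e) chart \<Rightarrow> ('h \<times> 'e) set" where
  "local_act_domain d = {z. fst z \<in> snd (chart_at B \<one>) ` fst (chart_at B \<one>) \<and> snd z \<in> snd d ` fst d \<and>
     act (chart_inv (chart_at B \<one>) (fst z)) (chart_inv d (snd z)) \<in> fst d}"

abbreviation unit_coord :: 'h where
  "unit_coord \<equiv> snd (chart_at B \<one>) \<one>"

lemma chart_inv_unit_coord [simp]: "chart_inv (chart_at B \<one>) unit_coord = \<one>"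
  using chart_at[OF atlas_B, of \<one>] by (simp add: chart_inv_chart[OF atlas_B])

context
  fixes d assumes d: "d \<in> A"
begin

lemma open_local_act_domain: "open (local_act_domain d)"
  and smooth_local_act: "smooth_on (local_act_domain d) (local_act d)"
  using smooth_map_prod_in_charts[OF atlas_B atlas_A atlas_A act_smooth chart_at(1)[OF atlas_B, of \<one>] d d]
  by (simp_all add: local_act_domain_def local_act_def[abs_def])

lemma unit_in_local_act_domain: "y \<in> snd d ` fst d \<Longrightarrow> (unit_coord, y) \<in> local_act_domain d"
  using chart_at(2)[OF atlas_B, of \<one>] chart_inv_in[OF atlas_A d] by (simp add: local_act_domain_def)

lemma local_act_unit: "y \<in> snd d ` fst d \<Longrightarrow> local_act d (unit_coord, y) = y"
  by (simp add: local_act_def chart_chart_inv[OF atlas_A d])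

lemma D_local_act_unit:
  assumes y: "y \<in> snd d ` fst d"
  shows "D (local_act d) (unit_coord, y) (0, w) = w"
proof -
  have "((\<lambda>y. local_act d (unit_coord, y)) has_derivative (\<lambda>w. D (local_act d) (unit_coord, y) (0, w))) (at y)"
    by (rule D_section(2)[OF smooth_on_imp_differentiable[OF smooth_local_act unit_in_local_act_domain[OF y]]])
  then have "((\<lambda>y. y) has_derivative (\<lambda>w. D (local_act d) (unit_coord, y) (0, w))) (at y)"
    by (rule has_derivative_transform_within_open[OF _ open_chart_range[OF atlas_A d] y]) (simp add: local_act_unit)
  from has_derivative_unique[OF this has_derivative_ident] show ?thesis by (rule fun_cong)
qed

text \<open>The fundamental field is a partial derivative of the action in the group variable.\<close>

lemma local_fund:
  assumes y: "y \<in> snd d ` fst d"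
  shows "local_field A d (fund X) y = D (local_act d) (unit_coord, y) (- X, 0)"
proof -
  have "local_field A d (fund X) y
      = D (\<lambda>x. snd d (act (chart_inv (chart_at B \<one>) x) (chart_inv d y))) unit_coord (- X)"
    using tangent_map_in_target_chart[OF atlas_B atlas_A orbit_tangent[of "chart_inv d y" \<one>] d]
    by (simp add: local_field_def fund_eq chart_inv_in[OF atlas_A d y])
  also have "\<dots> = D (local_act d) (unit_coord, y) (- X, 0)"
    using D_eqI[OF D_section(1)[OF smooth_on_imp_differentiable[OF smooth_local_act unit_in_local_act_domain[OF y]]]]
    by (simp add: local_act_def)
  finally show ?thesis .
qed

lemma smooth_local_fund: "smooth_on (snd d ` fst d) (local_field A d (fund X))"
proof -
  obtain E :: "'h set" where E: "frame E" by (rule model_frame_exists[OF atlas_B])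
  obtain E' :: "'e set" where E': "frame E'" by (rule model_frame_exists[OF atlas_A])
  have "smooth_on (snd d ` fst d) (\<lambda>y. D (local_act d) (unit_coord, y) (- X, 0))"
    by (rule smooth_on_subset[OF smooth_on_section(2)[OF E E' open_local_act_domain smooth_on_D_const[OF smooth_local_act]]])
       (use unit_in_local_act_domain in blast)
  then show ?thesis
    by (rule smooth_on_cong[OF open_chart_range[OF atlas_A d], rotated]) (simp add: local_fund)
qed

end

text \<open>Left-invariant fields are not related to fundamental fields by \<open>g \<mapsto> g p\<close>, but by \<open>g \<mapsto> g\<^sup>-\<^sup>1 p\<close>: since
\<open>(g h)\<^sup>-\<^sup>1 p = h\<^sup>-\<^sup>1 (g\<^sup>-\<^sup>1 p)\<close>, differentiating in \<open>h\<close> at the identity gives the fundamental field at the point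
\<open>g\<^sup>-\<^sup>1 p\<close>. This is where the sign convention for fundamental fields yields a homomorphism.\<close>

lemma inverse_orbit_related:
  "has_tangent_map B A (\<lambda>g. act (inv g) p) g (tangent_map B A (\<lambda>g. act (inv g) p) g)"
  "tangent_map B A (\<lambda>g. act (inv g) p) g (left_inv_field G B X g) = fund X (act (inv g) p)"
proof -
  have tm: "has_tangent_map B A (\<lambda>g. act (inv g) p) g
      (\<lambda>v. tangent_map B A (\<lambda>g. act g p) (inv g) (tangent_map B B (\<lambda>h. inv h) g v))" for p g
    by (rule has_tangent_map_compose[OF atlas_B atlas_B inv_tangent orbit_tangent])
  then show tm': "has_tangent_map B A (\<lambda>g. act (inv g) p) g (tangent_map B A (\<lambda>g. act (inv g) p) g)" for g
    by (rule has_tangent_map_tangent_map)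
  have "has_tangent_map B A (\<lambda>h. act (inv (g \<otimes> h)) p) \<one>
      (\<lambda>v. tangent_map B A (\<lambda>g. act (inv g) p) g (tangent_map B B (\<lambda>h. g \<otimes> h) \<one> v))"
    by (rule has_tangent_map_compose[OF atlas_B atlas_B left_mult_tangent]) (simp add: tm')
  then have "has_tangent_map B A (\<lambda>h. act (inv h) (act (inv g) p)) \<one>
      (\<lambda>v. tangent_map B A (\<lambda>g. act (inv g) p) g (tangent_map B B (\<lambda>h. g \<otimes> h) \<one> v))"
    by (simp add: inv_mult_group act_mult)
  from tangent_map_eqI[OF this] tangent_map_eqI[OF tm[of "act (inv g) p" \<one>]]
  have "tangent_map B A (\<lambda>g. act (inv g) p) g (tangent_map B B (\<lambda>h. g \<otimes> h) \<one> v)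
      = tangent_map B A (\<lambda>h. act h (act (inv g) p)) \<one> (- v)" for v
    by (simp add: tangent_map_inv_one fun_eq_iff)
  then show "tangent_map B A (\<lambda>g. act (inv g) p) g (left_inv_field G B X g) = fund X (act (inv g) p)"
    by (simp add: left_inv_field_def fund_eq)
qed

text \<open>The inverse orbit map relates the left-invariant fields to the fundamental fields, hence also their
brackets; at the identity it maps any \<open>Z\<close> to the fundamental vector of \<open>Z\<close> at \<open>p\<close>.\<close>

lemma fund_lie_bracket: "fund (lie_bracket G B X Y) p = vf_bracket A (fund X) (fund Y) p"
proof -
  obtain E :: "'h set" where E: "frame E" by (rule model_frame_exists[OF atlas_B])
  let ?c = "chart_at B \<one>" and ?d = "chart_at A p" and ?o = "\<lambda>g. act (inv g) p"
  note c = chart_at[OF atlas_B, of \<one>] and d = chart_at[OF atlas_A, of p]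
  define f where "f = (\<lambda>x. snd ?d (?o (chart_inv ?c x)))"
  define S where "S = {x \<in> snd ?c ` fst ?c. ?o (chart_inv ?c x) \<in> fst ?d}"
  have "smooth_map B A ?o"
    by (rule smooth_map_compose[OF atlas_B atlas_B atlas_A inv_smooth smooth_map_section(1)[OF atlas_B atlas_A atlas_A act_smooth]])
  from smooth_map_in_charts[OF atlas_B atlas_A this c(1) d(1)]
  have S: "open S" and f: "smooth_on S f" by (simp_all add: S_def f_def)
  have e: "unit_coord \<in> S" using c d by (simp add: S_def)
  have fe: "f unit_coord = snd ?d p" by (simp add: f_def)
  let ?V = "\<lambda>X. local_field B ?c (left_inv_field G B X)" and ?W = "\<lambda>X. local_field A ?d (fund X)"
  have rel: "D f x (?V X x) = ?W X (f x)" if x: "x \<in> S" for x X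
  proof -
    have xc: "x \<in> snd ?c ` fst ?c" and od: "?o (chart_inv ?c x) \<in> fst ?d" using x by (auto simp: S_def)
    have "(f has_derivative (\<lambda>w. tangent_map A std_atlas (snd ?d) (?o (chart_inv ?c x))
        (tangent_map B A ?o (chart_inv ?c x) (tangent_map std_atlas B (chart_inv ?c) x w)))) (at x)"
      using has_tangent_map_in_charts[OF atlas_B atlas_A inverse_orbit_related(1) c(1) chart_inv_in[OF atlas_B c(1) xc] d(1) od]
      by (simp add: f_def chart_chart_inv[OF atlas_B c(1) xc])
    from D_eqI[OF this]
    have "D f x (?V X x) = tangent_map A std_atlas (snd ?d) (?o (chart_inv ?c x)) (fund X (?o (chart_inv ?c x)))"
      using tangent_map_chart_inv_chart[OF atlas_B c(1) chart_inv_in[OF atlas_B c(1) xc]]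
      by (simp add: local_field_def chart_chart_inv[OF atlas_B c(1) xc] inverse_orbit_related(2))
    also have "\<dots> = ?W X (f x)"
      using od by (simp add: local_field_def f_def chart_inv_chart[OF atlas_A d(1)])
    finally show ?thesis .
  qed
  have V: "?V X differentiable at unit_coord" for X
    by (rule smooth_on_imp_differentiable[OF smooth_left_inv_field[OF c(1)] imageI[OF c(2)]])
  have W: "?W X differentiable at (f unit_coord)" for X
    unfolding fe by (rule smooth_on_imp_differentiable[OF smooth_local_fund[OF d(1)] imageI[OF d(2)]])
  have "D f unit_coord (D (?V Y) unit_coord (?V X unit_coord) - D (?V X) unit_coord (?V Y unit_coord))
      = D (?W Y) (f unit_coord) (?W X (f unit_coord)) - D (?W X) (f unit_coord) (?W Y (f unit_coord))"
    by (rule related_fields_bracket[OF E S e f V V W W rel rel])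
  then have "D f unit_coord (lie_bracket G B X Y) = vf_bracket A (fund X) (fund Y) p"
    by (simp add: lie_bracket_def vf_bracket_def Let_def fe)
  moreover have "D f unit_coord Z = fund Z p" for Z
    using rel[OF e, of Z] local_field_preferred_chart[OF atlas_B, of \<one> "left_inv_field G B Z"]
      local_field_preferred_chart[OF atlas_A, of p "fund Z"] by (simp add: fe)
  ultimately show ?thesis by simp
qed

end

section \<open>Invariant forms\<close>

locale invariant_one_form = lie_action G B A act + one_form A \<theta>
  for G :: "'g::topological_space monoid" (structure) and B :: "('g, 'h::{real_inner, banach}) atlas"
    and A :: "('m::topological_space, 'e::real_inner) atlas" and act and \<theta> +
  assumes invariant: "preserves_form A act \<theta>"
begin

lemma local_form_invariant:
  assumes d: "d \<in> A" and z: "(x, y) \<in> local_act_domain d"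
  shows "local_form A d \<theta> (local_act d (x, y)) (D (local_act d) (x, y) (0, w)) = local_form A d \<theta> y w"
proof -
  let ?g = "chart_inv (chart_at B \<one>) x" and ?q = "chart_inv d y"
  have y: "y \<in> snd d ` fst d" and gq: "act ?g ?q \<in> fst d" using z by (auto simp: local_act_domain_def)
  let ?v = "tangent_map std_atlas A (chart_inv d) y w"
  have 1: "((\<lambda>y. local_act d (x, y)) has_derivative
      (\<lambda>w. tangent_map A std_atlas (snd d) (act ?g ?q) (tangent_map A A (act ?g) ?q (tangent_map std_atlas A (chart_inv d) y w)))) (at y)"
    using has_tangent_map_in_charts[OF atlas_A atlas_A act_tangent d chart_inv_in[OF atlas_A d y] d gq]
    by (simp add: local_act_def chart_chart_inv[OF atlas_A d y])
  have 2: "((\<lambda>y. local_act d (x, y)) has_derivative (\<lambda>w. D (local_act d) (x, y) (0, w))) (at y)"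
    by (rule D_section(2)[OF smooth_on_imp_differentiable[OF smooth_local_act[OF d] z]])
  have "D (local_act d) (x, y) (0, w) = tangent_map A std_atlas (snd d) (act ?g ?q) (tangent_map A A (act ?g) ?q ?v)"
    using fun_cong[OF has_derivative_unique[OF 2 1]] .
  moreover have "local_act d (x, y) = snd d (act ?g ?q)" by (simp add: local_act_def)
  ultimately have "local_form A d \<theta> (local_act d (x, y)) (D (local_act d) (x, y) (0, w))
      = \<theta> (act ?g ?q) (tangent_map A A (act ?g) ?q ?v)"
    by (simp add: form_in_chart[OF atlas_A d gq, symmetric])
  also have "\<dots> = \<theta> ?q ?v" using invariant by (simp add: preserves_form_def)
  also have "\<dots> = local_form A d \<theta> y w" by (simp add: local_form_def)
  finally show ?thesis .
qed

text \<open>This is the coordinate form of \<open>L\<^sub>F \<theta> = 0\<close> for the fundamental field \<open>F\<close>. With \<open>a(x, y)\<close> the action in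
coordinates, invariance says that \<open>\<theta>\<^bsub>a(x,y)\<^esub>(\<partial>\<^sub>y a(x, y) w)\<close> does not depend on \<open>x\<close>. Its derivative at the
identity has two terms: the change of the base point gives the first one, and the second one arises from
\<open>\<partial>\<^sub>x \<partial>\<^sub>y a = \<partial>\<^sub>y \<partial>\<^sub>x a\<close>, since the derivative of \<open>a\<close> in \<open>x\<close> at the identity, in direction \<open>-X\<close>, is \<open>F\<close>.\<close>

lemma lie_derivative_zero:
  assumes d: "d \<in> A" and y: "y \<in> snd d ` fst d"
  shows "D (\<lambda>z. local_form A d \<theta> z w) y (local_field A d (fund X) y)
     + local_form A d \<theta> y (D (local_field A d (fund X)) y w) = 0"
proof -
  obtain E :: "'e set" where E: "frame E" by (rule model_frame_exists[OF atlas_A])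
  let ?a = "local_act d" and ?\<Theta> = "local_form A d \<theta>" and ?u = unit_coord and ?\<Omega> = "local_act_domain d"
  note a = smooth_local_act[OF d] and \<Omega> = open_local_act_domain[OF d] and uy = unit_in_local_act_domain[OF d y]
  let ?S = "{x. (x, y) \<in> ?\<Omega>}"
  have S: "open ?S" "?u \<in> ?S" using open_section(1)[OF \<Omega>] uy by simp_all
  have ay: "?a (?u, y) = y" by (rule local_act_unit[OF d y])
  have da: "((\<lambda>x. ?a (x, y)) has_derivative (\<lambda>v. D ?a (?u, y) (v, 0))) (at ?u)"
    by (rule D_section(1)[OF smooth_on_imp_differentiable[OF a uy]])
  have d\<Theta>: "((\<lambda>x. ?\<Theta> (?a (x, y)) b) has_derivative (\<lambda>v. D (\<lambda>z. ?\<Theta> z b) y (D ?a (?u, y) (v, 0)))) (at ?u)" for b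
    using has_derivative_compose[OF da, of "\<lambda>z. ?\<Theta> z b" "D (\<lambda>z. ?\<Theta> z b) y"]
      smooth_on_has_derivative[OF local_form_smooth[OF d] y, of b] by (simp add: ay)
  have dW: "((\<lambda>x. D ?a (x, y) (0, w)) has_derivative (\<lambda>v. D (\<lambda>z. D ?a z (0, w)) (?u, y) (v, 0))) (at ?u)"
    by (rule D_section(1)[OF smooth_on_imp_differentiable[OF smooth_on_D_const[OF a] uy]])
  have lin: "linear (?\<Theta> (?a (x, y)))" if "x \<in> ?S" for x
    using that by (intro local_form_linear[OF d]) (simp add: local_act_domain_def local_act_def)
  have "((\<lambda>x. ?\<Theta> (?a (x, y)) (D ?a (x, y) (0, w))) has_derivative
      (\<lambda>v. D (\<lambda>x. ?\<Theta> (?a (x, y)) (D ?a (?u, y) (0, w))) ?u v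
         + ?\<Theta> (?a (?u, y)) (D (\<lambda>z. D ?a z (0, w)) (?u, y) (v, 0)))) (at ?u)"
    by (rule has_derivative_linear_eval[OF E S lin _ dW]) (use d\<Theta> in \<open>auto simp: differentiable_def\<close>)
  then have "((\<lambda>x. ?\<Theta> y w) has_derivative
      (\<lambda>v. D (\<lambda>x. ?\<Theta> (?a (x, y)) (D ?a (?u, y) (0, w))) ?u v
         + ?\<Theta> (?a (?u, y)) (D (\<lambda>z. D ?a z (0, w)) (?u, y) (v, 0)))) (at ?u)"
    by (rule has_derivative_transform_within_open[OF _ S]) (simp add: local_form_invariant[OF d])
  \<comment> \<open>The direction is \<open>- X\<close> because the fundamental field is the partial derivative in this direction.\<close>
  from fun_cong[OF has_derivative_unique[OF this has_derivative_const], of "- X"]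
  have "D (\<lambda>z. ?\<Theta> z w) y (D ?a (?u, y) (- X, 0)) + ?\<Theta> y (D (\<lambda>z. D ?a z (0, w)) (?u, y) (- X, 0)) = 0"
    by (simp add: D_local_act_unit[OF d y] ay D_eqI[OF d\<Theta>])
  also have "D (\<lambda>z. D ?a z (0, w)) (?u, y) (- X, 0) = D (\<lambda>z. D ?a z (- X, 0)) (?u, y) (0, w)"
    by (rule symmetric_second_derivative[OF \<Omega> a uy])
  also have "\<dots> = D (local_field A d (fund X)) y w"
  proof -
    have "((\<lambda>z. D ?a (?u, z) (- X, 0)) has_derivative (\<lambda>w. D (\<lambda>z. D ?a z (- X, 0)) (?u, y) (0, w))) (at y)"
      by (rule D_section(2)[OF smooth_on_imp_differentiable[OF smooth_on_D_const[OF a] uy]])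
    then have "(local_field A d (fund X) has_derivative (\<lambda>w. D (\<lambda>z. D ?a z (- X, 0)) (?u, y) (0, w))) (at y)"
      by (rule has_derivative_transform_within_open[OF _ open_chart_range[OF atlas_A d] y]) (simp add: local_fund[OF d])
    from D_eqI[OF this] show ?thesis by simp
  qed
  finally show ?thesis by (simp add: local_fund[OF d y])
qed

lemma momentum_smooth: "momentum G B A act \<theta> X \<in> smooth_functions A"
  unfolding momentum_def by (rule form_field_smooth[OF smooth_local_fund])

lemma momentum_add: "momentum G B A act \<theta> (X + Y) p = momentum G B A act \<theta> X p + momentum G B A act \<theta> Y p"
  by (simp add: momentum_def fund_add linear_add[OF form_linear])

lemma momentum_scale: "momentum G B A act \<theta> (a *\<^sub>R X) p = a * momentum G B A act \<theta> X p"
  by (simp add: momentum_def fund_scale linear_scale[OF form_linear])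

lemma differential_momentum:
  "differential A (momentum G B A act \<theta> X) p v
   = D (\<lambda>y. local_form A (chart_at A p) \<theta> y (fund X p)) (snd (chart_at A p) p) v
     + \<theta> p (D (local_field A (chart_at A p) (fund X)) (snd (chart_at A p) p) v)"
  unfolding momentum_def
  using chart_at[OF atlas_A, of p]
  by (intro differential_form_field smooth_on_imp_differentiable[OF smooth_local_fund]) auto

lemma lie_derivative_zero_at:
  "D (\<lambda>y. local_form A (chart_at A p) \<theta> y w) (snd (chart_at A p) p) (fund X p)
   + \<theta> p (D (local_field A (chart_at A p) (fund X)) (snd (chart_at A p) p) w) = 0"
  using lie_derivative_zero[OF chart_at(1)[OF atlas_A] imageI[OF chart_at(2)[OF atlas_A]], of p w X]
  by (simp add: local_field_preferred_chart[OF atlas_A] local_form_preferred_chart[OF atlas_A])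

text \<open>Cartan's formula \<open>L\<^sub>F \<theta> = \<iota>(F) d\<theta> + d(\<theta>(F))\<close> for the invariant form \<open>\<theta>\<close>.\<close>

lemma contraction_ext_deriv: "ext_deriv A \<theta> p (fund X p) w = - differential A (momentum G B A act \<theta> X) p w"
  using lie_derivative_zero_at[of p w X] differential_momentum[of X p w]
  by (simp add: ext_deriv_def Let_def)

text \<open>For \<open>L\<^sub>F \<theta> = 0\<close>, the function \<open>F \<cdot> \<theta>(F')\<close> equals \<open>\<theta>([F, F'])\<close>.\<close>

lemma momentum_derivative_along_fund:
  "differential A (momentum G B A act \<theta> Y) p (fund X p) = momentum G B A act \<theta> (lie_bracket G B X Y) p"
proof -
  have "momentum G B A act \<theta> (lie_bracket G B X Y) p = \<theta> p (vf_bracket A (fund X) (fund Y) p)"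
    by (simp add: momentum_def fund_lie_bracket)
  also have "\<dots> = \<theta> p (D (local_field A (chart_at A p) (fund Y)) (snd (chart_at A p) p) (fund X p))
      - \<theta> p (D (local_field A (chart_at A p) (fund X)) (snd (chart_at A p) p) (fund Y p))"
    by (simp add: vf_bracket_def Let_def local_field_preferred_chart[OF atlas_A] linear_diff[OF form_linear])
  finally show ?thesis
    using lie_derivative_zero_at[of p "fund Y p" X] differential_momentum[of Y p "fund X p"] by simp
qed

end

section \<open>The momentum map of an invariant contact form\<close>

text \<open>At each point, \<open>\<theta>\<close> and \<open>d\<theta>\<close> satisfy the hypotheses of the linear algebra above, so the description
defining the Reeb vector is proper.\<close>

lemma
  fixes A :: "('m::topological_space, 'e::euclidean_space) atlas"
  assumes A: "smooth_atlas A" and \<theta>: "contact_form A n \<theta>"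
  shows contact_form_kernel: "\<theta> p u = 0 \<Longrightarrow> (\<And>w. ext_deriv A \<theta> p u w = 0) \<Longrightarrow> u = 0"
    and reeb_contact: "\<theta> p (reeb A \<theta> p) = 1" "ext_deriv A \<theta> p (reeb A \<theta> p) w = 0"
proof -
  interpret one_form A \<theta>
    using A \<theta> by unfold_locales (auto simp: contact_form_def)
  have dim: "DIM('e) = 2 * n + 1" using \<theta> by (simp add: contact_form_def)
  obtain v where v: "wedge 1 (2 * n) (\<lambda>w. \<theta> p (w 0)) (wedge_power (\<lambda>w. ext_deriv A \<theta> p (w 0) (w 1)) n) v \<noteq> 0"
    using \<theta> unfolding contact_form_def by blast
  show ker: "u = 0" if "\<theta> p u = 0" "\<And>w. ext_deriv A \<theta> p u w = 0" for u
    by (rule contact_form_nondegenerate[OF dim form_linear ext_deriv_linear_left ext_deriv_linear_right v that])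
       (use ext_deriv_skew[of p _ u] that(2) in simp)
  have "odd DIM('e)" using dim by simp
  then obtain r where r: "\<theta> p r = 1" "\<forall>w. ext_deriv A \<theta> p r w = 0"
    using reeb_vector_exists[OF _ form_linear ext_deriv_linear_left ext_deriv_skew ker] by blast
  have "reeb A \<theta> p = r"
    unfolding reeb_def
  proof (rule the_equality)
    show "v = r" if v: "\<theta> p v = 1 \<and> (\<forall>w. ext_deriv A \<theta> p v w = 0)" for v
    proof -
      have "v - r = 0"
        by (rule ker) (use v r in \<open>simp_all add: linear_diff[OF form_linear] linear_diff[OF ext_deriv_linear_left]\<close>)
      then show ?thesis by simp
    qed
  qed (use r in simp)
  then show "\<theta> p (reeb A \<theta> p) = 1" "ext_deriv A \<theta> p (reeb A \<theta> p) w = 0" using r by simp_all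
qed

theorem theorem1p2:
  fixes A :: "('m::{t2_space, second_countable_topology}, 'e::euclidean_space) atlas"
    and n :: nat
    and \<theta> :: "'m \<Rightarrow> 'e \<Rightarrow> real"
    and G :: "'g::{t2_space, second_countable_topology} monoid"
    and B :: "('g, 'h::{real_inner, banach}) atlas"
    and act :: "'g \<Rightarrow> 'm \<Rightarrow> 'm"
  assumes "compact (UNIV :: 'm set)" and "smooth_atlas A" and "contact_form A n \<theta>"
    and "compact (UNIV :: 'g set)" and "lie_group G B"
    and "smooth_action G B A act" and "preserves_form A act \<theta>"
  shows "((\<forall>X. momentum G B A act \<theta> X \<in> smooth_functions A) \<and>
          (\<forall>X Y. momentum G B A act \<theta> (X + Y) =
                 (\<lambda>p. momentum G B A act \<theta> X p + momentum G B A act \<theta> Y p)) \<and>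
          (\<forall>a X. momentum G B A act \<theta> (a *\<^sub>R X) = (\<lambda>p. a * momentum G B A act \<theta> X p)) \<and>
          (\<forall>X Y. momentum G B A act \<theta> (lie_bracket G B X Y) =
                 jacobi_bracket A \<theta> (momentum G B A act \<theta> X) (momentum G B A act \<theta> Y))) \<and>
         (\<forall>X. hamiltonian_field A \<theta> (momentum G B A act \<theta> X) = fundamental_field G B A act X)"
proof -
  interpret invariant_one_form G B A act \<theta>
    using assms by unfold_locales (auto simp: contact_form_def)
  note reeb = reeb_contact[OF assms(2,3)]
  let ?\<Phi> = "momentum G B A act \<theta>"
  \<comment> \<open>\<open>\<xi> \<cdot> \<Phi>\<^sub>X = - d\<theta>(F\<^sub>X, \<xi>) = d\<theta>(\<xi>, F\<^sub>X) = 0\<close>\<close>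
  have d\<Phi>_reeb: "differential A (?\<Phi> X) p (reeb A \<theta> p) = 0" for X p
    using contraction_ext_deriv[of p X "reeb A \<theta> p"] ext_deriv_skew[of p "fund X p" "reeb A \<theta> p"] reeb(2) by simp
  have "sharp A \<theta> p (differential A (?\<Phi> X) p) = fund X p - ?\<Phi> X p *\<^sub>R reeb A \<theta> p" for X p
    unfolding sharp_def
  proof (rule the_equality)
    \<comment> \<open>Subtracting the Reeb component makes the vector horizontal and keeps its contraction with \<open>d\<theta>\<close>.\<close>
    let ?v = "fund X p - ?\<Phi> X p *\<^sub>R reeb A \<theta> p"
    have v: "\<theta> p ?v = 0" "ext_deriv A \<theta> p ?v w = - differential A (?\<Phi> X) p w" for w
      using reeb
      by (simp_all add: linear_diff[OF form_linear] linear_scale[OF form_linear] contraction_ext_deriv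
          linear_diff[OF ext_deriv_linear_left] linear_scale[OF ext_deriv_linear_left])
        (simp add: momentum_def)
    then show "\<theta> p ?v = 0 \<and> (\<forall>w. ext_deriv A \<theta> p ?v w =
        differential A (?\<Phi> X) p (reeb A \<theta> p) * \<theta> p w - differential A (?\<Phi> X) p w)"
      by (simp add: d\<Phi>_reeb)
    fix u assume u: "\<theta> p u = 0 \<and> (\<forall>w. ext_deriv A \<theta> p u w =
        differential A (?\<Phi> X) p (reeb A \<theta> p) * \<theta> p w - differential A (?\<Phi> X) p w)"
    have "u - ?v = 0"
    proof (rule contact_form_kernel[OF assms(2,3)])
      show "\<theta> p (u - ?v) = 0" using u v(1) by (simp add: linear_diff[OF form_linear])
      show "ext_deriv A \<theta> p (u - ?v) w = 0" for w
      proof -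
        have "ext_deriv A \<theta> p (u - ?v) w = ext_deriv A \<theta> p u w - ext_deriv A \<theta> p ?v w"
          by (rule linear_diff[OF ext_deriv_linear_left])
        then show ?thesis using u v(2)[of w] by (simp add: d\<Phi>_reeb)
      qed
    qed
    then show "u = ?v" by simp
  qed
  then have ham: "hamiltonian_field A \<theta> (?\<Phi> X) = fund X" for X
    by (simp add: hamiltonian_field_def fun_eq_iff)
  have "jacobi_bracket A \<theta> (?\<Phi> X) (?\<Phi> Y) = ?\<Phi> (lie_bracket G B X Y)" for X Y
    by (simp add: jacobi_bracket_def vf_apply_def ham d\<Phi>_reeb momentum_derivative_along_fund)
  then show ?thesis
    using ham momentum_smooth momentum_add momentum_scale by (simp add: fun_eq_iff)
qed

end
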